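(* Let $K$ be a field, $E$ an elliptic curve over $K$ given by a Weierstrass equation, and $p$ an odd prime with $p\equiv 2\pmod 3$ and $p\neq\mathrm{char}(K)$. Let $P_1=(x_1,y_1)$, $P_2=(x_2,y_2)$ be a $\mathbb{Z}/p\mathbb{Z}$-basis of $E[p]$ and $\zeta_p$ a primitive $p$-th root of unity. Then $K(E[p])=K(x_1,y_1,y_2)$ or $K(E[p])=K(x_1,y_1,\zeta_p)$.
   Context: $E[p]$ is the $p$-torsion subgroup of $E(\overline{K})$; $K(E[p])$ is the field obtained from $K$ by adjoining the coordinates of all points of $E[p]$. *)

theory Defs
  imports
    "HOL-Algebra.Algebraic_Closure_Type"
    "HOL-Algebra.Generated_Fields"
    "HOL-Number_Theory.Cong"
begin

section \<open>Weierstrass equations\<close>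

text \<open>
  \<open>Weierstrass a1 a2 a3 a4 a6\<close> stands for the general equation
  \<open>y\<^sup>2 + a1 x y + a3 y = x\<^sup>3 + a2 x\<^sup>2 + a4 x + a6\<close>, so that fields of characteristic 2 and 3 are covered.
  The map function \<open>map_weierstrass\<close> of the datatype is base change along a field embedding.
\<close>

datatype 'a weierstrass =
  Weierstrass (wa1: 'a) (wa2: 'a) (wa3: 'a) (wa4: 'a) (wa6: 'a)

definition w_discriminant :: "'a::field weierstrass \<Rightarrow> 'a" where
  "w_discriminant W =
    (let b2 = (wa1 W)\<^sup>2 + 4 * wa2 W;
         b4 = 2 * wa4 W + wa1 W * wa3 W;
         b6 = (wa3 W)\<^sup>2 + 4 * wa6 W;
         b8 = (wa1 W)\<^sup>2 * wa6 W + 4 * wa2 W * wa6 W - wa1 W * wa3 W * wa4 W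
              + wa2 W * (wa3 W)\<^sup>2 - (wa4 W)\<^sup>2
     in - b2\<^sup>2 * b8 - 8 * b4 ^ 3 - 27 * b6\<^sup>2 + 9 * b2 * b4 * b6)"

definition elliptic_curve :: "'a::field weierstrass \<Rightarrow> bool" where
  "elliptic_curve W \<longleftrightarrow> w_discriminant W \<noteq> 0"

definition on_curve :: "'a::field weierstrass \<Rightarrow> 'a \<Rightarrow> 'a \<Rightarrow> bool" where
  "on_curve W x y \<longleftrightarrow>
     y\<^sup>2 + wa1 W * x * y + wa3 W * y = x ^ 3 + wa2 W * x\<^sup>2 + wa4 W * x + wa6 W"


section \<open>The group of points\<close>

datatype 'a point = Infinity | Affine 'a 'a

definition ec_points :: "'a::field weierstrass \<Rightarrow> 'a point set" where
  "ec_points W = insert Infinity {Affine x y |x y. on_curve W x y}"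

text \<open>
  The chord-tangent law. The first test says that the second point is the negative of the first one;
  otherwise \<open>l\<close> is the slope and \<open>n\<close> the intercept of the line through the two points
  (the tangent line if they coincide).
\<close>

fun ec_add :: "'a::field weierstrass \<Rightarrow> 'a point \<Rightarrow> 'a point \<Rightarrow> 'a point" where
  "ec_add W Infinity Q = Q"
| "ec_add W (Affine x1 y1) Infinity = Affine x1 y1"
| "ec_add W (Affine x1 y1) (Affine x2 y2) =
    (if x1 = x2 \<and> y1 + y2 + wa1 W * x1 + wa3 W = 0 then Infinity
     else
       let l = (if x1 \<noteq> x2 then (y2 - y1) / (x2 - x1)
                else (3 * x1\<^sup>2 + 2 * wa2 W * x1 + wa4 W - wa1 W * y1)
                     / (2 * y1 + wa1 W * x1 + wa3 W));
           n = y1 - l * x1;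
           x3 = l\<^sup>2 + wa1 W * l - wa2 W - x1 - x2
       in Affine x3 (- (l + wa1 W) * x3 - n - wa3 W))"

text \<open>The group is written multiplicatively: the multiple \<open>nP\<close> is \<open>P [^] n\<close>.\<close>

definition ec_group :: "'a::field weierstrass \<Rightarrow> 'a point monoid" where
  "ec_group W = \<lparr>carrier = ec_points W, monoid.mult = ec_add W, one = Infinity\<rparr>"

definition torsion :: "('a, 'b) monoid_scheme \<Rightarrow> nat \<Rightarrow> 'a set" where
  "torsion G n = {P \<in> carrier G. P [^]\<^bsub>G\<^esub> n = \<one>\<^bsub>G\<^esub>}"

text \<open>
  A \<open>\<int>/n\<int>\<close>-basis consisting of two elements. Residue classes are represented by natural numbers.
\<close>

definition torsion_basis :: "('a, 'b) monoid_scheme \<Rightarrow> nat \<Rightarrow> 'a \<Rightarrow> 'a \<Rightarrow> bool" where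
  "torsion_basis G n P Q \<longleftrightarrow>
     P \<in> torsion G n \<and> Q \<in> torsion G n \<and>
     (\<forall>R \<in> torsion G n. \<exists>(i::nat) (j::nat). R = P [^]\<^bsub>G\<^esub> i \<otimes>\<^bsub>G\<^esub> Q [^]\<^bsub>G\<^esub> j) \<and>
     (\<forall>(i::nat) (j::nat). P [^]\<^bsub>G\<^esub> i \<otimes>\<^bsub>G\<^esub> Q [^]\<^bsub>G\<^esub> j = \<one>\<^bsub>G\<^esub> \<longrightarrow> n dvd i \<and> n dvd j)"


section \<open>Fields of definition inside the algebraic closure\<close>

definition ec_closure_group :: "'k::field weierstrass \<Rightarrow> 'k alg_closure point monoid" where
  "ec_closure_group E = ec_group (map_weierstrass to_ac E)"

definition adjoin :: "'k::field alg_closure set \<Rightarrow> 'k alg_closure set" where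
  "adjoin S = generate_field ring_of_type_algebra (range to_ac \<union> S)"

definition coordinates :: "'a point set \<Rightarrow> 'a set" where
  "coordinates T = (\<Union>P \<in> T. set_point P)"

definition division_field :: "'k::field weierstrass \<Rightarrow> nat \<Rightarrow> 'k alg_closure set" where
  "division_field E n = adjoin (coordinates (torsion (ec_closure_group E) n))"

definition primitive_root_of_unity :: "nat \<Rightarrow> 'a::field \<Rightarrow> bool" where
  "primitive_root_of_unity n z \<longleftrightarrow> n > 0 \<and> z ^ n = 1 \<and> (\<forall>k. 0 < k \<and> k < n \<longrightarrow> z ^ k \<noteq> 1)"

end

theory Submission
  imports Defs "HOL-Number_Theory.Residues"
begin

text \<open>
  Let \<open>L = K(P1, y2)\<close> and suppose that \<open>x2\<close> is not in \<open>L\<close>. Then \<open>x2\<close> has a conjugate \<open>u \<noteq> x2\<close> over \<open>L\<close>, and the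
  points with ordinate \<open>y2\<close> are collinear, so that they sum to \<open>O\<close>. As \<open>p = 2\<close> modulo \<open>3\<close>, the conjugation cannot
  permute them cyclically; it therefore acts on \<open>E[p]\<close> with \<open>P1 \<mapsto> P1\<close> and \<open>P2 \<mapsto> b P1 - P2\<close>, and \<open>y2\<close> lies in \<open>K(P1)\<close>.
  Its determinant is \<open>-1\<close>, so by the Weil pairing it moves \<open>\<zeta>\<close>, which gives \<open>K(E[p]) = K(P1, \<zeta>)\<close>.

  The Weil pairing enters only through the following elementary substitute. For a \<open>p\<close>-th root of unity \<open>w \<noteq> 1\<close>,
  a Lagrange resolvent of slopes of lines through the multiples of \<open>P1\<close> is a function on the curve with simple
  poles at \<open>\<langle>P1\<rangle>\<close> that translation by \<open>P1\<close> multiplies by \<open>1 / w\<close>. Its zeros form one coset of \<open>\<langle>P1\<rangle>\<close>, and by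
  Abel's theorem this coset lies in \<open>E[p]\<close>. Counting shows that \<open>w\<close> corresponds bijectively to the
  nontrivial cosets of \<open>\<langle>P1\<rangle>\<close> in \<open>E[p]\<close>, and this bijection commutes with conjugation over \<open>K(P1)\<close>.

  Abel's theorem, the bound on the number of zeros, and the associativity of the chord-tangent law all follow
  from the products of the maximal ideals of the points in the coordinate ring, together with the fact that no function
  has a single simple pole at infinity.
\<close>

section \<open>The coordinate ring of the affine curve\<close>

text \<open>Two obstacles shape the proof. First, \<open>K\<close> need not be perfect, so in
  characteristic 2 or 3 the abscissa \<open>x2\<close> may be inseparable over \<open>L\<close>; a
  conjugate different from \<open>x2\<close> has to come from geometry. Secondly, no Galois group is
  at hand: a conjugation is a homomorphism on a simple extension \<open>L(x2)\<close>, and it can be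
  applied twice because \<open>(u, y2)\<close> is a combination of \<open>P1\<close> and
  \<open>P2\<close>, so that \<open>u\<close> lies in \<open>L(x2)\<close> as well. A homomorphism
  fixing \<open>P1\<close> sends \<open>P2\<close> to \<open>i P1 + j P2\<close>, and everything is
  read off from \<open>j\<close>, its determinant on \<open>E[p]\<close>. A cyclic permutation of
  the three collinear points forces \<open>j^2 + j + 1 = 0\<close>, a nontrivial cube root of unity
  modulo \<open>p\<close>, while 3 does not divide \<open>p - 1\<close>. A transposition forces
  \<open>j = -1\<close>; the remaining point is then minus \<open>P2 + (i P1 - P2) = i P1\<close>,
  which explains why \<open>y2\<close> lies in \<open>K(P1)\<close>. A homomorphism that also fixes
  \<open>w\<close> preserves the zero coset \<open>P2 + <P1>\<close> of the resolvent of
  \<open>w\<close>, which forces \<open>j = 1\<close>; this replaces the determinant formula of the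
  Weil pairing.\<close>

text \<open>
  The coordinate ring is realised as the subring \<open>{A(X) + B(X) Y}\<close> of an algebraic closure of \<open>k(X)\<close>,
  so that products of ideals can be compared by dividing inside a field.
\<close>

definition emb :: "'a::field poly \<Rightarrow> 'a poly fract alg_closure" where
  "emb p = to_ac (to_fract p)"

lemma emb_0 [simp]: "emb 0 = 0" and emb_1 [simp]: "emb 1 = 1"
  and emb_add [simp]: "emb (p + q) = emb p + emb q"
  and emb_diff [simp]: "emb (p - q) = emb p - emb q"
  and emb_minus [simp]: "emb (- p) = - emb p"
  and emb_mult [simp]: "emb (p * q) = emb p * emb q"
  and emb_eq_iff [simp]: "emb p = emb q \<longleftrightarrow> p = q"
  by (simp_all add: emb_def)

lemma emb_eq_0_iff [simp]: "emb p = 0 \<longleftrightarrow> p = 0"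
  using emb_eq_iff[of p 0] by simp

abbreviation cst :: "'a::field \<Rightarrow> 'a poly fract alg_closure" where
  "cst c \<equiv> emb [:c:]"

lemma cst_0 [simp]: "cst 0 = 0" and cst_1: "cst 1 = 1"
  by (simp_all flip: one_pCons)

lemma cst_add: "cst (a + b) = cst a + cst b"
  and cst_diff: "cst (a - b) = cst a - cst b"
  and cst_minus: "cst (- a) = - cst a"
  and cst_mult: "cst (a * b) = cst a * cst b"
  by (simp_all flip: emb_add emb_diff emb_minus emb_mult)

lemma cst_power: "cst (a ^ n) = cst a ^ n"
  by (induction n) (auto simp: cst_mult cst_1)

lemma cst_of_nat: "cst (of_nat n) = of_nat n"
  by (induction n) (auto simp: cst_add cst_1)

lemma cst_numeral: "cst (numeral n) = numeral n"
  using cst_of_nat[of "numeral n"] by simp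

lemmas cst_simps = cst_0 cst_1 cst_add cst_diff cst_minus cst_mult cst_power cst_numeral

definition gX :: "'a::field poly fract alg_closure" where
  "gX = emb [:0, 1:]"

lemma emb_pCons: "emb [:a, b:] = cst a + gX * cst b"
  "emb [:a, b, c, d:] = cst a + gX * (cst b + gX * (cst c + gX * cst d))"
  by (simp_all add: gX_def flip: emb_add emb_mult)

definition ec_neg :: "'a::field weierstrass \<Rightarrow> 'a point \<Rightarrow> 'a point" where
  "ec_neg W T = (case T of Infinity \<Rightarrow> Infinity
     | Affine x y \<Rightarrow> Affine x (- y - wa1 W * x - wa3 W))"

lemma ec_neg_simps [simp]:
  "ec_neg W Infinity = Infinity"
  "ec_neg W (Affine x y) = Affine x (- y - wa1 W * x - wa3 W)"
  by (simp_all add: ec_neg_def)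

definition slope :: "'a::field weierstrass \<Rightarrow> 'a point \<Rightarrow> 'a point \<Rightarrow> 'a" where
  "slope W S T = (case (S, T) of (Affine x1 y1, Affine x2 y2) \<Rightarrow>
       if x1 \<noteq> x2 then (y2 - y1) / (x2 - x1)
       else (3 * x1\<^sup>2 + 2 * wa2 W * x1 + wa4 W - wa1 W * y1) / (2 * y1 + wa1 W * x1 + wa3 W)
     | _ \<Rightarrow> 0)"

text \<open>At a singular point the two partial derivatives and the equation determine
  \<open>a3\<close>, \<open>a4\<close> and \<open>a6\<close>. Substituting them expresses
  \<open>b4\<close>, \<open>b6\<close> and \<open>b8\<close> through \<open>x\<close> and
  \<open>b2\<close>, and the discriminant vanishes identically. No division occurs, so
  characteristics 2 and 3 are covered.\<close>

lemma w_nonsingular: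
  assumes "elliptic_curve W" "on_curve W x y"
  shows "2 * y + wa1 W * x + wa3 W \<noteq> 0 \<or> 3 * x\<^sup>2 + 2 * wa2 W * x + wa4 W - wa1 W * y \<noteq> 0"
proof (rule ccontr)
  assume "\<not> ?thesis"
  hence n: "2 * y + wa1 W * x + wa3 W = 0" "3 * x\<^sup>2 + 2 * wa2 W * x + wa4 W - wa1 W * y = 0"
    by auto
  have a3: "wa3 W = - 2 * y - wa1 W * x"
    using n(1) by (metis add_diff_cancel_left' add.assoc diff_0 diff_conv_add_uminus minus_add_distrib mult_minus_left)
  have a4: "wa4 W = wa1 W * y - 3 * x\<^sup>2 - 2 * wa2 W * x"
    using n(2) by (simp add: algebra_simps)
  have a6: "wa6 W = y\<^sup>2 + wa1 W * x * y + wa3 W * y - (x ^ 3 + wa2 W * x\<^sup>2 + wa4 W * x)"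
    using assms(2) by (simp add: on_curve_def)
  define b2 where "b2 = (wa1 W)\<^sup>2 + 4 * wa2 W"
  have b4: "2 * wa4 W + wa1 W * wa3 W = - 6 * x\<^sup>2 - b2 * x"
    unfolding b2_def a4 a3 by (simp add: algebra_simps power2_eq_square)
  have b6: "(wa3 W)\<^sup>2 + 4 * wa6 W = 8 * x ^ 3 + b2 * x\<^sup>2"
    unfolding b2_def a6 a4 a3 by (simp add: algebra_simps power2_eq_square power3_eq_cube)
  have b8: "(wa1 W)\<^sup>2 * wa6 W + 4 * wa2 W * wa6 W - wa1 W * wa3 W * wa4 W
      + wa2 W * (wa3 W)\<^sup>2 - (wa4 W)\<^sup>2 = - 9 * x ^ 4 - b2 * x ^ 3"
    unfolding b2_def a6 a4 a3 by (simp add: algebra_simps power2_eq_square power3_eq_cube power4_eq_xxxx)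
  have "w_discriminant W = 0"
    unfolding w_discriminant_def Let_def b4 b6 b8 b2_def[symmetric]
    by (simp add: algebra_simps power2_eq_square power3_eq_cube power4_eq_xxxx)
  with assms(1) show False by (simp add: elliptic_curve_def)
qed

locale ell_curve =
  fixes W :: "'a::alg_closed_field weierstrass"
  assumes ell: "elliptic_curve W"
begin

abbreviation "a1 \<equiv> wa1 W"
abbreviation "a2 \<equiv> wa2 W"
abbreviation "a3 \<equiv> wa3 W"
abbreviation "a4 \<equiv> wa4 W"
abbreviation "a6 \<equiv> wa6 W"

definition cubic :: "'a poly" where "cubic = [:a6, a4, a2, 1:]"
definition ycoeff :: "'a poly" where "ycoeff = [:a3, a1:]"

text \<open>An arbitrary root of the Weierstrass quadratic serves as \<open>Y\<close>. The
  independence of \<open>1\<close> and \<open>gY\<close> over k[X] is derived from the norm in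
  \<open>reg_eq_0_iff\<close>.\<close>

definition gY :: "'a poly fract alg_closure" where
  "gY = (SOME y. y\<^sup>2 + emb ycoeff * y = emb cubic)"

lemma gY_eq: "gY\<^sup>2 + emb ycoeff * gY = emb cubic"
proof -
  have "\<exists>y. poly [:- emb cubic, emb ycoeff, 1:] y = 0"
    by (rule alg_closed_imp_poly_has_root) simp
  then obtain y where "poly [:- emb cubic, emb ycoeff, 1:] y = 0" ..
  hence "y\<^sup>2 + emb ycoeff * y = emb cubic"
    by (simp add: algebra_simps power2_eq_square add_eq_0_iff) 
  thus ?thesis unfolding gY_def by (rule someI)
qed

lemma gY_curve:
  "gY\<^sup>2 + cst a1 * gX * gY + cst a3 * gY = gX ^ 3 + cst a2 * gX\<^sup>2 + cst a4 * gX + cst a6"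
  using gY_eq by (simp add: ycoeff_def cubic_def emb_pCons algebra_simps power2_eq_square power3_eq_cube cst_1)

definition reg :: "'a poly \<Rightarrow> 'a poly \<Rightarrow> 'a poly fract alg_closure" where
  "reg A B = emb A + emb B * gY"

text \<open>
  The norm of \<open>A + B Y\<close> down to \<open>k[X]\<close>. Its degree is the pole order at infinity; since it is the larger of
  \<open>2 deg A\<close> and \<open>2 deg B + 3\<close>, it is never \<open>1\<close>.
\<close>

definition rnorm :: "'a poly \<Rightarrow> 'a poly \<Rightarrow> 'a poly" where
  "rnorm A B = A\<^sup>2 - A * B * ycoeff - B\<^sup>2 * cubic"

lemma degree_cubic: "degree cubic = 3"
  by (simp add: cubic_def)

lemma cubic_nz: "cubic \<noteq> 0" using degree_cubic by auto

lemma degree_ycoeff: "degree ycoeff \<le> 1"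
  by (simp add: ycoeff_def)

text \<open>The terms \<open>A^2\<close> and \<open>B^2 * cubic\<close> have degrees of different
  parity, so they cannot cancel, and the mixed term is smaller than the larger of them. Here
  \<open>A^2\<close> wins; the complementary range \<open>degree A <= degree B + 1\<close> is that
  of \<open>rnorm_big_B\<close>.\<close>

lemma rnorm_big_A:
  assumes "A \<noteq> 0" "B = 0 \<or> degree B + 2 \<le> degree A"
  shows "degree (rnorm A B) = 2 * degree A" "rnorm A B \<noteq> 0"
proof -
  have A: "degree (A\<^sup>2) = 2 * degree A" using assms(1) by (simp add: degree_power_eq)
  have "degree (rnorm A B) = 2 * degree A \<and> rnorm A B \<noteq> 0"
  proof (cases "B = 0")
    case True
    thus ?thesis using A assms(1) by (simp add: rnorm_def)
  next
    case False
    hence d: "degree B + 2 \<le> degree A" using assms by simp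
    have "degree (A * B * ycoeff) \<le> degree A + degree B + 1"
      using degree_mult_le[of "A*B" ycoeff] degree_mult_le[of A B] degree_ycoeff by linarith
    moreover have "degree (B\<^sup>2 * cubic) = 2 * degree B + 3"
      using False cubic_nz by (simp add: degree_mult_eq degree_power_eq degree_cubic)
    ultimately have "degree (A * B * ycoeff + B\<^sup>2 * cubic) < degree (A\<^sup>2)"
      unfolding A using d by (intro degree_add_less) linarith+
    hence "degree (A\<^sup>2 - (A * B * ycoeff + B\<^sup>2 * cubic)) = degree (A\<^sup>2)"
          "A\<^sup>2 - (A * B * ycoeff + B\<^sup>2 * cubic) \<noteq> 0"
      using degree_add_eq_left[of "-(A * B * ycoeff + B\<^sup>2 * cubic)" "A\<^sup>2"]
      unfolding degree_minus diff_conv_add_uminus[symmetric] by (blast, force)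
    thus ?thesis unfolding rnorm_def using A by (simp add: algebra_simps)
  qed
  thus "degree (rnorm A B) = 2 * degree A" "rnorm A B \<noteq> 0" by auto
qed

lemma rnorm_big_B:
  assumes "B \<noteq> 0" "degree A \<le> degree B + 1"
  shows "degree (rnorm A B) = 2 * degree B + 3" "rnorm A B \<noteq> 0"
proof -
  have A: "degree (A\<^sup>2) \<le> 2 * degree A" using degree_power_le[of A 2] by simp
  have "degree (A * B * ycoeff) \<le> degree A + degree B + 1"
    using degree_mult_le[of "A*B" ycoeff] degree_mult_le[of A B] degree_ycoeff by linarith
  moreover have D: "degree (B\<^sup>2 * cubic) = 2 * degree B + 3"
    using assms cubic_nz by (simp add: degree_mult_eq degree_power_eq degree_cubic)
  ultimately have "degree (A\<^sup>2 - A * B * ycoeff) < degree (B\<^sup>2 * cubic)"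
    using assms A by (intro degree_diff_less) linarith+
  hence "degree ((A\<^sup>2 - A * B * ycoeff) + - (B\<^sup>2 * cubic)) = degree (B\<^sup>2 * cubic)"
        "(A\<^sup>2 - A * B * ycoeff) + - (B\<^sup>2 * cubic) \<noteq> 0"
    using degree_add_eq_right[of "A\<^sup>2 - A * B * ycoeff" "-(B\<^sup>2 * cubic)"] by auto
  thus "degree (rnorm A B) = 2 * degree B + 3" "rnorm A B \<noteq> 0"
    unfolding rnorm_def using D by (simp_all add: algebra_simps)
qed

lemma rnorm_eq_0_iff [simp]: "rnorm A B = 0 \<longleftrightarrow> A = 0 \<and> B = 0"
proof
  assume "rnorm A B = 0"
  show "A = 0 \<and> B = 0"
  proof (rule ccontr)
    assume "\<not> (A = 0 \<and> B = 0)"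
    then consider "A \<noteq> 0" "B = 0 \<or> degree B + 2 \<le> degree A" | "B \<noteq> 0" "degree A \<le> degree B + 1"
      by fastforce
    thus False using rnorm_big_A(2) rnorm_big_B(2) \<open>rnorm A B = 0\<close> by cases auto
  qed
qed (simp add: rnorm_def)

lemma degree_rnorm_neq_1: "degree (rnorm A B) \<noteq> 1"
proof (cases "A = 0 \<and> B = 0")
  case False
  then consider "A \<noteq> 0" "B = 0 \<or> degree B + 2 \<le> degree A" | "B \<noteq> 0" "degree A \<le> degree B + 1"
    by fastforce
  thus ?thesis
  proof cases
    case 1 thus ?thesis using rnorm_big_A(1)[OF 1] by simp
  next
    case 2 thus ?thesis using rnorm_big_B(1)[OF 2] by simp
  qed
qed (simp add: rnorm_def)

lemma degree_rnorm_0: assumes "degree (rnorm A B) = 0" shows "degree A = 0 \<and> B = 0"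
proof (cases "A = 0 \<and> B = 0")
  case False
  then consider "A \<noteq> 0" "B = 0 \<or> degree B + 2 \<le> degree A" | "B \<noteq> 0" "degree A \<le> degree B + 1"
    by fastforce
  thus ?thesis
  proof cases
    case 1 thus ?thesis using rnorm_big_A(1)[OF 1] assms by auto
  next
    case 2 thus ?thesis using rnorm_big_B(1)[OF 2] assms by auto
  qed
qed auto

lemma reg_conj: "reg A B * (emb A - emb B * (gY + emb ycoeff)) = emb (rnorm A B)"
proof -
  have *: "gY * gY = emb cubic - emb ycoeff * gY"
    using gY_eq by (simp add: power2_eq_square algebra_simps)
  have "reg A B * (emb A - emb B * (gY + emb ycoeff)) =
     emb A * emb A - emb A * emb B * emb ycoeff - emb B * emb B * (gY * gY + emb ycoeff * gY)"
    by (simp add: reg_def algebra_simps)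
  also have "\<dots> = emb (rnorm A B)"
    unfolding * by (simp add: rnorm_def algebra_simps power2_eq_square)
  finally show ?thesis .
qed

lemma reg_eq_0_iff [simp]: "reg A B = 0 \<longleftrightarrow> A = 0 \<and> B = 0"
proof
  assume "reg A B = 0"
  hence "emb (rnorm A B) = 0" using reg_conj[of A B] by simp
  thus "A = 0 \<and> B = 0" by simp
qed (simp add: reg_def)

lemma reg_diff: "reg A B - reg C D = reg (A - C) (B - D)"
  and reg_add: "reg A B + reg C D = reg (A + C) (B + D)"
  and reg_minus: "- reg A B = reg (- A) (- B)"
  by (simp_all add: reg_def algebra_simps)

lemma reg_eq_iff [simp]: "reg A B = reg C D \<longleftrightarrow> A = C \<and> B = D"
  using reg_eq_0_iff[of "A - C" "B - D"] unfolding reg_diff[symmetric] by auto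

lemma reg_mult: "reg A B * reg C D = reg (A * C + B * D * cubic) (A * D + B * C - B * D * ycoeff)"
proof -
  have *: "gY * gY = emb cubic - emb ycoeff * gY"
    using gY_eq by (simp add: power2_eq_square algebra_simps)
  have "reg A B * reg C D = emb A * emb C + (emb A * emb D + emb B * emb C) * gY + emb B * emb D * (gY * gY)"
    by (simp add: reg_def algebra_simps)
  also have "\<dots> = reg (A * C + B * D * cubic) (A * D + B * C - B * D * ycoeff)"
    unfolding * by (simp add: reg_def algebra_simps)
  finally show ?thesis .
qed

lemma rnorm_mult: "rnorm (A * C + B * D * cubic) (A * D + B * C - B * D * ycoeff) = rnorm A B * rnorm C D"
  unfolding rnorm_def by (simp add: algebra_simps power2_eq_square)

definition coord_ring :: "'a poly fract alg_closure set" where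
  "coord_ring = {reg A B | A B. True}"

lemma reg_in_coord_ring [simp, intro]: "reg A B \<in> coord_ring" by (auto simp: coord_ring_def)

lemma RgE: assumes "z \<in> coord_ring" obtains A B where "z = reg A B"
  using assms by (auto simp: coord_ring_def)

lemma emb_reg: "emb A = reg A 0" and gY_reg: "gY = reg 0 1"
  by (simp_all add: reg_def)

lemma emb_coord_ring [simp, intro]: "emb A \<in> coord_ring" and gY_coord_ring [simp, intro]: "gY \<in> coord_ring"
  and gX_coord_ring [simp, intro]: "gX \<in> coord_ring"
  and zero_coord_ring [simp, intro]: "0 \<in> coord_ring" and one_coord_ring [simp, intro]: "1 \<in> coord_ring"
  using reg_in_coord_ring emb_reg gY_reg gX_def emb_0 emb_1 by metis+

lemma coord_ring_add [simp, intro]: "z \<in> coord_ring \<Longrightarrow> w \<in> coord_ring \<Longrightarrow> z + w \<in> coord_ring"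
  and coord_ring_diff [simp, intro]: "z \<in> coord_ring \<Longrightarrow> w \<in> coord_ring \<Longrightarrow> z - w \<in> coord_ring"
  and coord_ring_minus [simp, intro]: "z \<in> coord_ring \<Longrightarrow> - z \<in> coord_ring"
  and coord_ring_mult [simp, intro]: "z \<in> coord_ring \<Longrightarrow> w \<in> coord_ring \<Longrightarrow> z * w \<in> coord_ring"
  by (auto elim!: RgE simp: reg_add reg_diff reg_minus reg_mult)

text \<open>Meaningful on \<open>coord_ring\<close> only, where \<open>reg_eq_iff\<close> makes
  \<open>A\<close> and \<open>B\<close> unique. This is why fractions are later carried as pairs of
  ring elements.\<close>

definition pole_order :: "'a poly fract alg_closure \<Rightarrow> nat" where
  "pole_order z = (THE n. \<exists>A B. z = reg A B \<and> n = degree (rnorm A B))"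

lemma pole_order_reg: "pole_order (reg A B) = degree (rnorm A B)"
  unfolding pole_order_def by (rule the_equality) auto

lemma pole_order_mult:
  assumes "z \<in> coord_ring" "w \<in> coord_ring" "z \<noteq> 0" "w \<noteq> 0"
  shows "pole_order (z * w) = pole_order z + pole_order w"
proof -
  from assms obtain A B C D where "z = reg A B" "w = reg C D" by (auto elim!: RgE)
  thus ?thesis using assms by (simp add: reg_mult pole_order_reg rnorm_mult degree_mult_eq)
qed

lemma pole_order_emb: "pole_order (emb A) = 2 * degree A"
proof (cases "A = 0")
  case False
  thus ?thesis using rnorm_big_A(1)[of A 0] by (simp add: emb_reg pole_order_reg)
qed (simp add: emb_reg pole_order_reg rnorm_def)

lemma pole_order_1 [simp]: "pole_order 1 = 0"
  using pole_order_emb[of 1] by simp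

lemma pole_order_neq_1: "z \<in> coord_ring \<Longrightarrow> pole_order z \<noteq> 1"
  by (elim RgE) (use degree_rnorm_neq_1 in \<open>simp add: pole_order_reg\<close>)

lemma pole_order_0D: assumes "z \<in> coord_ring" "pole_order z = 0" shows "\<exists>c. z = cst c"
proof -
  from assms obtain A B where z: "z = reg A B" "degree (rnorm A B) = 0" by (auto elim!: RgE simp: pole_order_reg)
  from degree_rnorm_0[OF z(2)] obtain c where "A = [:c:]" "B = 0" by (auto elim: degree_eq_zeroE)
  thus ?thesis using z by (auto simp: emb_reg)
qed

end

section \<open>Ideals of points and the group law\<close>

lemma frac_cross:
  assumes "a * b * c = m * k" "c \<noteq> 0" "m \<noteq> 0" "k \<noteq> (0::'b::field)"
  shows "a * b * (w / k) = w / (c / m)"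
proof -
  have "a * b = m * k / c" using assms by (simp add: field_simps)
  thus ?thesis using assms by simp
qed

lemma mult_recip_cancel: "(u::'b::field) \<noteq> 0 \<Longrightarrow> z = u * w \<Longrightarrow> z * (1 / u) = w"
  by simp

context ell_curve begin

text \<open>The ring sees only the affine part, so the point at infinity gets the unit ideal; the
  behaviour there is recorded by \<open>pole_order\<close>.\<close>

definition point_ideal :: "'a point \<Rightarrow> 'a poly fract alg_closure set" where
  "point_ideal T = (case T of Infinity \<Rightarrow> coord_ring | Affine x y \<Rightarrow> {reg A B |A B. poly A x + poly B x * y = 0})"

lemma point_ideal_Infinity [simp]: "point_ideal Infinity = coord_ring"
  by (simp add: point_ideal_def)

lemma reg_point_ideal_iff [simp]: "reg A B \<in> point_ideal (Affine x y) \<longleftrightarrow> poly A x + poly B x * y = 0"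
  by (auto simp: point_ideal_def)

lemma pidE:
  assumes "z \<in> point_ideal (Affine x y)"
  obtains A B where "z = reg A B" "poly A x + poly B x * y = 0"
  using assms by (auto simp: point_ideal_def)

definition is_ideal :: "'a poly fract alg_closure set \<Rightarrow> bool" where
  "is_ideal I \<longleftrightarrow> I \<subseteq> coord_ring \<and> 0 \<in> I \<and> (\<forall>a\<in>I. \<forall>b\<in>I. a + b \<in> I) \<and> (\<forall>r\<in>coord_ring. \<forall>a\<in>I. r * a \<in> I)"

lemma is_idealD:
  assumes "is_ideal I"
  shows "a \<in> I \<Longrightarrow> a \<in> coord_ring" "0 \<in> I" "a \<in> I \<Longrightarrow> b \<in> I \<Longrightarrow> a + b \<in> I"
    "r \<in> coord_ring \<Longrightarrow> a \<in> I \<Longrightarrow> r * a \<in> I"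
    "r \<in> coord_ring \<Longrightarrow> a \<in> I \<Longrightarrow> a * r \<in> I"
  using assms by (auto simp: is_ideal_def mult.commute)

lemma is_ideal_minus: "is_ideal I \<Longrightarrow> a \<in> I \<Longrightarrow> - a \<in> I"
  using is_idealD(4)[of I "-1" a] by simp

lemma is_ideal_diff: "is_ideal I \<Longrightarrow> a \<in> I \<Longrightarrow> b \<in> I \<Longrightarrow> a - b \<in> I"
  using is_idealD(3)[of I a "-b"] is_ideal_minus by simp

lemma is_ideal_coord_ring [simp]: "is_ideal coord_ring"
  by (auto simp: is_ideal_def)

lemma on_curve_poly: "on_curve W x y \<longleftrightarrow> y\<^sup>2 + poly ycoeff x * y = poly cubic x"
  by (simp add: on_curve_def ycoeff_def cubic_def algebra_simps power2_eq_square power3_eq_cube)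

lemma is_ideal_point_ideal: 
  assumes "T \<in> ec_points W"
  shows "is_ideal (point_ideal T)"
proof (cases T)
  case (Affine x y)
  hence c: "y\<^sup>2 + poly ycoeff x * y = poly cubic x" using assms by (auto simp: ec_points_def on_curve_poly)
  have m: "reg C D * reg A B \<in> point_ideal (Affine x y)" if "poly A x + poly B x * y = 0" for A B C D
  proof -
    have "poly (C * A + D * B * cubic) x + poly (C * B + D * A - D * B * ycoeff) x * y =
      (poly C x + poly D x * y) * (poly A x + poly B x * y)"
      unfolding poly_add poly_mult poly_diff c[symmetric] by Groebner_Basis.algebra
    thus ?thesis using that by (simp add: reg_mult)
  qed
  have "0 \<in> point_ideal T" unfolding Affine using reg_point_ideal_iff[of 0 0] by (metis reg_eq_0_iff mult_zero_left poly_0 add_0)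
  moreover have "point_ideal T \<subseteq> coord_ring" using Affine by (auto elim!: pidE)
  moreover have "a + b \<in> point_ideal T" if "a \<in> point_ideal T" "b \<in> point_ideal T" for a b
  proof -
    from that obtain A B C D where "a = reg A B" "poly A x + poly B x * y = 0"
      "b = reg C D" "poly C x + poly D x * y = 0"
      unfolding Affine by (auto elim!: pidE)
    moreover from this have "(poly A x + poly B x * y) + (poly C x + poly D x * y) = 0" by simp
    ultimately show ?thesis unfolding Affine by (simp add: reg_add algebra_simps)
  qed
  moreover have "r * a \<in> point_ideal T" if "r \<in> coord_ring" "a \<in> point_ideal T" for r a
    using that m unfolding Affine by (auto elim!: pidE RgE)
  ultimately show ?thesis by (auto simp: is_ideal_def)
qed simp

lemma gX_point_ideal [simp, intro]: "gX - cst x \<in> point_ideal (Affine x y)"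
  and gY_point_ideal [simp, intro]: "gY - cst y \<in> point_ideal (Affine x y)"
proof -
  have "gX - cst x = reg [:-x, 1:] 0" "gY - cst y = reg [:-y:] 1"
    by (simp_all add: reg_def emb_pCons cst_simps)
  thus "gX - cst x \<in> point_ideal (Affine x y)" "gY - cst y \<in> point_ideal (Affine x y)" by simp_all
qed

text \<open>\<open>A + B Y = (A + B y) + B (Y - y)\<close>, and the polynomial
  \<open>A + B y\<close> vanishes at \<open>x\<close>.\<close>

lemma point_ideal_gen:
  assumes "z \<in> point_ideal (Affine x y)"
  obtains r s where "r \<in> coord_ring" "s \<in> coord_ring" "z = r * (gX - cst x) + s * (gY - cst y)"
proof -
  from assms obtain A B where z: "z = reg A B" and e: "poly A x + poly B x * y = 0" by (rule pidE)
  have "poly (A + B * [:y:]) x = 0" using e by (simp add: mult.commute)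
  then obtain q where q: "A + B * [:y:] = [:-x, 1:] * q" unfolding poly_eq_0_iff_dvd by (elim dvdE)
  have "z = (emb (A + B * [:y:])) + emb B * (gY - cst y)"
    unfolding z emb_add emb_mult by (simp add: reg_def algebra_simps)
  also have "emb (A + B * [:y:]) = emb q * (gX - cst x)"
    unfolding q emb_mult by (simp add: emb_pCons cst_simps)
  finally show thesis by (intro that) auto
qed

lemma cst_point_ideal_iff: "cst c \<in> point_ideal (Affine x y) \<longleftrightarrow> c = 0"
  by (simp add: emb_reg)

inductive_set ideal_mult :: "'a poly fract alg_closure set \<Rightarrow> 'a poly fract alg_closure set
    \<Rightarrow> 'a poly fract alg_closure set" for I J where
  zero: "0 \<in> ideal_mult I J"
| step: "a \<in> I \<Longrightarrow> b \<in> J \<Longrightarrow> c \<in> ideal_mult I J \<Longrightarrow> a * b + c \<in> ideal_mult I J"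

lemma ideal_mult_mult: "a \<in> I \<Longrightarrow> b \<in> J \<Longrightarrow> a * b \<in> ideal_mult I J"
  using ideal_mult.step[OF _ _ ideal_mult.zero, of a I b J] by simp

lemma ideal_mult_add: "x \<in> ideal_mult I J \<Longrightarrow> y \<in> ideal_mult I J \<Longrightarrow> x + y \<in> ideal_mult I J"
  by (induction rule: ideal_mult.induct) (auto simp: add.assoc intro: ideal_mult.step)

text \<open>The factor \<open>t\<close> may be any element of the ambient field. This allows
  inclusions of fractional ideals to be checked on products of two elements.\<close>

lemma ideal_mult_image:
  assumes "z \<in> ideal_mult I J" "is_ideal K" "\<And>a b. a \<in> I \<Longrightarrow> b \<in> J \<Longrightarrow> a * b * t \<in> K"
  shows "z * t \<in> K"
  using assms(1)
  by (induction rule: ideal_mult.induct) (auto simp: distrib_right is_idealD[OF assms(2)] assms(3))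

lemma is_ideal_ideal_mult: assumes "is_ideal I" "is_ideal J" shows "is_ideal (ideal_mult I J)"
proof -
  have R: "r * z \<in> ideal_mult I J" if "r \<in> coord_ring" "z \<in> ideal_mult I J" for r z
    using that(2)
  proof (induction rule: ideal_mult.induct)
    case (step a b c)
    have "(r * a) * b + r * c \<in> ideal_mult I J" using step that by (intro ideal_mult.step is_idealD(4)[OF assms(1)])
    thus ?case by (simp add: algebra_simps)
  qed (simp add: ideal_mult.zero)
  have "z \<in> coord_ring" if "z \<in> ideal_mult I J" for z
    using ideal_mult_image[OF that is_ideal_coord_ring, of 1] is_idealD(1)[OF assms(1)] is_idealD(1)[OF assms(2)] by simp
  thus ?thesis using R ideal_mult_add ideal_mult.zero by (auto simp: is_ideal_def)
qed

lemma ideal_mult_subsetI: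
  assumes "is_ideal K" "\<And>a b. a \<in> I \<Longrightarrow> b \<in> J \<Longrightarrow> a * b \<in> K"
  shows "ideal_mult I J \<subseteq> K"
  using ideal_mult_image[of _ I J K 1] assms by auto

lemma ideal_mult_left_commute:
  assumes "is_ideal I" "is_ideal J" "is_ideal K"
  shows "ideal_mult I (ideal_mult J K) \<subseteq> ideal_mult J (ideal_mult I K)"
proof (rule ideal_mult_subsetI)
  show *: "is_ideal (ideal_mult J (ideal_mult I K))" using assms by (intro is_ideal_ideal_mult)
  fix a b assume ab: "a \<in> I" "b \<in> ideal_mult J K"
  have "b * a \<in> ideal_mult J (ideal_mult I K)"
    using ab(2)
  proof (rule ideal_mult_image[OF _ *])
    fix c d assume "c \<in> J" "d \<in> K"
    hence "c * (a * d) \<in> ideal_mult J (ideal_mult I K)" using ab by (intro ideal_mult_mult)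
    thus "c * d * a \<in> ideal_mult J (ideal_mult I K)" by (simp add: ac_simps)
  qed
  thus "a * b \<in> ideal_mult J (ideal_mult I K)" by (simp add: mult.commute)
qed

text \<open>The line \<open>y = l x + n\<close> meets the curve in points with abscissae \<open>x1\<close>, \<open>x2\<close>, \<open>x3\<close>.\<close>

definition collinear :: "'a \<Rightarrow> 'a \<Rightarrow> 'a \<Rightarrow> 'a \<Rightarrow> 'a \<Rightarrow> bool" where
  "collinear l n x1 x2 x3 \<longleftrightarrow>
     x1 + x2 + x3 = l\<^sup>2 + a1 * l - a2 \<and>
     x1 * x2 + x1 * x3 + x2 * x3 = a4 - 2 * l * n - a3 * l - a1 * n \<and>
     x1 * x2 * x3 = n\<^sup>2 + a3 * n - a6"

definition line :: "'a \<Rightarrow> 'a \<Rightarrow> 'a poly fract alg_closure" where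
  "line l n = gY - cst l * gX - cst n"

lemma line_reg: "line l n = reg [:-n, -l:] 1"
  by (simp add: line_def reg_def emb_pCons cst_simps)

lemma line_coord_ring [simp, intro]: "line l n \<in> coord_ring" and line_nz [simp]: "line l n \<noteq> 0"
  by (simp_all add: line_reg)

lemma pole_order_line: "pole_order (line l n) = 3"
  unfolding line_reg pole_order_reg by (subst rnorm_big_B(1)) auto

lemma gX_reg: "gX - cst x = emb [:-x, 1:]"
  by (simp add: emb_pCons cst_simps)

lemma gX_nz: "gX - cst x \<noteq> 0"
  unfolding gX_reg by simp

lemma gX_neq [simp]: "gX \<noteq> cst x"
  using gX_nz[of x] by auto

lemma pole_order_gX: "pole_order (gX - cst x) = 2"
  unfolding gX_reg pole_order_emb by simp

lemma collinear_neg: "collinear l n x1 x2 x3 \<Longrightarrow> collinear (- l - a1) (- n - a3) x1 x2 x3"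
  unfolding collinear_def by (simp add: algebra_simps power2_eq_square)

text \<open>The second line is, up to sign, the conjugate of the first under
  \<open>Y -> - Y - a1 X - a3\<close>. Their product is therefore a polynomial in \<open>X\<close>,
  the cubic obtained by substituting the line into the equation, and Vieta's relations identify
  it.\<close>

lemma collinear_line:
  assumes "collinear l n x1 x2 x3"
  shows "(gX - cst x1) * (gX - cst x2) * (gX - cst x3) = line l n * line (- l - a1) (- n - a3)"
proof -
  have e: "cst x1 + cst x2 + cst x3 = (cst l)\<^sup>2 + cst a1 * cst l - cst a2"
    "cst x1 * cst x2 + cst x1 * cst x3 + cst x2 * cst x3
       = cst a4 - 2 * cst l * cst n - cst a3 * cst l - cst a1 * cst n"
    "cst x1 * cst x2 * cst x3 = (cst n)\<^sup>2 + cst a3 * cst n - cst a6"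
    using assms[unfolded collinear_def] unfolding cst_simps[symmetric] emb_eq_iff by auto
  have "(u - x1) * (u - x2) * (u - x3) - (v - l * u - n) * (v - (- l - c1) * u - (- n - c3)) =
     (u ^ 3 + c2 * u\<^sup>2 + c4 * u + c6 - (v\<^sup>2 + c1 * u * v + c3 * v))
     - u\<^sup>2 * (x1 + x2 + x3 - (l\<^sup>2 + c1 * l - c2))
     + u * (x1 * x2 + x1 * x3 + x2 * x3 - (c4 - 2 * l * n - c3 * l - c1 * n))
     - (x1 * x2 * x3 - (n\<^sup>2 + c3 * n - c6))"
    for u v x1 x2 x3 l n c1 c2 c3 c4 c6 :: "'a poly fract alg_closure"
    by Groebner_Basis.algebra
  from this[of gX "cst x1" "cst x2" "cst x3" gY "cst l" "cst n" "cst a1" "cst a3" "cst a2" "cst a4" "cst a6"]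
  show ?thesis unfolding line_def cst_minus cst_diff e gY_curve by simp
qed

text \<open>Since \<open>Y - y1 = line + l (X - x1)\<close>, each ideal is generated by
  \<open>X - xi\<close> and the line. In a product of two elements, the part without a factor
  \<open>line\<close> becomes, after multiplication by \<open>X - x3\<close>, a multiple of
  \<open>line\<close> times the conjugate line by \<open>collinear_line\<close>; the conjugate line
  passes through \<open>S\<close>. All other terms keep the factor \<open>X - x3\<close>.\<close>

lemma point_ideal_add_subset:
  assumes c: "collinear l n x1 x2 x3" and y: "y1 = l * x1 + n" "y2 = l * x2 + n"
    and S: "S = Affine x3 (- (l * x3 + n) - a1 * x3 - a3)" "S \<in> ec_points W"
    and z: "z \<in> ideal_mult (point_ideal (Affine x1 y1)) (point_ideal (Affine x2 y2))"
  shows "z * ((gX - cst x3) / line l n) \<in> point_ideal S"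
  using z is_ideal_point_ideal[OF S(2)]
proof (rule ideal_mult_image)
  fix a b assume "a \<in> point_ideal (Affine x1 y1)" "b \<in> point_ideal (Affine x2 y2)"
  then obtain r s r' s' where rs: "r \<in> coord_ring" "s \<in> coord_ring" "r' \<in> coord_ring" "s' \<in> coord_ring"
    and ab: "a = r * (gX - cst x1) + s * (gY - cst y1)" "b = r' * (gX - cst x2) + s' * (gY - cst y2)"
    by (auto elim!: point_ideal_gen)
  define u where "u = r + s * cst l"
  define u' where "u' = r' + s' * cst l"
  have ab': "a = u * (gX - cst x1) + s * line l n" "b = u' * (gX - cst x2) + s' * line l n"
    unfolding ab u_def u'_def line_def y cst_simps by Groebner_Basis.algebra+
  let ?w = "u * u' * line (- l - a1) (- n - a3) +
     (s * b + s' * u * (gX - cst x1)) * (gX - cst x3)"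
  have "a * b * (gX - cst x3) = line l n * ?w"
  proof -
    have "a * b * (gX - cst x3) - line l n * ?w = u * u' *
      ((gX - cst x1) * (gX - cst x2) * (gX - cst x3) - line l n * line (- l - a1) (- n - a3))"
      unfolding ab' by Groebner_Basis.algebra
    thus ?thesis unfolding collinear_line[OF c] by simp
  qed
  hence "a * b * ((gX - cst x3) / line l n) = ?w"
    by (simp add: field_simps)
  moreover have "line (- l - a1) (- n - a3) \<in> point_ideal S"
    unfolding S line_reg by (simp add: algebra_simps)
  moreover have "u \<in> coord_ring" "u' \<in> coord_ring" "b \<in> coord_ring" unfolding u_def u'_def ab using rs by auto
  moreover have "gX - cst x3 \<in> point_ideal S" unfolding S by simp
  ultimately show "a * b * ((gX - cst x3) / line l n) \<in> point_ideal S"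
    using rs is_ideal_point_ideal[OF S(2)] by (auto intro!: is_idealD(3,4))
qed

lemma neg_points: "T \<in> ec_points W \<Longrightarrow> ec_neg W T \<in> ec_points W"
proof (cases T)
  case (Affine x y)
  moreover have "(- y - a1 * x - a3)\<^sup>2 + a1 * x * (- y - a1 * x - a3) + a3 * (- y - a1 * x - a3)
      = y\<^sup>2 + a1 * x * y + a3 * y"
    by Groebner_Basis.algebra
  ultimately show "T \<in> ec_points W \<Longrightarrow> ec_neg W T \<in> ec_points W"
    by (simp add: ec_points_def on_curve_def)
qed (simp add: ec_points_def)

lemma ec_neg_neg [simp]: "ec_neg W (ec_neg W T) = T"
  by (cases T) auto

lemma gY_neg_factor:
  assumes "on_curve W x y"
  shows "(gY - cst y) * (gY - cst (- y - a1 * x - a3)) = (gX - cst x) *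
    (gX\<^sup>2 + cst x * gX + (cst x)\<^sup>2 + cst a2 * (gX + cst x) + cst a4 - cst a1 * gY)"
proof -
  have c: "(cst y)\<^sup>2 + cst a1 * cst x * cst y + cst a3 * cst y
      = (cst x) ^ 3 + cst a2 * (cst x)\<^sup>2 + cst a4 * cst x + cst a6"
    using assms[unfolded on_curve_def] unfolding cst_simps[symmetric] emb_eq_iff by auto
  have "(v - y) * (v - (- y - c1 * x - c3)) - (u - x) *
      (u\<^sup>2 + x * u + x\<^sup>2 + c2 * (u + x) + c4 - c1 * v) =
     (v\<^sup>2 + c1 * u * v + c3 * v - (u ^ 3 + c2 * u\<^sup>2 + c4 * u + c6))
     - (y\<^sup>2 + c1 * x * y + c3 * y - (x ^ 3 + c2 * x\<^sup>2 + c4 * x + c6))"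
    for u v x y c1 c2 c3 c4 c6 :: "'a poly fract alg_closure"
    by Groebner_Basis.algebra
  from this[of gY "cst y" "cst a1" "cst x" "cst a3" gX "cst a2" "cst a4" "cst a6"]
  show ?thesis unfolding cst_minus cst_diff cst_mult gY_curve c by simp
qed

lemma point_ideal_neg_subset:
  assumes "Affine x y \<in> ec_points W" "z \<in> ideal_mult (point_ideal (Affine x y)) (point_ideal (ec_neg W (Affine x y)))"
  shows "z * (1 / (gX - cst x)) \<in> coord_ring"
  using assms(2) is_ideal_coord_ring
proof (rule ideal_mult_image)
  fix a b assume "a \<in> point_ideal (Affine x y)" "b \<in> point_ideal (ec_neg W (Affine x y))"
  then obtain r s r' s' where rs: "r \<in> coord_ring" "s \<in> coord_ring" "r' \<in> coord_ring" "s' \<in> coord_ring"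
    and ab: "a = r * (gX - cst x) + s * (gY - cst y)"
      "b = r' * (gX - cst x) + s' * (gY - cst (- y - a1 * x - a3))"
    by (auto elim!: point_ideal_gen)
  let ?q = "gX\<^sup>2 + cst x * gX + (cst x)\<^sup>2 + cst a2 * (gX + cst x) + cst a4 - cst a1 * gY"
  have "on_curve W x y" using assms by (auto simp: ec_points_def)
  note fac = gY_neg_factor[OF this]
  have "a * b - (gX - cst x) * (r * b + r' * s * (gY - cst y) + s * s' * ?q) =
    s * s' * ((gY - cst y) * (gY - cst (- y - a1 * x - a3)) - (gX - cst x) * ?q)"
    (is "_ = _ * (?v1 * ?v2 - ?u * ?t)")
  proof -
    have "(r * u + s * v1) * (r' * u + s' * v2) - u * (r * (r' * u + s' * v2) + r' * s * v1 + s * s' * t)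
       = s * s' * (v1 * v2 - u * t)" for u v1 v2 t
      by (simp add: algebra_simps)
    from this[of ?u ?v1 ?v2 ?t] show ?thesis unfolding ab .
  qed
  hence "a * b = (gX - cst x) * (r * b + r' * s * (gY - cst y) + s * s' * ?q)"
    unfolding fac by simp
  hence "a * b * (1 / (gX - cst x)) = r * b + r' * s * (gY - cst y) + s * s' * ?q"
    by (rule mult_recip_cancel[OF gX_nz])
  also have "\<dots> \<in> coord_ring" unfolding ab power2_eq_square using rs by auto
  finally show "a * b * (1 / (gX - cst x)) \<in> coord_ring" .
qed

text \<open>This is the only place where the curve has to be nonsingular.\<close>

lemma gX_in_point_ideal_neg:
  assumes "Affine x y \<in> ec_points W"
  shows "gX - cst x \<in> ideal_mult (point_ideal (Affine x y)) (point_ideal (ec_neg W (Affine x y)))" (is "_ \<in> ?I")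
proof -
  have c: "on_curve W x y" using assms by (auto simp: ec_points_def)
  have I: "is_ideal ?I" using assms neg_points[OF assms] by (intro is_ideal_ideal_mult is_ideal_point_ideal)
  let ?q = "gX\<^sup>2 + cst x * gX + (cst x)\<^sup>2 + cst a2 * (gX + cst x) + cst a4 - cst a1 * gY"
  let ?y = "- y - a1 * x - a3"
  have m1: "(gX - cst x) * (gX - cst x) \<in> ?I" by (intro ideal_mult_mult) auto
  have m2: "(gX - cst x) * (gY - cst ?y) \<in> ?I" by (intro ideal_mult_mult) auto
  have m3: "(gY - cst y) * (gX - cst x) \<in> ?I" by (intro ideal_mult_mult) auto
  have m4: "(gX - cst x) * ?q \<in> ?I"
    unfolding gY_neg_factor[OF c, symmetric] by (intro ideal_mult_mult) auto
  have unit: "gX - cst x \<in> ?I" if "d \<noteq> 0" "(gX - cst x) * cst d \<in> ?I" for d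
  proof -
    have "cst (1 / d) * ((gX - cst x) * cst d) \<in> ?I" by (rule is_idealD(4)[OF I _ that(2)]) auto
    also have "cst (1 / d) * ((gX - cst x) * cst d) = (gX - cst x) * cst (1 / d * d)"
      unfolding cst_mult by (simp add: ac_simps)
    finally show ?thesis using that(1) by (simp add: cst_1)
  qed
  \<comment> \<open>Up to sign these are the partial derivatives of the equation: \<open>?d1\<close>
    is the difference of \<open>y\<close> and the ordinate of the negative point, and
    \<open>?d2\<close> is the value of \<open>?q\<close> at \<open>(x, y)\<close>. The ideal
    contains \<open>(X - x) * ?d1\<close> and \<open>(X - x) * ?d2\<close>, and one of the constants
    is a unit.\<close>
  let ?d1 = "2 * y + a1 * x + a3" and ?d2 = "3 * x\<^sup>2 + 2 * a2 * x + a4 - a1 * y"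
  have "?d1 \<noteq> 0 \<or> ?d2 \<noteq> 0" by (rule w_nonsingular[OF ell c])
  moreover have "gX - cst x \<in> ?I" if "?d1 \<noteq> 0"
  proof (rule unit[OF that])
    have "(gX - cst x) * (gY - cst ?y) - (gY - cst y) * (gX - cst x) \<in> ?I"
      by (rule is_ideal_diff[OF I m2 m3])
    also have "(gX - cst x) * (gY - cst ?y) - (gY - cst y) * (gX - cst x) = (gX - cst x) * cst ?d1"
      unfolding cst_simps by Groebner_Basis.algebra
    finally show "(gX - cst x) * cst ?d1 \<in> ?I" .
  qed
  moreover have "gX - cst x \<in> ?I" if "?d2 \<noteq> 0"
  proof (rule unit[OF that])
    have "(gX - cst x) * ?q - (gX + 2 * cst x + cst a2) * ((gX - cst x) * (gX - cst x))
       + cst a1 * ((gY - cst y) * (gX - cst x)) \<in> ?I"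
      by (intro is_idealD(3)[OF I] is_ideal_diff[OF I] m4 is_idealD(4)[OF I _ m1] is_idealD(4)[OF I _ m3])
        (auto simp flip: cst_numeral)
    also have "(gX - cst x) * ?q - (gX + 2 * cst x + cst a2) * ((gX - cst x) * (gX - cst x))
       + cst a1 * ((gY - cst y) * (gX - cst x)) = (gX - cst x) * cst ?d2"
      unfolding cst_simps by Groebner_Basis.algebra
    finally show "(gX - cst x) * cst ?d2 \<in> ?I" .
  qed
  ultimately show ?thesis by blast
qed

text \<open>The ideals are inverted by the ideals of the negative points. By
  \<open>collinear_line\<close> the element equals \<open>(X - x1) (X - x2) w / ?m\<close>, each
  \<open>X - xi\<close> lies in the product of the ideals of the point and of its negative, and the
  factors from the negatives are absorbed by the forward inclusion for the conjugate line.\<close>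

lemma point_ideal_add_superset:
  assumes c: "collinear l n x1 x2 x3" and y: "y1 = l * x1 + n" "y2 = l * x2 + n"
    and S: "S = Affine x3 (- (l * x3 + n) - a1 * x3 - a3)" "S \<in> ec_points W"
    and T: "Affine x1 y1 \<in> ec_points W" "Affine x2 y2 \<in> ec_points W"
    and w: "w \<in> point_ideal S"
  shows "w / ((gX - cst x3) / line l n) \<in> ideal_mult (point_ideal (Affine x1 y1)) (point_ideal (Affine x2 y2))" (is "_ \<in> ?I")
proof -
  let ?T1 = "Affine x1 y1" and ?T2 = "Affine x2 y2"
  let ?m = "line (- l - a1) (- n - a3)"
  have I: "is_ideal ?I" using T by (intro is_ideal_ideal_mult is_ideal_point_ideal)
  have key: "b1 * b2 * (w / ?m) \<in> coord_ring" if b: "b1 \<in> point_ideal (ec_neg W ?T1)" "b2 \<in> point_ideal (ec_neg W ?T2)" for b1 b2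
  proof -
    have "b1 * b2 * ((gX - cst x3) / ?m) \<in> point_ideal (ec_neg W S)"
    proof (rule point_ideal_add_subset[OF collinear_neg[OF c]])
      show "b1 * b2 \<in> ideal_mult (point_ideal (Affine x1 (- y1 - a1 * x1 - a3))) (point_ideal (Affine x2 (- y2 - a1 * x2 - a3)))"
        using b by (intro ideal_mult_mult) auto
      show "ec_neg W S \<in> ec_points W" by (rule neg_points[OF S(2)])
    qed (simp_all add: y S(1) algebra_simps)
    hence "w * (b1 * b2 * ((gX - cst x3) / ?m)) \<in> ideal_mult (point_ideal S) (point_ideal (ec_neg W S))"
      by (intro ideal_mult_mult w)
    from point_ideal_neg_subset[OF _ this[unfolded S(1)]] S
    have "w * (b1 * b2 * ((gX - cst x3) / ?m)) * (1 / (gX - cst x3)) \<in> coord_ring" by auto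
    moreover have "w * (b1 * b2 * (d / m)) * (1 / d) = b1 * b2 * (w / m)" if "d \<noteq> 0"
      for d m :: "'a poly fract alg_closure"
      using that by simp
    ultimately show ?thesis by (simp add: mult_ac)
  qed
  have "(gX - cst x1) * (gX - cst x2) * (w / ?m) \<in> ?I"
  proof -
    have "(gX - cst x1) * ((gX - cst x2) * (w / ?m)) \<in> ?I"
      using gX_in_point_ideal_neg[OF T(1)] I
    proof (rule ideal_mult_image)
      fix a1 b1 assume 1: "a1 \<in> point_ideal ?T1" "b1 \<in> point_ideal (ec_neg W ?T1)"
      have "(gX - cst x2) * (a1 * b1 * (w / ?m)) \<in> ?I"
        using gX_in_point_ideal_neg[OF T(2)] I
      proof (rule ideal_mult_image)
        fix a2 b2 assume 2: "a2 \<in> point_ideal ?T2" "b2 \<in> point_ideal (ec_neg W ?T2)"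
        have "(b1 * b2 * (w / ?m)) * (a1 * a2) \<in> ?I"
          using 1 2 by (intro is_idealD(4)[OF I] ideal_mult_mult key)
        thus "a2 * b2 * (a1 * b1 * (w / ?m)) \<in> ?I" by (simp add: mult_ac)
      qed
      thus "a1 * b1 * ((gX - cst x2) * (w / ?m)) \<in> ?I" by (simp add: mult_ac)
    qed
    thus ?thesis by (simp add: mult_ac)
  qed
  also have "(gX - cst x1) * (gX - cst x2) * (w / ?m) = w / ((gX - cst x3) / line l n)"
    using collinear_line[OF c] gX_nz line_nz line_nz by (rule frac_cross)
  finally show ?thesis .
qed

lemma affine_points [simp]: "Affine x y \<in> ec_points W \<longleftrightarrow> on_curve W x y"
  by (auto simp: ec_points_def)

lemma Infinity_points [simp]: "Infinity \<in> ec_points W"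
  by (auto simp: ec_points_def)

lemma on_curve_same_x:
  assumes "on_curve W x y1" "on_curve W x y2"
  shows "y2 = y1 \<or> y2 = - y1 - a1 * x - a3"
proof -
  have "(y2 - y1) * (y2 - (- y1 - a1 * x - a3)) = (y2\<^sup>2 + a1 * x * y2 + a3 * y2) - (y1\<^sup>2 + a1 * x * y1 + a3 * y1)"
    by Groebner_Basis.algebra
  also have "\<dots> = 0" using assms by (simp add: on_curve_def)
  finally show ?thesis by auto
qed

lemma ec_add_eq_Infinity_iff:
  assumes "S \<in> ec_points W" "T \<in> ec_points W"
  shows "ec_add W S T = Infinity \<longleftrightarrow> S = ec_neg W T"
proof (cases S; cases T)
  fix x1 y1 x2 y2 assume ST: "S = Affine x1 y1" "T = Affine x2 y2"
  have "y1 + y2 + a1 * x1 + a3 = 0 \<longleftrightarrow> y1 = - y2 - a1 * x1 - a3"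
    by (auto simp: algebra_simps add_eq_0_iff2)
  thus ?thesis using ST by (auto simp: Let_def)
qed auto

lemma line_third_point:
  assumes "on_curve W x1 y1" "on_curve W x2 y2" "\<not> (x1 = x2 \<and> y1 + y2 + a1 * x1 + a3 = 0)"
  defines "l \<equiv> slope W (Affine x1 y1) (Affine x2 y2)"
  defines "n \<equiv> y1 - l * x1"
  defines "x3 \<equiv> l\<^sup>2 + a1 * l - a2 - x1 - x2"
  shows "ec_add W (Affine x1 y1) (Affine x2 y2) = Affine x3 (- (l * x3 + n) - a1 * x3 - a3)"
    and "y1 = l * x1 + n" "y2 = l * x2 + n" "collinear l n x1 x2 x3"
    and "on_curve W x3 (- (l * x3 + n) - a1 * x3 - a3)"
proof -
  show y1: "y1 = l * x1 + n" by (simp add: n_def)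
  show "ec_add W (Affine x1 y1) (Affine x2 y2) = Affine x3 (- (l * x3 + n) - a1 * x3 - a3)"
    using assms(3) by (simp add: Let_def x3_def n_def l_def slope_def algebra_simps)
  \<comment> \<open>The defects in the second and third Vieta relation; the first relation holds by
    the choice of \<open>x3\<close>. So the cubic on the line differs from the expected product by
    the linear polynomial \<open>d1 x - d0\<close>, and two conditions suffice to kill it.\<close>
  define d1 where "d1 = a4 - 2 * l * n - a3 * l - a1 * n - (x1 * x2 + x1 * x3 + x2 * x3)"
  define d0 where "d0 = n\<^sup>2 + a3 * n - a6 - x1 * x2 * x3"
  have lin: "d1 * x - d0 = (x - x1) * (x - x2) * (x3 - x) + (x ^ 3 + a2 * x\<^sup>2 + a4 * x + a6) -
     ((l * x + n)\<^sup>2 + a1 * x * (l * x + n) + a3 * (l * x + n))" for x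
    unfolding d1_def d0_def x3_def by Groebner_Basis.algebra
  have e1: "d1 * x1 - d0 = 0"
    using lin[of x1] assms(1) by (simp add: on_curve_def flip: y1)
  have *: "y2 = l * x2 + n \<and> d1 = 0"
  proof (cases "x1 = x2")
    case False
    have "l * (x2 - x1) = y2 - y1" using False by (simp add: l_def slope_def)
    hence y2: "y2 = l * x2 + n" by (simp add: n_def algebra_simps)
    have "d1 * x2 - d0 = 0"
      using lin[of x2] assms(2) by (simp add: on_curve_def flip: y2)
    hence "d1 * (x1 - x2) = 0" using e1 by (simp add: algebra_simps)
    thus ?thesis using False y2 by simp
  next
    case True
    have nz: "y1 + y2 + a1 * x1 + a3 \<noteq> 0" using assms(3) True by simp
    have y2: "y2 = y1"
      using on_curve_same_x[OF assms(1), of y2] assms(2) True nz by (auto simp: algebra_simps)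
    have nz': "2 * y1 + a1 * x1 + a3 \<noteq> 0" using nz unfolding y2 mult_2 .
    have l: "l * (2 * y1 + a1 * x1 + a3) = 3 * x1\<^sup>2 + 2 * a2 * x1 + a4 - a1 * y1"
      using True nz' by (simp add: l_def slope_def)
    \<comment> \<open>Derivative of \<open>lin\<close> at the double point; it vanishes because
      \<open>l\<close> is the slope of the tangent.\<close>
    have "d1 = (3 * x1\<^sup>2 + 2 * a2 * x1 + a4 - a1 * y1) - l * (2 * y1 + a1 * x1 + a3)"
      unfolding d1_def x3_def True[symmetric] n_def by Groebner_Basis.algebra
    thus ?thesis using l y2 y1 True by simp
  qed
  thus "y2 = l * x2 + n" by simp
  from * e1 have "d1 = 0" "d0 = 0" by auto
  thus "collinear l n x1 x2 x3" unfolding collinear_def d1_def d0_def by (simp add: x3_def)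
  have "(- (l * x3 + n) - a1 * x3 - a3)\<^sup>2 + a1 * x3 * (- (l * x3 + n) - a1 * x3 - a3) +
      a3 * (- (l * x3 + n) - a1 * x3 - a3) = (l * x3 + n)\<^sup>2 + a1 * x3 * (l * x3 + n) + a3 * (l * x3 + n)"
    by Groebner_Basis.algebra
  also have "\<dots> = x3 ^ 3 + a2 * x3\<^sup>2 + a4 * x3 + a6"
    using lin[of x3] \<open>d1 = 0\<close> \<open>d0 = 0\<close> by simp
  finally show "on_curve W x3 (- (l * x3 + n) - a1 * x3 - a3)" by (simp add: on_curve_def)
qed

text \<open>The codimension of \<open>point_ideal T\<close> in the coordinate ring.\<close>

definition pt_degree :: "'a point \<Rightarrow> nat" where "pt_degree T = (if T = Infinity then 0 else 1)"

lemma pt_degree_simps [simp]: "pt_degree Infinity = 0" "pt_degree (Affine x y) = 1"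
  by (simp_all add: pt_degree_def)

lemma pt_degree_neg [simp]: "pt_degree (ec_neg W T) = pt_degree T"
  by (cases T) auto

text \<open>\<open>point_ideal S * point_ideal T = (l / v) * point_ideal (S + T)\<close> as fractional ideals.\<close>

definition transfers :: "'a point \<Rightarrow> 'a point \<Rightarrow> 'a poly fract alg_closure \<Rightarrow> 'a poly fract alg_closure \<Rightarrow> bool" where
  "transfers S T v l \<longleftrightarrow> v \<in> coord_ring \<and> l \<in> coord_ring \<and> v \<noteq> 0 \<and> l \<noteq> 0 \<and>
     pole_order v + pt_degree S + pt_degree T = pole_order l + pt_degree (ec_add W S T) \<and>
     (\<forall>z. z \<in> ideal_mult (point_ideal S) (point_ideal T) \<longleftrightarrow> z * (v / l) \<in> point_ideal (ec_add W S T))"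

lemma transfersI:
  assumes "v \<in> coord_ring" "l \<in> coord_ring" "v \<noteq> 0" "l \<noteq> 0" "pole_order v + pt_degree S + pt_degree T = pole_order l + pt_degree (ec_add W S T)"
    "\<And>z. z \<in> ideal_mult (point_ideal S) (point_ideal T) \<Longrightarrow> z * (v / l) \<in> point_ideal (ec_add W S T)"
    "\<And>w. w \<in> point_ideal (ec_add W S T) \<Longrightarrow> w / (v / l) \<in> ideal_mult (point_ideal S) (point_ideal T)"
  shows "transfers S T v l"
proof -
  have "z \<in> ideal_mult (point_ideal S) (point_ideal T)" if "z * (v / l) \<in> point_ideal (ec_add W S T)" for z
    using assms(7)[OF that] assms(3,4) by simp
  thus ?thesis using assms(1-6) unfolding transfers_def by blast
qed

lemma ideal_mult_coord_ring: assumes "is_ideal I" shows "ideal_mult coord_ring I = I" "ideal_mult I coord_ring = I"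
proof -
  show "ideal_mult coord_ring I = I"
  proof
    show "ideal_mult coord_ring I \<subseteq> I" by (intro ideal_mult_subsetI assms is_idealD(4)[OF assms])
    show "I \<subseteq> ideal_mult coord_ring I" using ideal_mult_mult[of 1 coord_ring _ I] by auto
  qed
  show "ideal_mult I coord_ring = I"
  proof
    show "ideal_mult I coord_ring \<subseteq> I" by (intro ideal_mult_subsetI assms is_idealD(5)[OF assms])
    show "I \<subseteq> ideal_mult I coord_ring" using ideal_mult_mult[of _ I 1 coord_ring] by auto
  qed
qed

lemma transfers_chord:
  assumes "on_curve W x1 y1" "on_curve W x2 y2" "ec_add W (Affine x1 y1) (Affine x2 y2) = Affine x3 y3"
  shows "transfers (Affine x1 y1) (Affine x2 y2) (gX - cst x3)
     (line (slope W (Affine x1 y1) (Affine x2 y2)) (y1 - slope W (Affine x1 y1) (Affine x2 y2) * x1))"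
proof -
  have n: "\<not> (x1 = x2 \<and> y1 + y2 + a1 * x1 + a3 = 0)" using assms(3) by auto
  define l where "l = slope W (Affine x1 y1) (Affine x2 y2)"
  note L = line_third_point[OF assms(1,2) n, folded l_def]
  have x3: "x3 = l\<^sup>2 + a1 * l - a2 - x1 - x2" using L(1)[unfolded assms(3)] by simp
  have S: "Affine x3 y3 = Affine x3 (- (l * x3 + (y1 - l * x1)) - a1 * x3 - a3)"
    using L(1)[unfolded assms(3), folded x3] .
  have P: "Affine x3 y3 \<in> ec_points W" unfolding S using L(5)[folded x3] by simp
  show ?thesis
    unfolding l_def[symmetric]
  proof (rule transfersI, goal_cases)
    case 5 thus ?case unfolding assms(3) by (simp add: pole_order_gX pole_order_line)
  next
    case (6 z)
    thus ?case unfolding assms(3)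
      using point_ideal_add_subset[OF L(4)[folded x3] L(2,3) S P] by blast
  next
    case (7 w)
    thus ?case unfolding assms(3)
      using point_ideal_add_superset[OF L(4)[folded x3] L(2,3) S P] assms(1,2) by simp
  qed (auto simp: gX_nz)
qed

lemma transfers_neg:
  assumes "Affine x y \<in> ec_points W"
  shows "transfers (Affine x y) (ec_neg W (Affine x y)) 1 (gX - cst x)"
proof -
  have e: "ec_add W (Affine x y) (ec_neg W (Affine x y)) = Infinity"
    using ec_add_eq_Infinity_iff[OF assms neg_points[OF assms]] by simp
  have I: "is_ideal (ideal_mult (point_ideal (Affine x y)) (point_ideal (ec_neg W (Affine x y))))"
    using assms neg_points[OF assms] by (intro is_ideal_ideal_mult is_ideal_point_ideal)
  show ?thesis
  proof (rule transfersI, goal_cases)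
    case 5 thus ?case unfolding e by (simp add: pole_order_gX)
  next
    case (6 z)
    thus ?case unfolding e using point_ideal_neg_subset[OF assms 6] by simp
  next
    case (7 w)
    hence "w * (gX - cst x) \<in> ideal_mult (point_ideal (Affine x y)) (point_ideal (ec_neg W (Affine x y)))"
      unfolding e using gX_in_point_ideal_neg[OF assms] by (intro is_idealD(4)[OF I]) auto
    thus ?case by simp
  qed (auto simp: gX_nz)
qed

lemma ec_add_closed:
  assumes "S \<in> ec_points W" "T \<in> ec_points W"
  shows "ec_add W S T \<in> ec_points W"
proof (cases S; cases T)
  fix x1 y1 x2 y2 assume ST: "S = Affine x1 y1" "T = Affine x2 y2"
  hence c: "on_curve W x1 y1" "on_curve W x2 y2" using assms by simp_all
  show ?thesis
  proof (cases "x1 = x2 \<and> y1 + y2 + a1 * x1 + a3 = 0")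
    case False
    show ?thesis unfolding ST line_third_point(1)[OF c False] using line_third_point(5)[OF c False] by simp
  next
    case True
    show ?thesis unfolding ST ec_add.simps if_P[OF True] by simp
  qed
qed (use assms in auto)

lemma ex_transfers:
  assumes "S \<in> ec_points W" "T \<in> ec_points W"
  shows "\<exists>v l. transfers S T v l"
proof (cases S)
  case Infinity
  hence "transfers S T 1 1" using ideal_mult_coord_ring[OF is_ideal_point_ideal[OF assms(2)]] by (simp add: transfers_def)
  thus ?thesis by blast
next
  case S: (Affine x1 y1)
  show ?thesis
  proof (cases T)
    case Infinity
    hence "transfers S T 1 1" using ideal_mult_coord_ring[OF is_ideal_point_ideal[OF assms(1)]] S by (simp add: transfers_def)
    thus ?thesis by blast
  next
    case T: (Affine x2 y2)
    show ?thesis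
    proof (cases "ec_add W S T")
      case Infinity
      hence "S = ec_neg W T" using ec_add_eq_Infinity_iff assms by simp
      hence "T = ec_neg W S" by simp
      thus ?thesis using transfers_neg[of x1 y1] S assms by auto
    next
      case (Affine x3 y3)
      thus ?thesis using transfers_chord[of x1 y1 x2 y2 x3 y3] S T assms by auto
    qed
  qed
qed

section \<open>Products of point ideals, Abel's theorem and associativity\<close>

fun points_ideal :: "'a point list \<Rightarrow> 'a poly fract alg_closure set" where
  "points_ideal [] = coord_ring"
| "points_ideal (T # Ts) = ideal_mult (point_ideal T) (points_ideal Ts)"

fun point_sum :: "'a point list \<Rightarrow> 'a point" where
  "point_sum [] = Infinity"
| "point_sum (T # Ts) = ec_add W T (point_sum Ts)"

lemma is_ideal_points_ideal: "set Ts \<subseteq> ec_points W \<Longrightarrow> is_ideal (points_ideal Ts)"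
  by (induction Ts) (auto intro: is_ideal_ideal_mult is_ideal_point_ideal)

lemma point_sum_closed: "set Ts \<subseteq> ec_points W \<Longrightarrow> point_sum Ts \<in> ec_points W"
  by (induction Ts) (auto intro: ec_add_closed)

text \<open>Repeated use of \<open>ex_transfers\<close> collapses the product of the ideals to the
  ideal of the sum. The equation of pole orders is the conservation of degree along the way.\<close>

lemma points_ideal_point_sum:
  assumes "set Ts \<subseteq> ec_points W"
  shows "\<exists>v l. v \<in> coord_ring \<and> l \<in> coord_ring \<and> v \<noteq> 0 \<and> l \<noteq> 0 \<and>
     pole_order v + (\<Sum>T\<leftarrow>Ts. pt_degree T) = pole_order l + pt_degree (point_sum Ts) \<and>
     (\<forall>z\<in>points_ideal Ts. z * (v / l) \<in> point_ideal (point_sum Ts))"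
  using assms
proof (induction Ts)
  case Nil
  show ?case by (rule exI[of _ 1], rule exI[of _ 1]) simp
next
  case (Cons T Ts)
  then obtain v l where vl: "v \<in> coord_ring" "l \<in> coord_ring" "v \<noteq> 0" "l \<noteq> 0"
     "pole_order v + (\<Sum>T\<leftarrow>Ts. pt_degree T) = pole_order l + pt_degree (point_sum Ts)"
     "\<And>z. z \<in> points_ideal Ts \<Longrightarrow> z * (v / l) \<in> point_ideal (point_sum Ts)" by auto
  have P: "T \<in> ec_points W" "point_sum Ts \<in> ec_points W" using Cons.prems point_sum_closed by auto
  then obtain v' l' where t: "transfers T (point_sum Ts) v' l'" using ex_transfers by blast
  show ?case
  proof (intro exI conjI ballI)
    show "v * v' \<in> coord_ring" "l * l' \<in> coord_ring" "v * v' \<noteq> 0" "l * l' \<noteq> 0"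
      using t vl by (auto simp: transfers_def)
    show "pole_order (v * v') + (\<Sum>T\<leftarrow>T # Ts. pt_degree T) = pole_order (l * l') + pt_degree (point_sum (T # Ts))"
      using t vl by (auto simp: transfers_def pole_order_mult)
    fix z assume "z \<in> points_ideal (T # Ts)"
    hence z: "z \<in> ideal_mult (point_ideal T) (points_ideal Ts)" by simp
    have "z * (v / l) \<in> ideal_mult (point_ideal T) (point_ideal (point_sum Ts))"
      using z is_ideal_ideal_mult[OF P[THEN is_ideal_point_ideal]]
    proof (rule ideal_mult_image)
      fix a b assume "a \<in> point_ideal T" "b \<in> points_ideal Ts"
      hence "a * (b * (v / l)) \<in> ideal_mult (point_ideal T) (point_ideal (point_sum Ts))" by (intro ideal_mult_mult vl(6))
      thus "a * b * (v / l) \<in> ideal_mult (point_ideal T) (point_ideal (point_sum Ts))" by (simp only: mult.assoc)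
    qed
    hence "z * (v / l) * (v' / l') \<in> point_ideal (ec_add W T (point_sum Ts))" using t by (simp only: transfers_def)
    thus "z * (v * v' / (l * l')) \<in> point_ideal (point_sum (T # Ts))" by (simp add: mult.assoc)
  qed
qed

text \<open>The second part is Abel's theorem: the zeros of a function on the curve sum to \<open>O\<close>.\<close>

lemma points_ideal_pole_order:
  assumes "set Ts \<subseteq> ec_points W" "g \<in> points_ideal Ts" "g \<noteq> 0"
  shows "(\<Sum>T\<leftarrow>Ts. pt_degree T) \<le> pole_order g"
    and "(\<Sum>T\<leftarrow>Ts. pt_degree T) = pole_order g \<Longrightarrow> point_sum Ts = Infinity"
proof -
  let ?n = "\<Sum>T\<leftarrow>Ts. pt_degree T"
  obtain v l where vl: "v \<in> coord_ring" "l \<in> coord_ring" "v \<noteq> 0" "l \<noteq> 0"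
     "pole_order v + ?n = pole_order l + pt_degree (point_sum Ts)"
     "\<And>z. z \<in> points_ideal Ts \<Longrightarrow> z * (v / l) \<in> point_ideal (point_sum Ts)" using points_ideal_point_sum[OF assms(1)] by auto
  have gR: "g \<in> coord_ring" using is_idealD(1)[OF is_ideal_points_ideal[OF assms(1)] assms(2)] .
  define w where "w = g * (v / l)"
  have w: "w \<in> point_ideal (point_sum Ts)" unfolding w_def by (rule vl(6)[OF assms(2)])
  have wR: "w \<in> coord_ring" using is_idealD(1)[OF is_ideal_point_ideal[OF point_sum_closed[OF assms(1)]] w] .
  have wnz: "w \<noteq> 0" unfolding w_def using vl assms(3) by simp
  have "w * l = g * v" unfolding w_def using vl by simp
  hence "pole_order w + pole_order l = pole_order g + pole_order v"
    using pole_order_mult[OF wR vl(2) wnz vl(4)] pole_order_mult[OF gR vl(1) assms(3) vl(3)] by simp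
  hence o: "pole_order g + pt_degree (point_sum Ts) = pole_order w + ?n" using vl(5) by linarith
  \<comment> \<open>If the sum is affine, \<open>w\<close> is a nonzero function that vanishes at a
    point. It is not constant, so its pole order is at least 2, and \<open>o\<close> gives strict
    inequality.\<close>
  have "?n \<le> pole_order g \<and> (?n = pole_order g \<longrightarrow> point_sum Ts = Infinity)"
  proof (cases "point_sum Ts")
    case (Affine x y)
    have "pole_order w \<noteq> 1" by (rule pole_order_neq_1[OF wR])
    moreover have "pole_order w \<noteq> 0"
    proof
      assume "pole_order w = 0"
      then obtain c where "w = cst c" using pole_order_0D[OF wR] by blast
      thus False using w wnz Affine by (simp add: cst_point_ideal_iff)
    qed
    ultimately show ?thesis using o Affine by simp
  qed (use o in simp)
  thus "?n \<le> pole_order g" "?n = pole_order g \<Longrightarrow> point_sum Ts = Infinity" by auto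
qed

lemma points_ideal_swap:
  assumes "S \<in> ec_points W" "T \<in> ec_points W" "set Ts \<subseteq> ec_points W"
  shows "points_ideal (S # T # Ts) = points_ideal (T # S # Ts)"
  using ideal_mult_left_commute[OF is_ideal_point_ideal[OF assms(1)] is_ideal_point_ideal[OF assms(2)] is_ideal_points_ideal[OF assms(3)]]
    ideal_mult_left_commute[OF is_ideal_point_ideal[OF assms(2)] is_ideal_point_ideal[OF assms(1)] is_ideal_points_ideal[OF assms(3)]]
  by auto

text \<open>The function with divisor \<open>A + B + C + (- S)\<close> for \<open>S = (A + B) + C\<close>.\<close>

lemma four_points:
  assumes P: "A \<in> ec_points W" "B \<in> ec_points W" "C \<in> ec_points W"
    and t1: "transfers A B v l" and t2: "transfers (ec_add W A B) C v' l'"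
    and t3: "transfers S (ec_neg W S) 1 l''" and S: "S = ec_add W (ec_add W A B) C"
  shows "l * l' * l'' / (v * v') \<in> points_ideal [A, B, C, ec_neg W S]"
proof -
  have PS: "S \<in> ec_points W" "ec_add W A B \<in> ec_points W" using S P ec_add_closed by auto
  have nS: "ec_neg W S \<in> ec_points W" using neg_points PS by simp
  have nz: "v \<noteq> 0" "l \<noteq> 0" "v' \<noteq> 0" "l' \<noteq> 0" "l'' \<noteq> 0" using t1 t2 t3 by (auto simp: transfers_def)
  have inf: "ec_add W S (ec_neg W S) = Infinity" using ec_add_eq_Infinity_iff PS nS by simp
  let ?K = "points_ideal [A, B, C, ec_neg W S]"
  have K: "is_ideal ?K" using P nS by (intro is_ideal_points_ideal) auto
  have "l'' * (1 / l'') \<in> point_ideal (ec_add W S (ec_neg W S))" unfolding inf using nz by simp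
  hence "l'' \<in> ideal_mult (point_ideal S) (point_ideal (ec_neg W S))" using t3 by (simp only: transfers_def)
  hence "l'' * (l * l' / (v * v')) \<in> ?K"
    using K
  proof (rule ideal_mult_image)
    fix a b assume ab: "a \<in> point_ideal S" "b \<in> point_ideal (ec_neg W S)"
    have "a * (l' / v') * (v' / l') \<in> point_ideal S" using ab nz by simp
    hence "a * (l' / v') \<in> ideal_mult (point_ideal (ec_add W A B)) (point_ideal C)" using t2 S by (simp only: transfers_def)
    hence "a * (l' / v') * (b * (l / v)) \<in> ?K" using K
    proof (rule ideal_mult_image)
      fix c d assume cd: "c \<in> point_ideal (ec_add W A B)" "d \<in> point_ideal C"
      have "c * (l / v) * (v / l) \<in> point_ideal (ec_add W A B)" using cd nz by simp
      hence "c * (l / v) \<in> ideal_mult (point_ideal A) (point_ideal B)" using t1 by (simp only: transfers_def)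
      hence "c * (l / v) * (d * b) \<in> ?K" using K
      proof (rule ideal_mult_image)
        fix e f assume ef: "e \<in> point_ideal A" "f \<in> point_ideal B"
        have "e * (f * (d * (b * 1))) \<in> ?K"
          unfolding points_ideal.simps using ef cd ab by (intro ideal_mult_mult) auto
        thus "e * f * (d * b) \<in> ?K" by (simp only: mult_1_right mult.assoc)
      qed
      thus "c * d * (b * (l / v)) \<in> ?K" by (simp only: mult_ac)
    qed
    thus "a * b * (l * l' / (v * v')) \<in> ?K" by (simp add: mult_ac)
  qed
  thus ?thesis by (simp add: mult_ac)
qed

lemma pole_order_four_points:
  assumes P: "A \<in> ec_points W" "B \<in> ec_points W" "C \<in> ec_points W"
    and t1: "transfers A B v l" and t2: "transfers (ec_add W A B) C v' l'"
    and t3: "transfers S (ec_neg W S) 1 l''" and S: "S = ec_add W (ec_add W A B) C"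
  shows "pole_order (l * l' * l'' / (v * v')) = pt_degree A + pt_degree B + pt_degree C + pt_degree S"
proof -
  let ?g = "l * l' * l'' / (v * v')"
  have PS: "S \<in> ec_points W" using S P ec_add_closed by auto
  have inf: "ec_add W S (ec_neg W S) = Infinity" using ec_add_eq_Infinity_iff PS neg_points by simp
  note t = t1[unfolded transfers_def] t2[unfolded transfers_def] t3[unfolded transfers_def inf]
  have "?g \<in> coord_ring" using is_idealD(1)[OF is_ideal_points_ideal four_points[OF assms]] P neg_points[OF PS] by auto
  moreover have "?g \<noteq> 0" using t by auto
  ultimately have "pole_order (?g * (v * v')) = pole_order ?g + (pole_order v + pole_order v')"
    using t by (simp only: pole_order_mult coord_ring_mult mult_eq_0_iff simp_thms)
  also have "?g * (v * v') = l * l' * l''" using t by simp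
  also have "pole_order \<dots> = pole_order l + pole_order l' + pole_order l''" using t by (simp add: pole_order_mult)
  finally show ?thesis using t S by simp
qed

lemma ex_transfers_neg: "S \<in> ec_points W \<Longrightarrow> \<exists>l. transfers S (ec_neg W S) 1 l"
proof (cases S)
  case Infinity
  hence "transfers S (ec_neg W S) 1 1" using ideal_mult_coord_ring[OF is_ideal_coord_ring] by (simp add: transfers_def)
  thus ?thesis ..
qed (use transfers_neg in blast)

text \<open>\<open>four_points\<close> yields a function from the left-nested sum
  \<open>S = (A + B) + C\<close>. As the ideal product is commutative, its factors may be
  rearranged, and \<open>point_sum\<close> reads the zeros with nesting to the right: Abel's theorem
  gives \<open>- S + (A + (B + C)) = O\<close>. Moving \<open>- S\<close> to the front keeps
  \<open>A + (B + C)\<close> intact.\<close>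

lemma ec_add_assoc:
  assumes P: "A \<in> ec_points W" "B \<in> ec_points W" "C \<in> ec_points W"
  shows "ec_add W (ec_add W A B) C = ec_add W A (ec_add W B C)"
proof -
  define S where "S = ec_add W (ec_add W A B) C"
  have PS: "S \<in> ec_points W" "ec_add W A B \<in> ec_points W" unfolding S_def using P ec_add_closed by auto
  have nS: "ec_neg W S \<in> ec_points W" using neg_points PS by simp
  obtain v l v' l' l'' where t: "transfers A B v l" "transfers (ec_add W A B) C v' l'"
    "transfers S (ec_neg W S) 1 l''"
    using ex_transfers[OF P(1,2)] ex_transfers[OF PS(2) P(3)] ex_transfers_neg[OF PS(1)] by blast
  let ?g = "l * l' * l'' / (v * v')"
  have "?g \<in> points_ideal [A, B, C, ec_neg W S]" by (rule four_points[OF P t S_def])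
  also have "points_ideal [A, B, C, ec_neg W S] = points_ideal [A, B, ec_neg W S, C]"
    using points_ideal_swap[of C "ec_neg W S" "[]"] P nS by simp
  also have "\<dots> = points_ideal [A, ec_neg W S, B, C]"
    using points_ideal_swap[of B "ec_neg W S" "[C]"] P nS by simp
  also have "\<dots> = points_ideal [ec_neg W S, A, B, C]"
    using points_ideal_swap[of A "ec_neg W S" "[B, C]"] P nS by simp
  finally have g: "?g \<in> points_ideal [ec_neg W S, A, B, C]" .
  have "?g \<noteq> 0" using t by (auto simp: transfers_def)
  moreover have "pole_order ?g = pt_degree A + pt_degree B + pt_degree C + pt_degree S"
    by (rule pole_order_four_points[OF P t S_def])
  ultimately have "point_sum [ec_neg W S, A, B, C] = Infinity"
    using points_ideal_pole_order(2)[OF _ g] P nS by simp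
  moreover have "ec_add W C Infinity = C" by (cases C) auto
  ultimately have "ec_add W (ec_neg W S) (ec_add W A (ec_add W B C)) = Infinity" by simp
  hence "ec_neg W S = ec_neg W (ec_add W A (ec_add W B C))"
    using ec_add_eq_Infinity_iff nS P ec_add_closed by simp
  hence "S = ec_add W A (ec_add W B C)" by (metis ec_neg_neg)
  thus ?thesis by (simp add: S_def)
qed

lemma slope_commute:
  assumes "on_curve W x1 y1" "on_curve W x2 y2" "\<not> (x1 = x2 \<and> y1 + y2 + a1 * x1 + a3 = 0)"
  shows "slope W (Affine x1 y1) (Affine x2 y2) = slope W (Affine x2 y2) (Affine x1 y1)"
proof (cases "x1 = x2")
  case True
  hence "y2 = y1" using on_curve_same_x[OF assms(1), of y2] assms(2,3) by (auto simp: algebra_simps)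
  thus ?thesis using True by simp
next
  case False
  thus ?thesis by (simp add: slope_def) (metis minus_diff_eq minus_divide_divide)
qed

lemma ec_add_commute:
  assumes "S \<in> ec_points W" "T \<in> ec_points W"
  shows "ec_add W S T = ec_add W T S"
proof (cases S; cases T)
  fix x1 y1 x2 y2 assume ST: "S = Affine x1 y1" "T = Affine x2 y2"
  hence c: "on_curve W x1 y1" "on_curve W x2 y2" using assms by simp_all
  show ?thesis
  proof (cases "x1 = x2 \<and> y1 + y2 + a1 * x1 + a3 = 0")
    case False
    hence F: "\<not> (x2 = x1 \<and> y2 + y1 + a1 * x2 + a3 = 0)" by (auto simp: add.commute)
    define l where "l = slope W (Affine x1 y1) (Affine x2 y2)"
    have l: "slope W (Affine x2 y2) (Affine x1 y1) = l" using slope_commute[OF c False] l_def by simp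
    note L = line_third_point[OF c False, folded l_def]
    note L' = line_third_point[OF c(2,1) F, unfolded l]
    have e1: "y2 - l * x2 = y1 - l * x1" using L(2,3) by simp
    have e2: "l\<^sup>2 + a1 * l - a2 - x2 - x1 = l\<^sup>2 + a1 * l - a2 - x1 - x2" by simp
    show ?thesis unfolding ST L(1) L'(1) e1 e2 ..
  next
    case True
    hence T: "x2 = x1 \<and> y2 + y1 + a1 * x2 + a3 = 0" by (auto simp: add.commute)
    show ?thesis unfolding ST ec_add.simps if_P[OF True] if_P[OF T] ..
  qed
qed auto

lemma comm_group_ec: "comm_group (ec_group W)"
proof (rule comm_groupI)
  fix x assume "x \<in> carrier (ec_group W)"
  thus "\<exists>y\<in>carrier (ec_group W). y \<otimes>\<^bsub>ec_group W\<^esub> x = \<one>\<^bsub>ec_group W\<^esub>"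
    using ec_add_eq_Infinity_iff neg_points by (intro bexI[of _ "ec_neg W x"]) (auto simp: ec_group_def)
qed (auto simp: ec_group_def ec_add_closed ec_add_assoc intro: ec_add_commute)

subsection \<open>Slopes and zeros\<close>

text \<open>A function with a pole of order 4 at infinity, normalised to leading term
  \<open>x^2\<close>. Comparing the coefficients of \<open>Y\<close> shows that the slopes survive
  in it only through their sum.\<close>

lemma chord_product:
  assumes "g \<in> coord_ring" "g * (gX - cst x0) = line l n * line l' n'"
  obtains A where "g = reg A [:- l - l' - a1:]" "degree A = 2" "coeff A 2 = 1"
proof -
  from assms(1) obtain A B where g: "g = reg A B" by (rule RgE)
  have "reg A B * reg [:-x0, 1:] 0 = reg [:-n, -l:] 1 * reg [:-n', -l':] 1"
    using assms(2) unfolding g gX_reg line_reg unfolding emb_reg .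
  hence e: "A * [:-x0, 1:] = [:-n, -l:] * [:-n', -l':] + cubic"
       "B * [:-x0, 1:] = [:-n, -l:] + [:-n', -l':] - ycoeff"
    unfolding reg_mult reg_eq_iff by (simp_all add: algebra_simps)
  have "degree (B * [:-x0, 1:]) \<le> 1" unfolding e(2) ycoeff_def by simp
  hence "degree B = 0" by (cases "B = 0") (simp_all add: degree_mult_eq del: mult_pCons_right)
  then obtain b where b: "B = [:b:]" by (rule degree_eq_zeroE)
  have "b = - l - l' - a1" using arg_cong[OF e(2), of "\<lambda>p. coeff p 1"] unfolding b ycoeff_def by simp
  moreover have d3: "degree (A * [:-x0, 1:]) = 3" unfolding e(1) cubic_def by simp
  hence Anz: "A \<noteq> 0" by auto
  hence "degree A = 2" using d3 by (simp add: degree_mult_eq del: mult_pCons_right)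
  moreover have "coeff A 2 = 1"
  proof -
    have "lead_coeff (A * [:-x0, 1:]) = lead_coeff A" by (simp only: lead_coeff_mult) simp
    moreover have "lead_coeff (A * [:-x0, 1:]) = 1" unfolding e(1) cubic_def by simp
    ultimately show ?thesis using \<open>degree A = 2\<close> by simp
  qed
  ultimately show thesis using that g b by simp
qed

lemma not_opposite:
  "ec_add W (Affine x1 y1) (Affine x2 y2) = Affine x3 y3 \<Longrightarrow> \<not> (x1 = x2 \<and> y1 + y2 + a1 * x1 + a3 = 0)"
  by auto

lemma chord_product_points_ideal:
  assumes c: "on_curve W x1 y1" "on_curve W x2 y2" "on_curve W x3 y3"
    and AB: "ec_add W (Affine x1 y1) (Affine x2 y2) = Affine x4 y4"
    and S: "ec_add W (Affine x4 y4) (Affine x3 y3) = Affine x5 y5"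
  obtains A where "reg A [:- slope W (Affine x1 y1) (Affine x2 y2) - slope W (Affine x4 y4) (Affine x3 y3) - a1:]
      \<in> points_ideal [Affine x1 y1, Affine x2 y2, Affine x3 y3, ec_neg W (Affine x5 y5)]"
    "degree A = 2" "coeff A 2 = 1"
proof -
  have P: "Affine x1 y1 \<in> ec_points W" "Affine x2 y2 \<in> ec_points W" "Affine x3 y3 \<in> ec_points W"
    using c by simp_all
  have c4: "on_curve W x4 y4" using ec_add_closed[OF P(1,2)] unfolding AB by simp
  have PS: "Affine x5 y5 \<in> ec_points W" using ec_add_closed[of "Affine x4 y4", OF _ P(3)] c4 unfolding S by simp
  let ?l = "slope W (Affine x1 y1) (Affine x2 y2)" and ?l' = "slope W (Affine x4 y4) (Affine x3 y3)"
  \<comment> \<open>The factor \<open>X - x5\<close> cancels; it is kept so that the term has the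
    form produced by \<open>four_points\<close>.\<close>
  let ?g = "line ?l (y1 - ?l * x1) * line ?l' (y4 - ?l' * x4) * (gX - cst x5) / ((gX - cst x4) * (gX - cst x5))"
  have g: "?g \<in> points_ideal [Affine x1 y1, Affine x2 y2, Affine x3 y3, ec_neg W (Affine x5 y5)]" (is "_ \<in> ?K")
  proof (rule four_points[OF P])
    show "transfers (Affine x1 y1) (Affine x2 y2) (gX - cst x4) (line ?l (y1 - ?l * x1))"
      by (rule transfers_chord[OF c(1,2) AB])
    show "transfers (ec_add W (Affine x1 y1) (Affine x2 y2)) (Affine x3 y3) (gX - cst x5) (line ?l' (y4 - ?l' * x4))"
      unfolding AB by (rule transfers_chord[OF c4 c(3) S])
    show "transfers (Affine x5 y5) (ec_neg W (Affine x5 y5)) 1 (gX - cst x5)"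
      by (rule transfers_neg[OF PS])
  qed (simp only: AB S)
  have K: "is_ideal ?K" using P neg_points[OF PS] by (intro is_ideal_points_ideal) auto
  have gR: "?g \<in> coord_ring" by (rule is_idealD(1)[OF K g])
  have *: "a * b * d / (e * d) * e = a * b" if "d \<noteq> 0" "e \<noteq> 0" for a b d e :: "'a poly fract alg_closure"
    using that by simp
  have "?g * (gX - cst x4) = line ?l (y1 - ?l * x1) * line ?l' (y4 - ?l' * x4)"
    by (rule *[OF gX_nz gX_nz])
  from chord_product[OF gR this] obtain A where A: "?g = reg A [:- ?l - ?l' - a1:]" "degree A = 2" "coeff A 2 = 1" .
  show thesis by (rule that[OF g[unfolded A(1)] A(2,3)])
qed

text \<open>
  The function with divisor \<open>A + B + C + (- (A + B + C)) - 4 O\<close> and leading term \<open>x\<^sup>2\<close> is unique, and the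
  coefficient of \<open>y\<close> in it is the sum of the slopes up to sign and \<open>a1\<close>.
\<close>

lemma slope_cocycle:
  assumes P: "A \<in> ec_points W" "B \<in> ec_points W" "C \<in> ec_points W"
    and nz: "A \<noteq> Infinity" "B \<noteq> Infinity" "C \<noteq> Infinity" "ec_add W A B \<noteq> Infinity"
      "ec_add W B C \<noteq> Infinity" "ec_add W (ec_add W A B) C \<noteq> Infinity"
  shows "slope W A B + slope W (ec_add W A B) C = slope W A (ec_add W B C) + slope W B C"
proof -
  obtain x1 y1 x2 y2 x3 y3 where A: "A = Affine x1 y1" and B: "B = Affine x2 y2" and C: "C = Affine x3 y3"
    using nz by (metis point.exhaust)
  obtain x4 y4 x5 y5 x6 y6 where AB: "ec_add W A B = Affine x4 y4" and S: "ec_add W (ec_add W A B) C = Affine x5 y5"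
    and BC: "ec_add W B C = Affine x6 y6"
    using nz by (metis point.exhaust)
  have c: "on_curve W x1 y1" "on_curve W x2 y2" "on_curve W x3 y3" using P A B C by auto
  have c6: "on_curve W x6 y6" using ec_add_closed[OF P(2,3)] BC by simp
  have S': "ec_add W (ec_add W B C) A = Affine x5 y5"
    using ec_add_assoc[OF P] ec_add_commute[OF P(1) ec_add_closed[OF P(2,3)]] S by simp
  have nS: "ec_neg W (Affine x5 y5) \<in> ec_points W"
    using ec_add_closed[OF ec_add_closed[OF P(1,2)] P(3)] unfolding S by (rule neg_points)
  let ?l1 = "slope W A B" and ?l2 = "slope W (ec_add W A B) C"
  let ?m1 = "slope W B C" and ?m2 = "slope W (ec_add W B C) A"
  let ?K = "points_ideal [A, B, C, ec_neg W (Affine x5 y5)]"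
  obtain U where U: "reg U [:- ?l1 - ?l2 - a1:] \<in> ?K" "degree U = 2" "coeff U 2 = 1"
    using chord_product_points_ideal[OF c AB[unfolded A B] S[unfolded AB, unfolded C]] unfolding A B C AB[unfolded A B] .
  obtain V where V: "reg V [:- ?m1 - ?m2 - a1:] \<in> points_ideal [B, C, A, ec_neg W (Affine x5 y5)]" "degree V = 2" "coeff V 2 = 1"
    using chord_product_points_ideal[OF c(2,3,1) BC[unfolded B C] S'[unfolded BC, unfolded A]] unfolding A B C BC[unfolded B C] .
  have K: "is_ideal ?K" using P nS by (intro is_ideal_points_ideal) auto
  have "points_ideal [B, C, A, ec_neg W (Affine x5 y5)] = points_ideal [B, A, C, ec_neg W (Affine x5 y5)]"
    using points_ideal_swap[OF P(3,1), of "[ec_neg W (Affine x5 y5)]"] nS by simp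
  also have "\<dots> = ?K" using points_ideal_swap[OF P(2,1), of "[C, ec_neg W (Affine x5 y5)]"] nS P by simp
  finally have V': "reg V [:- ?m1 - ?m2 - a1:] \<in> ?K" using V by simp
  have "reg U [:- ?l1 - ?l2 - a1:] - reg V [:- ?m1 - ?m2 - a1:] \<in> ?K" by (rule is_ideal_diff[OF K U(1) V'])
  hence D: "reg (U - V) [:(?m1 + ?m2) - (?l1 + ?l2):] \<in> ?K" by (simp add: reg_diff algebra_simps)
  have "?m1 + ?m2 = ?l1 + ?l2"
  proof (rule ccontr)
    assume n: "?m1 + ?m2 \<noteq> ?l1 + ?l2"
    \<comment> \<open>The leading terms cancel, so the difference has pole order 3 although it lies
      in the ideal of four affine points.\<close>
    have "degree (U - V) \<le> 1"
    proof (rule degree_le, intro allI impI)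
      fix i :: nat assume "1 < i"
      hence "i = 2 \<or> i > 2" by auto
      thus "coeff (U - V) i = 0" using U V by (auto simp: coeff_eq_0)
    qed
    hence "degree (rnorm (U - V) [:(?m1 + ?m2) - (?l1 + ?l2):]) = 3"
      using n by (subst rnorm_big_B(1)) auto
    moreover have "(\<Sum>T\<leftarrow>[A, B, C, ec_neg W (Affine x5 y5)]. pt_degree T) \<le> pole_order (reg (U - V) [:(?m1 + ?m2) - (?l1 + ?l2):])"
      using n nS P by (intro points_ideal_pole_order(1) D) auto
    ultimately show False unfolding pole_order_reg by (simp add: A B C)
  qed
  moreover have "?m2 = slope W A (ec_add W B C)"
    unfolding BC A using slope_commute[OF c6 c(1) not_opposite] S'[unfolded BC A] by blast
  ultimately show ?thesis by (metis add.commute)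
qed

lemma separate_points:
  assumes "T \<in> ec_points W" "T' \<in> ec_points W" "T \<noteq> T'" "T \<noteq> Infinity" "T' \<noteq> Infinity"
  obtains e where "e \<in> point_ideal T'" "1 - e \<in> point_ideal T"
proof -
  obtain x y x' y' where T: "T = Affine x y" "T' = Affine x' y'" using assms by (metis point.exhaust)
  show thesis
  proof (cases "x = x'")
    case False
    have "reg [:- x' / (x - x'), 1 / (x - x'):] 0 \<in> point_ideal T'" unfolding T by simp
    moreover have "1 - reg [:- x' / (x - x'), 1 / (x - x'):] 0 \<in> point_ideal T"
    proof -
      have "- x' / (x - x') + x / (x - x') = (x - x') / (x - x')"
        unfolding add_divide_distrib[symmetric] by simp
      also have "\<dots> = 1" using False by simp
      finally have "- x' / (x - x') + x / (x - x') = 1" .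
      moreover have "1 - reg [:- x' / (x - x'), 1 / (x - x'):] 0 = reg (1 - [:- x' / (x - x'), 1 / (x - x'):]) 0"
        by (simp add: reg_def)
      ultimately show ?thesis unfolding T by simp
    qed
    ultimately show thesis by (rule that)
  next
    case True
    hence ne: "y \<noteq> y'" using assms T by auto
    have "reg [:- y' / (y - y'):] [:1 / (y - y'):] \<in> point_ideal T'" unfolding T by simp
    moreover have "1 - reg [:- y' / (y - y'):] [:1 / (y - y'):] \<in> point_ideal T"
    proof -
      have "- y' / (y - y') + y / (y - y') = (y - y') / (y - y')"
        unfolding add_divide_distrib[symmetric] by simp
      also have "\<dots> = 1" using ne by simp
      finally have e1: "- y' / (y - y') + y / (y - y') = 1" .
      have e2: "1 - reg [:- y' / (y - y'):] [:1 / (y - y'):] = reg (1 - [:- y' / (y - y'):]) (- [:1 / (y - y'):])"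
        unfolding reg_def emb_diff emb_minus by simp
      show ?thesis unfolding T e2 reg_point_ideal_iff using e1 by (simp add: algebra_simps)
    qed
    ultimately show thesis by (rule that)
  qed
qed

lemma separate_points_ideal:
  assumes "T \<in> ec_points W" "T \<noteq> Infinity" "set Ts \<subseteq> ec_points W" "Infinity \<notin> set Ts" "T \<notin> set Ts"
  shows "\<exists>h\<in>points_ideal Ts. 1 - h \<in> point_ideal T"
  using assms(3-)
proof (induction Ts)
  case Nil
  have "0 \<in> point_ideal T" using is_idealD(2)[OF is_ideal_point_ideal[OF assms(1)]] .
  thus ?case by (intro bexI[of _ 1]) auto
next
  case (Cons T' Ts)
  then obtain h where h: "h \<in> points_ideal Ts" "1 - h \<in> point_ideal T" by auto
  obtain e where e: "e \<in> point_ideal T'" "1 - e \<in> point_ideal T"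
    using separate_points[of T T'] Cons.prems assms(1,2) by auto
  have I: "is_ideal (point_ideal T)" using is_ideal_point_ideal[OF assms(1)] .
  have "is_ideal (point_ideal T')" using is_ideal_point_ideal Cons.prems by auto
  hence eR: "e \<in> coord_ring" using e is_idealD(1) by blast
  have "(1 - e) + e * (1 - h) \<in> point_ideal T"
    by (rule is_idealD(3)[OF I e(2) is_idealD(4)[OF I eR h(2)]])
  hence "1 - e * h \<in> point_ideal T" by (simp add: algebra_simps)
  moreover have "e * h \<in> points_ideal (T' # Ts)" using e h by (simp add: ideal_mult_mult)
  ultimately show ?case by blast
qed

text \<open>Chinese remainder theorem: the ideals of distinct points are comaximal, and
  \<open>g = (1 - h) g + g h\<close> puts an element of the intersection into the product.\<close>

lemma points_ideal_distinct:
  assumes "distinct Ts" "set Ts \<subseteq> ec_points W" "Infinity \<notin> set Ts" "g \<in> coord_ring" "\<And>T. T \<in> set Ts \<Longrightarrow> g \<in> point_ideal T"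
  shows "g \<in> points_ideal Ts"
  using assms
proof (induction Ts)
  case (Cons T Ts)
  hence g: "g \<in> points_ideal Ts" "g \<in> point_ideal T" by auto
  obtain h where h: "h \<in> points_ideal Ts" "1 - h \<in> point_ideal T" using separate_points_ideal[of T Ts] Cons.prems by auto
  have "(1 - h) * g + g * h \<in> ideal_mult (point_ideal T) (points_ideal Ts)" using g h by (intro ideal_mult_add ideal_mult_mult)
  thus ?case by (simp add: algebra_simps)
qed simp

lemma zeros_bound:
  assumes "distinct Ts" "set Ts \<subseteq> ec_points W" "Infinity \<notin> set Ts" "A \<noteq> 0 \<or> B \<noteq> 0"
    "\<And>x y. Affine x y \<in> set Ts \<Longrightarrow> poly A x + poly B x * y = 0"
  shows "length Ts \<le> degree (rnorm A B)"
    and "length Ts = degree (rnorm A B) \<Longrightarrow> point_sum Ts = Infinity"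
proof -
  have "reg A B \<in> point_ideal T" if "T \<in> set Ts" for T
  proof (cases T)
    case Infinity
    thus ?thesis using that assms(3) by blast
  next
    case (Affine x y)
    thus ?thesis using that assms(5) by simp
  qed
  hence *: "reg A B \<in> points_ideal Ts" by (intro points_ideal_distinct assms) auto
  have "map pt_degree Ts = map (\<lambda>_. 1) Ts"
    using assms(3) by (intro map_cong refl) (auto simp: pt_degree_def)
  hence n: "(\<Sum>T\<leftarrow>Ts. pt_degree T) = length Ts" by (simp only: sum_list_triv) simp
  have nz: "reg A B \<noteq> 0" using assms(4) by simp
  show "length Ts \<le> degree (rnorm A B)" using points_ideal_pole_order(1)[OF assms(2) * nz] unfolding n pole_order_reg .
  show "length Ts = degree (rnorm A B) \<Longrightarrow> point_sum Ts = Infinity"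
    using points_ideal_pole_order(2)[OF assms(2) * nz] unfolding n pole_order_reg .
qed

text \<open>Over a root \<open>x\<close> of the norm lie the ordinates \<open>y\<close> and
  \<open>- y - ycoeff\<close>, and the product of the two values of the function is the value of the
  norm.\<close>

lemma ex_zero:
  assumes "degree (rnorm A B) > 0"
  shows "\<exists>x y. on_curve W x y \<and> poly A x + poly B x * y = 0"
proof -
  obtain x where x: "poly (rnorm A B) x = 0" using alg_closed_imp_poly_has_root[OF assms] by blast
  have "\<exists>y. poly [:- poly cubic x, poly ycoeff x, 1:] y = 0"
    by (rule alg_closed_imp_poly_has_root) simp
  then obtain y where "poly [:- poly cubic x, poly ycoeff x, 1:] y = 0" ..
  hence y: "y\<^sup>2 + poly ycoeff x * y = poly cubic x"
    by (simp add: algebra_simps power2_eq_square add_eq_0_iff)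
  let ?y = "- y - poly ycoeff x"
  have y': "?y\<^sup>2 + poly ycoeff x * ?y = poly cubic x" unfolding y[symmetric] by Groebner_Basis.algebra
  have "(poly A x + poly B x * y) * (poly A x + poly B x * ?y) = poly (rnorm A B) x"
    unfolding rnorm_def poly_diff poly_mult poly_power y[symmetric] by Groebner_Basis.algebra
  hence "poly A x + poly B x * y = 0 \<or> poly A x + poly B x * ?y = 0" unfolding x by simp
  thus ?thesis using y y' on_curve_poly by blast
qed

end

section \<open>Eigenfunctions of the translation by a torsion point\<close>

sublocale ell_curve \<subseteq> G: comm_group "ec_group W"
  by (rule comm_group_ec)

lemma prod_linear_degree:
  fixes c :: "nat \<Rightarrow> 'b::field"
  assumes "finite S"
  shows "degree (\<Prod>j\<in>S. [:- c j, 1:]) = card S" "lead_coeff (\<Prod>j\<in>S. [:- c j, 1:]) = 1"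
proof -
  show "lead_coeff (\<Prod>j\<in>S. [:- c j, 1:]) = 1" by (simp add: lead_coeff_prod)
  show "degree (\<Prod>j\<in>S. [:- c j, 1:]) = card S"
    by (subst degree_prod_eq_sum_degree) auto
qed

lemma root_of_unity_sum:
  fixes w :: "'b::field"
  assumes "w ^ p = 1" "w \<noteq> 1" "p > 0"
  shows "(\<Sum>i=1..<p. w ^ i) = -1"
proof -
  have "(1 - w) * (\<Sum>i<p. w ^ i) = 0" using one_diff_power_eq[of w p] assms by simp
  hence "(\<Sum>i<p. w ^ i) = 0" using assms by simp
  moreover have "(\<Sum>i<p. w ^ i) = 1 + (\<Sum>i=1..<p. w ^ i)"
    using assms(3) by (simp add: lessThan_atLeast0 sum.atLeast_Suc_lessThan)
  ultimately show ?thesis by (simp add: add_eq_0_iff)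
qed

lemma (in ell_curve) degree_rnorm_le: "degree (rnorm A B) \<le> max (2 * degree A) (2 * degree B + 3)"
proof (cases "A = 0 \<and> B = 0")
  case False
  then consider "A \<noteq> 0" "B = 0 \<or> degree B + 2 \<le> degree A" | "B \<noteq> 0" "degree A \<le> degree B + 1"
    by fastforce
  thus ?thesis
  proof cases
    case 1 thus ?thesis using rnorm_big_A(1)[OF 1] by simp
  next
    case 2 thus ?thesis using rnorm_big_B(1)[OF 2] by simp
  qed
qed (simp add: rnorm_def)

context ell_curve begin

lemma G_simps [simp]: "carrier (ec_group W) = ec_points W" "monoid.mult (ec_group W) = ec_add W"
  "\<one>\<^bsub>ec_group W\<^esub> = Infinity"
  by (simp_all add: ec_group_def)

abbreviation mul :: "'a point \<Rightarrow> nat \<Rightarrow> 'a point" where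
  "mul T n \<equiv> T [^]\<^bsub>ec_group W\<^esub> n"

lemma mul_closed: "T \<in> ec_points W \<Longrightarrow> mul T n \<in> ec_points W"
  using G.nat_pow_closed[of T n] by simp

lemma mul_add: "T \<in> ec_points W \<Longrightarrow> ec_add W (mul T m) (mul T n) = mul T (m + n)"
  using G.nat_pow_mult[of T m n] by simp

lemma mul_simps [simp]: "mul T 0 = Infinity" "T \<in> ec_points W \<Longrightarrow> mul T 1 = T" "mul T (Suc n) = ec_add W (mul T n) T"
  using G.nat_pow_0[of T] G.nat_pow_Suc[of T n] G.nat_pow_eone[of T] by simp_all

lemma ec_add_Infinity [simp]: "ec_add W T Infinity = T"
  by (cases T) auto

lemma ec_add_left_commute:
  "A \<in> ec_points W \<Longrightarrow> B \<in> ec_points W \<Longrightarrow> C \<in> ec_points W \<Longrightarrow>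
    ec_add W A (ec_add W B C) = ec_add W B (ec_add W A C)"
  using G.m_lcomm[of A B C] by simp

lemma mul_distrib: "S \<in> ec_points W \<Longrightarrow> T \<in> ec_points W \<Longrightarrow> mul (ec_add W S T) n = ec_add W (mul S n) (mul T n)"
  using G.nat_pow_distrib[of S T n] by simp

lemma mul_mul: "T \<in> ec_points W \<Longrightarrow> mul (mul T m) n = mul T (m * n)"
  using G.nat_pow_pow[of T m n] by simp

lemma ec_add_cancel: "A \<in> ec_points W \<Longrightarrow> B \<in> ec_points W \<Longrightarrow> C \<in> ec_points W \<Longrightarrow>
    ec_add W A B = ec_add W A C \<longleftrightarrow> B = C"
  using G.l_cancel[of A B C] by auto

lemma ec_add_neg: "T \<in> ec_points W \<Longrightarrow> ec_add W T (ec_neg W T) = Infinity"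
  using ec_add_eq_Infinity_iff[of T "ec_neg W T"] neg_points[of T] by simp

end

section \<open>Multiples of a point of odd prime order and the resolvent of slopes\<close>

locale ec_torsion_point = ell_curve +
  fixes p :: nat and P :: "'a point"
  assumes p: "prime p" "odd p" and P: "P \<in> ec_points W" "mul P p = Infinity" "P \<noteq> Infinity"
begin

lemma p_ge: "p \<ge> 3"
  using p prime_ge_2_nat[of p] by (cases "p = 2") auto

lemma mul_eq_Infinity_iff:
  assumes "T \<in> ec_points W" "mul T p = Infinity" "T \<noteq> Infinity"
  shows "mul T n = Infinity \<longleftrightarrow> p dvd n"
proof -
  have *: "mul T k = Infinity \<longleftrightarrow> G.ord T dvd k" for k
    using G.pow_eq_id[of T k] assms by simp
  have "G.ord T dvd p" using * assms by simp
  moreover have "G.ord T \<noteq> 1" using G.ord_eq_1[of T] assms by simp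
  ultimately have "G.ord T = p" using p(1) by (metis prime_nat_iff)
  thus ?thesis using * by simp
qed

lemmas mP_Infinity = mul_eq_Infinity_iff[OF P]
lemmas mP_closed = mul_closed[OF P(1)]
lemmas mP_add = mul_add[OF P(1)]

lemma mul_mod:
  assumes "T \<in> ec_points W" "mul T p = Infinity"
  shows "mul T (n mod p) = mul T n"
proof -
  have "mul T n = ec_add W (mul T (n mod p)) (mul (mul T p) (n div p))"
    unfolding mul_mul[OF assms(1)] mul_add[OF assms(1)] by simp
  thus ?thesis using G.nat_pow_one[of "n div p"] assms by simp
qed

lemma mP_inj: assumes "mul P i = mul P j" "i < p" "j < p" shows "i = j"
proof -
  have *: "i = j" if "mul P i = mul P j" "i < p" "j < p" "i \<le> j" for i j
  proof -
    have "mul P (j - i) = Infinity" using G.pow_eq_div2[of P j i] that P by simp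
    hence "p dvd j - i" using mP_Infinity by simp
    thus ?thesis using that by (auto dest: dvd_imp_le)
  qed
  show ?thesis using *[of i j] *[of j i] assms nat_le_linear[of i j] by metis
qed

lemma mP_neg: "i \<le> p \<Longrightarrow> ec_neg W (mul P i) = mul P (p - i)"
proof -
  assume "i \<le> p"
  hence "ec_add W (mul P (p - i)) (mul P i) = Infinity" unfolding mP_add using P by simp
  thus ?thesis using ec_add_eq_Infinity_iff mP_closed by simp
qed

definition cyc :: "'a point set" where "cyc = range (mul P)"

lemma mP_cyc [simp, intro]: "mul P i \<in> cyc" and Infinity_cyc [simp, intro]: "Infinity \<in> cyc"
  and P_cyc [simp, intro]: "P \<in> cyc"
  using mul_simps(1)[of P] mul_simps(2)[OF P(1)] unfolding cyc_def by (blast, metis rangeI, metis rangeI)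

lemma cyc_neg: assumes "T \<in> cyc" shows "ec_neg W T \<in> cyc"
proof -
  obtain i where "T = mul P i" using assms by (auto simp: cyc_def)
  hence "T = mul P (i mod p)" using mul_mod P by simp
  moreover have "i mod p \<le> p" using p_ge by simp
  ultimately show ?thesis using mP_neg by simp
qed

lemma cyc_add_iff:
  assumes "T \<in> ec_points W"
  shows "ec_add W T (mul P i) \<in> cyc \<longleftrightarrow> T \<in> cyc"
proof
  assume "T \<in> cyc"
  then obtain j where "T = mul P j" by (auto simp: cyc_def)
  thus "ec_add W T (mul P i) \<in> cyc" using mP_add by simp
next
  assume "ec_add W T (mul P i) \<in> cyc"
  then obtain j where j: "ec_add W T (mul P i) = mul P j" by (auto simp: cyc_def)
  have "ec_neg W (mul P i) \<in> cyc" by (rule cyc_neg) simp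
  then obtain k where k: "ec_neg W (mul P i) = mul P k" by (auto simp: cyc_def)
  have "T = ec_add W T (ec_add W (mul P i) (mul P k))"
    unfolding k[symmetric] using ec_add_neg mP_closed by simp
  also have "\<dots> = ec_add W (mul P j) (mul P k)" using ec_add_assoc[OF assms mP_closed[of i] mP_closed[of k]] j by simp
  finally show "T \<in> cyc" using mP_add by simp
qed

definition px :: "nat \<Rightarrow> 'a" where "px i = (case mul P i of Affine x y \<Rightarrow> x | Infinity \<Rightarrow> 0)"
definition py :: "nat \<Rightarrow> 'a" where "py i = (case mul P i of Affine x y \<Rightarrow> y | Infinity \<Rightarrow> 0)"

lemma mP_affine: assumes "i \<in> {1..<p}" shows "mul P i = Affine (px i) (py i)"
proof -
  have "\<not> p dvd i" using assms by (auto dest: dvd_imp_le)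
  hence "mul P i \<noteq> Infinity" using mP_Infinity by simp
  thus ?thesis by (cases "mul P i") (auto simp: px_def py_def)
qed

lemma mP_on_curve: "i \<in> {1..<p} \<Longrightarrow> on_curve W (px i) (py i)"
  using mP_closed[of i] mP_affine by simp

lemma same_x: assumes "Affine x y \<in> ec_points W" "i \<in> {1..<p}" "x = px i"
  shows "Affine x y = mul P i \<or> Affine x y = mul P (p - i)"
  using on_curve_same_x[OF mP_on_curve[OF assms(2)], of y] assms mP_affine[OF assms(2)] mP_neg[of i]
  by auto

lemma px_eq_iff: assumes "i \<in> {1..<p}" "j \<in> {1..<p}" shows "px i = px j \<longleftrightarrow> i = j \<or> i = p - j"
proof
  assume "px i = px j"
  hence "mul P i = mul P j \<or> mul P i = mul P (p - j)"
    using same_x[of "px i" "py i" j] mP_on_curve[OF assms(1)] mP_affine[OF assms(1)] assms by simp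
  thus "i = j \<or> i = p - j" using mP_inj[of i j] mP_inj[of i "p - j"] assms by auto
next
  assume "i = j \<or> i = p - j"
  moreover have "px (p - j) = px j"
  proof -
    have "p - j \<in> {1..<p}" using assms by auto
    thus ?thesis using mP_neg[of j] mP_affine[OF assms(2)] mP_affine[of "p - j"] assms by auto
  qed
  ultimately show "px i = px j" by auto
qed

lemma notCP_x: assumes "Affine x y \<in> ec_points W" "Affine x y \<notin> cyc" "i \<in> {1..<p}" shows "x \<noteq> px i"
  using same_x[OF assms(1,3)] assms(2) mP_cyc by metis

lemma slope_mP: assumes "Affine x y \<in> ec_points W" "Affine x y \<notin> cyc" "i \<in> {1..<p}"
  shows "slope W (Affine x y) (mul P i) = (y - py i) / (x - px i)"
proof -
  have "(py i - y) / (px i - x) = (y - py i) / (x - px i)" by (metis minus_diff_eq minus_divide_divide)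
  thus ?thesis using notCP_x[OF assms] by (simp add: slope_def mP_affine[OF assms(3)])
qed

text \<open>For \<open>i = p - 1\<close> the points \<open>P\<close> and \<open>mul P i\<close> are
  opposite and have no chord. The value \<open>- a1\<close> comes from the line through
  \<open>T + P\<close> and \<open>- P\<close>: it is the conjugate of the line through
  \<open>T\<close> and \<open>P\<close>, so its slope is \<open>- l - a1\<close>.\<close>

definition slope_const :: "nat \<Rightarrow> 'a" where
  "slope_const i = (if i = p - 1 then - a1 else slope W P (mul P i))"

text \<open>
  As a function of \<open>T\<close>, \<open>slope W T (i P)\<close> plays the role of \<open>zeta(T + i P) - zeta(T)\<close> for the Weierstrass zeta
  function, up to a constant. Hence this sum is a Lagrange resolvent: translation by \<open>P\<close> divides it by \<open>w\<close>.
\<close>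

definition eigenfun :: "'a \<Rightarrow> 'a point \<Rightarrow> 'a" where
  "eigenfun w T = (1 - w) * (\<Sum>i=1..<p. w ^ i * slope W T (mul P i)) + w * (\<Sum>i=1..<p. w ^ i * slope_const i)"

text \<open>\<open>slope_cocycle\<close> for \<open>T\<close>, \<open>P\<close> and
  \<open>i P\<close>. The last index is separate because \<open>P + i P = O\<close> there; it is
  computed directly from the conjugate line.\<close>

lemma slope_shift:
  assumes T: "T \<in> ec_points W" "T \<notin> cyc" and i: "i \<in> {1..<p}"
  shows "slope W (ec_add W T P) (mul P i) =
    (if i + 1 = p then 0 else slope W T (mul P (i + 1))) - slope W T P + slope_const i"
proof (cases "i + 1 = p")
  case False
  have "slope W T P + slope W (ec_add W T P) (mul P i) = slope W T (ec_add W P (mul P i)) + slope W P (mul P i)"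
  proof (rule slope_cocycle[OF T(1) P(1) mP_closed])
    show "T \<noteq> Infinity" using T(2) by auto
    show "ec_add W T P \<noteq> Infinity" using cyc_add_iff[OF T(1), of 1] T P by auto
    show "mul P i \<noteq> Infinity" using mP_affine[OF i] by simp
    have "ec_add W P (mul P i) = mul P (Suc i)"
      using ec_add_commute[OF P(1) mP_closed[of i]] by simp
    thus "ec_add W P (mul P i) \<noteq> Infinity" using mP_affine[of "Suc i"] i False by auto
    have "ec_add W (ec_add W T P) (mul P i) = ec_add W T (mul P (Suc i))"
      using ec_add_assoc[OF T(1) P(1) mP_closed[of i]] \<open>ec_add W P (mul P i) = mul P (Suc i)\<close> by simp
    thus "ec_add W (ec_add W T P) (mul P i) \<noteq> Infinity" using cyc_add_iff[OF T(1), of "Suc i"] T by auto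
  qed (rule P(3))
  moreover have "ec_add W P (mul P i) = mul P (i + 1)"
    using ec_add_commute[OF P(1) mP_closed[of i]] by simp
  moreover have "i \<noteq> p - 1" using False i by auto
  ultimately show ?thesis using False by (simp add: slope_const_def algebra_simps)
next
  case True
  obtain x y where Txy: "T = Affine x y" using T(2) by (cases T) auto
  have one: "1 \<in> {1..<p}" using p_ge by auto
  obtain x1 y1 where P1: "P = Affine x1 y1" using P(3) by (cases P) auto
  have x1: "px 1 = x1" unfolding px_def mul_simps(2)[OF P(1)] unfolding P1 by simp
  have i1: "i = p - 1" using True by simp
  have mi: "mul P i = ec_neg W P" using mP_neg[of 1] P p_ge i1 by simp
  have nT: "ec_add W T P \<notin> cyc" using cyc_add_iff[OF T(1), of 1] T P by simp
  then obtain x3 y3 where S: "ec_add W T P = Affine x3 y3" by (cases "ec_add W T P") auto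
  have c: "on_curve W x y" "on_curve W x1 y1" using T P(1) Txy P1 by auto
  define l where "l = slope W T P"
  have l: "slope W (Affine x y) (Affine x1 y1) = l" unfolding l_def Txy P1 ..
  have S1: "ec_add W (Affine x y) (Affine x1 y1) = Affine x3 y3" using S Txy P1 by simp
  note L = line_third_point[OF c not_opposite[OF S1], unfolded l]
  have y3: "y3 = - (l * x3 + (y - l * x)) - a1 * x3 - a3" using L(1) unfolding S1 by auto
  have S': "Affine x3 y3 \<in> ec_points W" using ec_add_closed[OF T(1) P(1)] unfolding S .
  have ne: "x3 \<noteq> x1" using notCP_x[OF S' _ one] nT S x1 by simp
  have mi': "mul P i = Affine x1 (- y1 - a1 * x1 - a3)" unfolding mi unfolding P1 by simp
  have "slope W (ec_add W T P) (mul P i) = (- y1 - a1 * x1 - a3 - y3) / (x1 - x3)"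
    unfolding S mi' using ne by (simp add: slope_def)
  also have "- y1 - a1 * x1 - a3 - y3 = (- l - a1) * (x1 - x3)"
    unfolding y3 using L(3) by (simp add: algebra_simps)
  also have "\<dots> / (x1 - x3) = - l - a1" using ne by simp
  finally show ?thesis using True i1 by (simp add: slope_const_def l_def)
qed

lemma eigenfun_shift:
  assumes w: "w ^ p = 1" "w \<noteq> 1" and T: "T \<in> ec_points W" "T \<notin> cyc"
  shows "w * eigenfun w (ec_add W T P) = eigenfun w T"
proof -
  \<comment> \<open>The value 0 at \<open>j = p\<close> stands for the absent slope to
    \<open>O\<close>. Shifting the index loses the term \<open>w * slope W T P\<close>, and this is
    restored by the sum of the powers of \<open>w\<close>, which is \<open>-1\<close>.\<close>
  define F where "F j = w ^ j * (if j = p then 0 else slope W T (mul P j))" for j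
  define c where "c = (\<Sum>i=1..<p. w ^ i * slope_const i)"
  define s where "s = (\<Sum>i=1..<p. w ^ i * slope W T (mul P i))"
  define s' where "s' = (\<Sum>i=1..<p. w ^ i * slope W (ec_add W T P) (mul P i))"
  have "w * s' = (\<Sum>i=1..<p. F (Suc i) - w * slope W T P * w ^ i + w * (w ^ i * slope_const i))"
    unfolding s'_def sum_distrib_left F_def
    by (intro sum.cong refl, subst slope_shift[OF T]) (auto simp: algebra_simps)
  also have "\<dots> = (\<Sum>i=1..<p. F (Suc i)) - w * slope W T P * (\<Sum>i=1..<p. w ^ i) + w * c"
    unfolding sum.distrib sum_subtractf sum_distrib_left c_def ..
  also have "(\<Sum>i=1..<p. w ^ i) = -1" using root_of_unity_sum[OF w] p_ge by simp
  also have "(\<Sum>i=1..<p. F (Suc i)) = s - w * slope W T P"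
  proof -
    have "(\<Sum>i=1..<p. F (Suc i)) = (\<Sum>i=Suc 1..<Suc p. F i)" by (simp only: sum.shift_bounds_Suc_ivl)
    moreover have "(\<Sum>i=1..<Suc p. F i) = F 1 + (\<Sum>i=Suc 1..<Suc p. F i)"
      using p_ge by (intro sum.atLeast_Suc_lessThan) simp
    moreover have "(\<Sum>i=1..<Suc p. F i) = (\<Sum>i=1..<p. F i) + F p"
      using p_ge by (intro sum.atLeastLessThan_Suc) simp
    moreover have "(\<Sum>i=1..<p. F i) = s" unfolding s_def F_def by (intro sum.cong) auto
    moreover have "F p = 0" "F 1 = w * slope W T P" using p_ge P by (auto simp: F_def)
    ultimately show ?thesis by (simp add: algebra_simps)
  qed
  finally have *: "w * s' = s + w * c" by simp
  \<comment> \<open>The relation \<open>*\<close> is affine in the resolvent \<open>s\<close>.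
    Adding \<open>w c / (1 - w)\<close> to \<open>s\<close> makes it homogeneous;
    \<open>eigenfun\<close> is this corrected resolvent multiplied by \<open>1 - w\<close>.\<close>
  have "w * eigenfun w (ec_add W T P) = (1 - w) * (w * s') + w * w * c"
    unfolding eigenfun_def s'_def[symmetric] c_def[symmetric] by (simp add: algebra_simps)
  also have "\<dots> = (1 - w) * s + w * c" unfolding * by (simp add: algebra_simps)
  finally show ?thesis unfolding eigenfun_def s_def[symmetric] c_def[symmetric] .
qed

lemma eigenfun_shift_mul:
  assumes w: "w ^ p = 1" "w \<noteq> 1" and T: "T \<in> ec_points W" "T \<notin> cyc"
  shows "w ^ k * eigenfun w (ec_add W T (mul P k)) = eigenfun w T"
proof (induction k)
  case (Suc k)
  have "ec_add W T (mul P (Suc k)) = ec_add W (ec_add W T (mul P k)) P"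
    using ec_add_assoc[OF T(1) mP_closed P(1)] by simp
  moreover have "w * eigenfun w (ec_add W (ec_add W T (mul P k)) P) = eigenfun w (ec_add W T (mul P k))"
    using T by (intro eigenfun_shift w ec_add_closed mP_closed) (simp_all add: cyc_add_iff)
  ultimately have "w ^ Suc k * eigenfun w (ec_add W T (mul P (Suc k))) = w ^ k * eigenfun w (ec_add W T (mul P k))"
    by (metis mult.assoc power_Suc2)
  thus ?case using Suc by simp
qed simp

lemma eigenfun_coset:
  assumes w: "w ^ p = 1" "w \<noteq> 1" and T: "T \<in> ec_points W" "T \<notin> cyc"
  shows "eigenfun w (ec_add W T (mul P k)) = 0 \<longleftrightarrow> eigenfun w T = 0"
proof -
  have "w \<noteq> 0" using w p_ge by (metis power_0_left zero_neq_one not_numeral_le_zero)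
  thus ?thesis using eigenfun_shift_mul[OF assms, of k] by (metis mult_eq_0_iff power_not_zero)
qed

end

section \<open>Poles and zeros of the eigenfunctions\<close>

context ec_torsion_point begin

text \<open>
  Multiplying by \<open>denom\<close> clears the simple poles of \<open>eigenfun w\<close> at the multiples of \<open>P\<close>; half of the multiples
  suffice because \<open>i P\<close> and \<open>(p - i) P\<close> have the same abscissa.
\<close>

definition half_p :: nat where "half_p = (p - 1) div 2"

lemma p_half_p: "p = 2 * half_p + 1" and half_p_ge: "half_p \<ge> 1"
  using p p_ge by (auto simp: half_p_def elim!: oddE)

definition rep :: "nat \<Rightarrow> nat" where "rep i = (if i \<le> half_p then i else p - i)"

lemma rep_range: "i \<in> {1..<p} \<Longrightarrow> rep i \<in> {1..half_p}"
  using p_half_p by (auto simp: rep_def)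

lemma rep_eq_iff: "i \<in> {1..<p} \<Longrightarrow> j \<in> {1..<p} \<Longrightarrow> rep i = rep j \<longleftrightarrow> i = j \<or> i = p - j"
  using p_half_p by (auto simp: rep_def)

lemma px_rep: assumes "i \<in> {1..<p}" shows "px (rep i) = px i"
proof -
  have "rep i \<in> {1..<p}" using rep_range[OF assms] p_half_p by auto
  thus ?thesis using px_eq_iff[of "rep i" i] assms by (auto simp: rep_def)
qed

lemma px_rep_eq: assumes "i \<in> {1..half_p}" "k \<in> {1..<p}" shows "px i = px k \<longleftrightarrow> i = rep k"
  using px_eq_iff[of i k] assms p_half_p by (auto simp: rep_def)

definition denom :: "'a poly" where "denom = (\<Prod>j\<in>{1..half_p}. [:- px j, 1:])"
definition denom_but :: "nat \<Rightarrow> 'a poly" where "denom_but i = (\<Prod>j\<in>{1..half_p} - {rep i}. [:- px j, 1:])"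

lemma denom_degree: "degree denom = half_p"
  unfolding denom_def by (subst prod_linear_degree(1)) auto

lemma denom_but_degree: assumes "i \<in> {1..<p}" shows "degree (denom_but i) = half_p - 1" "coeff (denom_but i) (half_p - 1) = 1"
proof -
  show "degree (denom_but i) = half_p - 1"
    unfolding denom_but_def using rep_range[OF assms] by (subst prod_linear_degree(1)) auto
  thus "coeff (denom_but i) (half_p - 1) = 1"
    using prod_linear_degree(2)[of "{1..half_p} - {rep i}" px] unfolding denom_but_def by simp
qed

lemma denom_but_denom: assumes "i \<in> {1..<p}" shows "(x - px i) * poly (denom_but i) x = poly denom x"
proof -
  have "denom = [:- px (rep i), 1:] * denom_but i"
    unfolding denom_def denom_but_def using rep_range[OF assms] by (subst prod.remove[of _ "rep i"]) auto
  hence "poly denom x = poly ([:- px (rep i), 1:] * denom_but i) x" by (rule arg_cong)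
  hence "poly denom x = (x - px (rep i)) * poly (denom_but i) x" unfolding poly_mult by simp
  thus ?thesis by (simp only: px_rep[OF assms])
qed

lemma denom_but_root: assumes "i \<in> {1..<p}" "k \<in> {1..<p}"
  shows "poly (denom_but i) (px k) = 0 \<longleftrightarrow> rep i \<noteq> rep k"
proof -
  have "poly (denom_but i) (px k) = 0 \<longleftrightarrow> (\<exists>j\<in>{1..half_p} - {rep i}. px k = px j)"
    unfolding denom_but_def by (auto simp: poly_prod)
  also have "\<dots> \<longleftrightarrow> (\<exists>j\<in>{1..half_p} - {rep i}. j = rep k)"
    using px_rep_eq[OF _ assms(2)] by (intro bex_cong refl) (metis DiffD1)
  also have "\<dots> \<longleftrightarrow> rep i \<noteq> rep k" using rep_range[OF assms(2)] by auto
  finally show ?thesis .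
qed

definition const_term :: "'a \<Rightarrow> 'a" where "const_term w = w * (\<Sum>i=1..<p. w ^ i * slope_const i)"

text \<open>\<open>num_A + num_B Y\<close> is the product of \<open>denom\<close> and
  \<open>eigenfun w\<close>: the slope to \<open>i P\<close> is
  \<open>(Y - py i) / (X - px i)\<close>, and \<open>denom_but i\<close> is \<open>denom\<close>
  without the factor of \<open>i P\<close>.\<close>

definition num_A :: "'a \<Rightarrow> 'a poly" where
  "num_A w = smult (const_term w) denom - smult (1 - w) (\<Sum>i=1..<p. smult (w ^ i * py i) (denom_but i))"
definition num_B :: "'a \<Rightarrow> 'a poly" where
  "num_B w = smult (1 - w) (\<Sum>i=1..<p. smult (w ^ i) (denom_but i))"

lemma eval_g: "poly (num_A w) x + poly (num_B w) x * y =
    const_term w * poly denom x + (1 - w) * (\<Sum>i=1..<p. w ^ i * ((y - py i) * poly (denom_but i) x))"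
proof -
  have *: "(\<Sum>i=1..<p. w ^ i * ((y - py i) * poly (denom_but i) x)) =
     y * (\<Sum>i=1..<p. w ^ i * poly (denom_but i) x) - (\<Sum>i=1..<p. w ^ i * py i * poly (denom_but i) x)"
    unfolding sum_distrib_left sum_subtractf[symmetric] by (intro sum.cong refl) (simp add: algebra_simps)
  show ?thesis unfolding num_A_def num_B_def * by (simp add: poly_sum algebra_simps)
qed

lemma eval_g_eigenfun:
  assumes "Affine x y \<in> ec_points W" "Affine x y \<notin> cyc"
  shows "poly (num_A w) x + poly (num_B w) x * y = poly denom x * eigenfun w (Affine x y)" "poly denom x \<noteq> 0"
proof -
  have *: "(\<Sum>i=1..<p. w ^ i * ((y - py i) * poly (denom_but i) x)) =
      poly denom x * (\<Sum>i=1..<p. w ^ i * slope W (Affine x y) (mul P i))"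
    unfolding sum_distrib_left
  proof (intro sum.cong refl)
    fix i assume i: "i \<in> {1..<p}"
    have nz: "x - px i \<noteq> 0" using notCP_x[OF assms i] by simp
    show "w ^ i * ((y - py i) * poly (denom_but i) x) = poly denom x * (w ^ i * slope W (Affine x y) (mul P i))"
      unfolding slope_mP[OF assms i] denom_but_denom[OF i, symmetric] using nz by simp
  qed
  show "poly (num_A w) x + poly (num_B w) x * y = poly denom x * eigenfun w (Affine x y)"
    unfolding eval_g eigenfun_def const_term_def * by (simp add: algebra_simps)
  have "x \<noteq> px j" if "j \<in> {1..half_p}" for j
    using notCP_x[OF assms, of j] that p_half_p by auto
  thus "poly denom x \<noteq> 0" unfolding denom_def by (auto simp: poly_prod)
qed

lemma degree_num_A: "degree (num_A w) \<le> half_p"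
  unfolding num_A_def
proof (intro degree_diff_le)
  show "degree (smult (const_term w) denom) \<le> half_p" using denom_degree degree_smult_le[of "const_term w" denom] by simp
  have "degree (\<Sum>i=1..<p. smult (w ^ i * py i) (denom_but i)) \<le> half_p"
  proof (intro degree_sum_le)
    fix i assume "i \<in> {1..<p}"
    thus "degree (smult (w ^ i * py i) (denom_but i)) \<le> half_p"
      using denom_but_degree(1)[of i] degree_smult_le[of "w ^ i * py i" "denom_but i"] by simp
  qed simp
  thus "degree (smult (1 - w) (\<Sum>i=1..<p. smult (w ^ i * py i) (denom_but i))) \<le> half_p"
    using degree_smult_le order_trans by blast
qed

lemma degree_num_B: "degree (num_B w) \<le> half_p - 1"
proof -
  have "degree (\<Sum>i=1..<p. smult (w ^ i) (denom_but i)) \<le> half_p - 1"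
  proof (intro degree_sum_le)
    fix i assume "i \<in> {1..<p}"
    thus "degree (smult (w ^ i) (denom_but i)) \<le> half_p - 1"
      using denom_but_degree(1)[of i] degree_smult_le[of "w ^ i" "denom_but i"] by simp
  qed simp
  thus ?thesis unfolding num_B_def using degree_smult_le order_trans by blast
qed

lemma coeff_num_B:
  assumes "w ^ p = 1" "w \<noteq> 1"
  shows "coeff (num_B w) (half_p - 1) = w - 1"
proof -
  have "coeff (num_B w) (half_p - 1) = (1 - w) * (\<Sum>i=1..<p. w ^ i * coeff (denom_but i) (half_p - 1))"
    unfolding num_B_def by (simp add: coeff_sum)
  also have "(\<Sum>i=1..<p. w ^ i * coeff (denom_but i) (half_p - 1)) = (\<Sum>i=1..<p. w ^ i)"
    using denom_but_degree(2) by (intro sum.cong) auto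
  also have "\<dots> = -1" using root_of_unity_sum[OF assms] p_ge by simp
  finally show ?thesis by simp
qed

text \<open>By \<open>coeff_num_B\<close> the degree of \<open>num_B\<close> is exactly
  \<open>half_p - 1\<close>, and the \<open>Y\<close> part decides the pole order:
  \<open>2 * (half_p - 1) + 3 = p\<close>. This is the size of one coset of
  \<open><P>\<close>.\<close>

lemma degree_rnorm_g:
  assumes "w ^ p = 1" "w \<noteq> 1"
  shows "degree (rnorm (num_A w) (num_B w)) = p" "num_B w \<noteq> 0"
proof -
  have c: "coeff (num_B w) (half_p - 1) \<noteq> 0" using coeff_num_B[OF assms] assms by simp
  thus nz: "num_B w \<noteq> 0" by auto
  have "degree (num_B w) = half_p - 1" using c degree_num_B le_degree by (metis le_antisym)
  thus "degree (rnorm (num_A w) (num_B w)) = p"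
    using rnorm_big_B(1)[OF nz, of "num_A w"] degree_num_A[of w] half_p_ge p_half_p by simp
qed

text \<open>At \<open>k P\<close> only the index \<open>p - k\<close> survives: for
  \<open>i = k\<close> the ordinates agree, and for the other indices \<open>denom_but i\<close>
  vanishes. The surviving difference of ordinates is nonzero because \<open>p\<close> is odd. So
  clearing denominators creates no zeros on \<open><P>\<close>.\<close>

lemma g_nonzero_cyc:
  assumes w: "w ^ p = 1" "w \<noteq> 1" and k: "k \<in> {1..<p}"
  shows "poly (num_A w) (px k) + poly (num_B w) (px k) * py k \<noteq> 0"
proof -
  have k': "p - k \<in> {1..<p}" using k by auto
  have "poly denom (px k) = 0" using denom_but_denom[OF k, of "px k"] by simp
  moreover have "(\<Sum>i=1..<p. w ^ i * ((py k - py i) * poly (denom_but i) (px k))) =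
      w ^ (p - k) * ((py k - py (p - k)) * poly (denom_but (p - k)) (px k))"
  proof -
    have "(\<Sum>i=1..<p. w ^ i * ((py k - py i) * poly (denom_but i) (px k))) =
        (\<Sum>i\<in>{p - k}. w ^ i * ((py k - py i) * poly (denom_but i) (px k)))"
    proof (rule sum.mono_neutral_right)
      show "\<forall>i\<in>{1..<p} - {p - k}. w ^ i * ((py k - py i) * poly (denom_but i) (px k)) = 0"
      proof
        fix i assume i: "i \<in> {1..<p} - {p - k}"
        show "w ^ i * ((py k - py i) * poly (denom_but i) (px k)) = 0"
        proof (cases "i = k")
          case False
          hence "rep i \<noteq> rep k" using rep_eq_iff[of i k] i k by auto
          thus ?thesis using denom_but_root[of i k] i k by simp
        qed simp
      qed
    qed (use k' in auto)
    thus ?thesis by simp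
  qed
  ultimately have e: "poly (num_A w) (px k) + poly (num_B w) (px k) * py k =
     (1 - w) * (w ^ (p - k) * ((py k - py (p - k)) * poly (denom_but (p - k)) (px k)))"
    unfolding eval_g by simp
  have "rep (p - k) = rep k" using rep_eq_iff[OF k' k] by simp
  hence "poly (denom_but (p - k)) (px k) \<noteq> 0" using denom_but_root[OF k' k] by simp
  moreover have "py k \<noteq> py (p - k)"
  proof
    assume "py k = py (p - k)"
    moreover have "px k = px (p - k)" using px_eq_iff[OF k k'] k by simp
    ultimately have "mul P k = mul P (p - k)" using mP_affine[OF k] mP_affine[OF k'] by simp
    hence "k = p - k" using mP_inj[of k "p - k"] k k' by auto
    thus False using p(2) k by (metis add_diff_inverse_nat atLeastLessThan_iff even_add less_not_sym)
  qed
  moreover have "w \<noteq> 0" using w p_ge by (metis power_0_left zero_neq_one not_numeral_le_zero)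
  ultimately show ?thesis unfolding e using w by simp
qed

lemma eigenfun_zeros_le:
  assumes w: "w ^ p = 1" "w \<noteq> 1"
    and Ts: "distinct Ts" "set Ts \<subseteq> ec_points W - cyc" "\<And>T. T \<in> set Ts \<Longrightarrow> eigenfun w T = 0"
  shows "length Ts \<le> p" "length Ts = p \<Longrightarrow> point_sum Ts = Infinity"
proof -
  have "poly (num_A w) x + poly (num_B w) x * y = 0" if "Affine x y \<in> set Ts" for x y
  proof -
    have "Affine x y \<in> ec_points W" "Affine x y \<notin> cyc" using that Ts(2) by auto
    thus ?thesis using eval_g_eigenfun(1) Ts(3)[OF that] by simp
  qed
  moreover have "Infinity \<notin> set Ts" "set Ts \<subseteq> ec_points W" using Ts(2) by auto
  ultimately show "length Ts \<le> p" "length Ts = p \<Longrightarrow> point_sum Ts = Infinity"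
    using zeros_bound[of Ts "num_A w" "num_B w"] Ts(1) degree_rnorm_g[OF w] by auto
qed

definition coset :: "'a point \<Rightarrow> 'a point list" where
  "coset T = map (\<lambda>i. ec_add W T (mul P i)) [0..<p]"

lemma coset_distinct: assumes "T \<in> ec_points W" shows "distinct (coset T)" "length (coset T) = p"
proof -
  show "distinct (coset T)" unfolding coset_def distinct_map
    using ec_add_cancel[OF assms mP_closed mP_closed] mP_inj by (auto intro!: inj_onI)
qed (simp add: coset_def)

lemma coset_iff: assumes "T \<in> ec_points W"
  shows "S \<in> set (coset T) \<longleftrightarrow> (\<exists>i. S = ec_add W T (mul P i))"
proof
  assume "\<exists>i. S = ec_add W T (mul P i)"
  then obtain i where "S = ec_add W T (mul P i)" ..
  hence "S = ec_add W T (mul P (i mod p))" using mul_mod P by simp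
  moreover have "i mod p < p" using p_ge by simp
  ultimately show "S \<in> set (coset T)" unfolding coset_def by auto
qed (auto simp: coset_def)

lemma coset_sub: assumes "T \<in> ec_points W" "T \<notin> cyc" shows "set (coset T) \<subseteq> ec_points W - cyc"
  using assms ec_add_closed mP_closed cyc_add_iff unfolding coset_def by auto

lemma eigenfun_coset_zero:
  assumes w: "w ^ p = 1" "w \<noteq> 1" and T: "T \<in> ec_points W" "T \<notin> cyc" "eigenfun w T = 0" and S: "S \<in> set (coset T)"
  shows "eigenfun w S = 0"
  using S eigenfun_coset[OF w T(1,2)] T(3) coset_iff[OF T(1)] by auto

text \<open>A zero outside the coset of \<open>T\<close> would bring the number of zeros to
  \<open>p + 1\<close>.\<close>

lemma eigenfun_zero_same_coset:
  assumes w: "w ^ p = 1" "w \<noteq> 1" and T: "T \<in> ec_points W" "T \<notin> cyc" "eigenfun w T = 0"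
    and S: "S \<in> ec_points W" "S \<notin> cyc" "eigenfun w S = 0"
  shows "\<exists>i. S = ec_add W T (mul P i)"
proof (rule ccontr)
  assume "\<not> ?thesis"
  hence "S \<notin> set (coset T)" using coset_iff[OF T(1)] by simp
  hence "length (S # coset T) \<le> p"
    using coset_distinct[OF T(1)] coset_sub[OF T(1,2)] S eigenfun_coset_zero[OF w T]
    by (intro eigenfun_zeros_le(1)[OF w]) auto
  thus False using coset_distinct[OF T(1)] by simp
qed

lemma point_sum_coset:
  assumes "T \<in> ec_points W"
  shows "point_sum (map (\<lambda>i. ec_add W T (mul P i)) xs) = ec_add W (mul T (length xs)) (mul P (sum_list xs))"
proof (induction xs)
  case (Cons i xs)
  have "point_sum (map (\<lambda>i. ec_add W T (mul P i)) (i # xs)) =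
     ec_add W (ec_add W T (mul P i)) (ec_add W (mul T (length xs)) (mul P (sum_list xs)))"
    using Cons by simp
  also have "\<dots> = ec_add W T (ec_add W (mul P i) (ec_add W (mul T (length xs)) (mul P (sum_list xs))))"
    using assms mP_closed mul_closed ec_add_closed by (intro ec_add_assoc) auto
  also have "\<dots> = ec_add W T (ec_add W (mul T (length xs)) (ec_add W (mul P i) (mul P (sum_list xs))))"
    using assms mP_closed mul_closed ec_add_closed by (subst ec_add_left_commute) auto
  also have "\<dots> = ec_add W (ec_add W T (mul T (length xs))) (mul P (i + sum_list xs))"
    unfolding mP_add using assms mP_closed mul_closed by (intro ec_add_assoc[symmetric]) auto
  also have "ec_add W T (mul T (length xs)) = mul T (length (i # xs))"
    using ec_add_commute[OF assms mul_closed[OF assms]] by simp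
  finally show ?case by simp
qed simp

text \<open>The coset of a zero \<open>T\<close> consists of \<open>p\<close> zeros, as many as the
  pole order permits, so by Abel's theorem its points sum to \<open>O\<close>.\<close>

lemma ex_torsion_zero:
  assumes w: "w ^ p = 1" "w \<noteq> 1"
  obtains T where "T \<in> ec_points W" "T \<notin> cyc" "eigenfun w T = 0" "mul T p = Infinity"
proof -
  have "degree (rnorm (num_A w) (num_B w)) > 0" using degree_rnorm_g[OF w] p_ge by simp
  then obtain x y where xy: "on_curve W x y" "poly (num_A w) x + poly (num_B w) x * y = 0"
    using ex_zero by blast
  let ?T = "Affine x y"
  have TP: "?T \<in> ec_points W" using xy by simp
  have TC: "?T \<notin> cyc"
  proof
    assume "?T \<in> cyc"
    then obtain i where "?T = mul P i" by (auto simp: cyc_def)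
    hence i: "?T = mul P (i mod p)" using mul_mod P by simp
    have "i mod p \<in> {1..<p}" using i p_ge by (cases "i mod p = 0") auto
    thus False using g_nonzero_cyc[OF w, of "i mod p"] mP_affine[of "i mod p"] i xy by auto
  qed
  have z: "eigenfun w ?T = 0" using eval_g_eigenfun(1)[OF TP TC, of w] eval_g_eigenfun(2)[OF TP TC] xy by simp
  have "point_sum (coset ?T) = Infinity"
    using coset_distinct[OF TP] coset_sub[OF TP TC] eigenfun_coset_zero[OF w TP TC z]
    by (intro eigenfun_zeros_le(2)[OF w]) auto
  hence "ec_add W (mul ?T p) (mul P (sum_list [0..<p])) = Infinity"
    unfolding coset_def point_sum_coset[OF TP] by simp
  \<comment> \<open>The coset sums to \<open>p T + (0 + ... + (p - 1)) P\<close>; as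
    \<open>p\<close> is odd, the coefficient of \<open>P\<close> is divisible by
    \<open>p\<close>.\<close>
  moreover have "p dvd sum_list [0..<p]"
  proof -
    have "sum_list [0..<p] = (\<Sum>i<p. i)" by (simp add: sum_list_distinct_conv_sum_set lessThan_atLeast0)
    also have "\<dots> = p * half_p"
    proof -
      have "(\<Sum>i<2 * h + 1. i) = (2 * h + 1) * h" for h :: nat by (induction h) auto
      thus ?thesis using p_half_p by metis
    qed
    finally show ?thesis by simp
  qed
  hence "mul P (sum_list [0..<p]) = Infinity" using mP_Infinity by simp
  ultimately have "mul ?T p = Infinity" by simp
  thus thesis using that TP TC z by blast
qed

text \<open>Two eigenfunctions with a common coset of zeros are proportional, and \<open>S\<close>,
  a point where they do not vanish, then shows that their eigenvalues under translation by
  \<open>P\<close> agree.\<close>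

lemma eigenfun_root_unique:
  assumes w: "w ^ p = 1" "w \<noteq> 1" and w': "w' ^ p = 1" "w' \<noteq> 1"
    and T: "T \<in> ec_points W" "T \<notin> cyc" "eigenfun w T = 0" "eigenfun w' T = 0"
    and S: "S \<in> ec_points W" "S \<notin> cyc" "\<And>i. S \<noteq> ec_add W T (mul P i)"
  shows "w = w'"
proof -
  \<comment> \<open>Both \<open>Y\<close> parts have leading coefficient root minus 1, so this
    combination cancels it. The pole order drops below \<open>p\<close>, while the coset of
    \<open>T\<close> still supplies \<open>p\<close> zeros.\<close>
  define A where "A = smult (1 - w') (num_A w) - smult (1 - w) (num_A w')"
  define B where "B = smult (1 - w') (num_B w) - smult (1 - w) (num_B w')"
  have ev: "poly A x + poly B x * y = poly denom x * ((1 - w') * eigenfun w (Affine x y) - (1 - w) * eigenfun w' (Affine x y))"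
    if "Affine x y \<in> ec_points W" "Affine x y \<notin> cyc" for x y
  proof -
    have "poly A x + poly B x * y = (1 - w') * (poly (num_A w) x + poly (num_B w) x * y) -
       (1 - w) * (poly (num_A w') x + poly (num_B w') x * y)"
      unfolding A_def B_def by (simp add: algebra_simps)
    thus ?thesis unfolding eval_g_eigenfun(1)[OF that] by (simp add: algebra_simps)
  qed
  have dA: "degree A \<le> half_p" unfolding A_def
    by (intro degree_diff_le order_trans[OF degree_smult_le] degree_num_A)
  have dB: "degree B \<le> half_p - 1" unfolding B_def
    by (intro degree_diff_le order_trans[OF degree_smult_le] degree_num_B)
  have cB: "coeff B (half_p - 1) = 0" unfolding B_def
    by (simp add: coeff_num_B[OF w, simplified] coeff_num_B[OF w', simplified] algebra_simps)
  have AB: "A = 0 \<and> B = 0"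
  proof (rule ccontr)
    assume nz: "\<not> (A = 0 \<and> B = 0)"
    have "p \<le> degree (rnorm A B)"
    proof -
      have "length (coset T) \<le> degree (rnorm A B)"
      proof (rule zeros_bound(1))
        fix x y assume "Affine x y \<in> set (coset T)"
        moreover from this have "Affine x y \<in> ec_points W" "Affine x y \<notin> cyc" using coset_sub[OF T(1,2)] by auto
        ultimately show "poly A x + poly B x * y = 0"
          using ev eigenfun_coset_zero[OF w T(1,2,3)] eigenfun_coset_zero[OF w' T(1,2,4)] by simp
      qed (use coset_sub[OF T(1,2)] coset_distinct[OF T(1)] nz in auto)
      thus ?thesis using coset_distinct[OF T(1)] by simp
    qed
    moreover have "degree (rnorm A B) \<le> 2 * half_p"
    proof (cases "B = 0")
      case True
      thus ?thesis using nz dA rnorm_big_A(1)[of A B] by simp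
    next
      case False
      have "degree B \<noteq> half_p - 1" using cB False by (metis leading_coeff_0_iff)
      hence "2 * degree B + 3 \<le> 2 * half_p" using dB by linarith
      thus ?thesis using degree_rnorm_le[of A B] dA by (simp add: max_def split: if_splits)
    qed
    ultimately show False using p_half_p by simp
  qed
  have rel: "(1 - w') * eigenfun w R = (1 - w) * eigenfun w' R" if R: "R \<in> ec_points W" "R \<notin> cyc" for R
  proof -
    obtain x y where xy: "R = Affine x y" using R by (cases R) auto
    show ?thesis using ev[of x y] eval_g_eigenfun(2)[of x y] R AB unfolding xy by simp
  qed
  have hS: "eigenfun w S \<noteq> 0" using eigenfun_zero_same_coset[OF w T(1,2,3) S(1,2)] S(3) by blast
  have SP: "ec_add W S P \<in> ec_points W" "ec_add W S P \<notin> cyc"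
    using ec_add_closed[OF S(1) P(1)] cyc_add_iff[OF S(1), of 1] S P by auto
  have "(1 - w') * eigenfun w S = w * ((1 - w') * eigenfun w (ec_add W S P))"
    using eigenfun_shift[OF w S(1,2)] by (simp add: mult_ac)
  also have "\<dots> = w * (1 - w) * eigenfun w' (ec_add W S P)" using rel[OF SP] by (simp add: mult_ac)
  finally have "w' * ((1 - w') * eigenfun w S) = w * (1 - w) * (w' * eigenfun w' (ec_add W S P))" by (simp add: mult_ac)
  also have "\<dots> = w * ((1 - w') * eigenfun w S)"
    using eigenfun_shift[OF w' S(1,2)] rel[OF S(1,2)] by (simp add: mult_ac)
  finally show ?thesis using hS w'(2) by simp
qed

end

section \<open>Matching roots of unity with cosets of \<open><P>\<close> in
  \<open>E[p]\<close>\<close>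

locale ec_torsion_basis = ec_torsion_point +
  fixes Q :: "'a point"
  assumes basis: "torsion_basis (ec_group W) p P Q"
begin

lemma Q: "Q \<in> ec_points W" "mul Q p = Infinity"
  using basis by (auto simp: torsion_basis_def torsion_def)

definition lincomb :: "nat \<Rightarrow> nat \<Rightarrow> 'a point" where "lincomb i j = ec_add W (mul P i) (mul Q j)"

lemma lincomb_closed: "lincomb i j \<in> ec_points W"
  unfolding lincomb_def by (intro ec_add_closed mul_closed P Q)

lemma lincomb_simps: "lincomb i 0 = mul P i" "lincomb 0 j = mul Q j" "lincomb 0 1 = Q" "lincomb 1 0 = P"
  using P Q by (simp_all add: lincomb_def)

lemma lincomb_span: "T \<in> ec_points W \<Longrightarrow> mul T p = Infinity \<Longrightarrow> \<exists>i j. T = lincomb i j"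
  using basis by (auto simp: torsion_basis_def torsion_def lincomb_def)

lemma lincomb_add: "ec_add W (lincomb a b) (lincomb c d) = lincomb (a + c) (b + d)"
proof -
  note cl = mul_closed[OF P(1)] mul_closed[OF Q(1)] ec_add_closed
  have "ec_add W (lincomb a b) (lincomb c d) = ec_add W (mul P a) (ec_add W (mul Q b) (ec_add W (mul P c) (mul Q d)))"
    unfolding lincomb_def by (intro ec_add_assoc cl)
  also have "ec_add W (mul Q b) (ec_add W (mul P c) (mul Q d)) = ec_add W (mul P c) (ec_add W (mul Q b) (mul Q d))"
    by (intro ec_add_left_commute cl)
  also have "ec_add W (mul P a) \<dots> = ec_add W (ec_add W (mul P a) (mul P c)) (ec_add W (mul Q b) (mul Q d))"
    by (intro ec_add_assoc[symmetric] cl)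
  finally show ?thesis unfolding mul_add[OF P(1)] mul_add[OF Q(1)] lincomb_def .
qed

lemma lincomb_mul: "mul (lincomb a b) n = lincomb (a * n) (b * n)"
  unfolding lincomb_def using mul_distrib[OF mul_closed[OF P(1)] mul_closed[OF Q(1)]] mul_mul P Q by simp

lemma lincomb_eq_Infinity: "lincomb i j = Infinity \<longleftrightarrow> p dvd i \<and> p dvd j"
proof
  assume "lincomb i j = Infinity"
  thus "p dvd i \<and> p dvd j" using basis by (auto simp: torsion_basis_def lincomb_def)
next
  assume "p dvd i \<and> p dvd j"
  thus "lincomb i j = Infinity"
    using mul_mod[OF P(1,2), of i] mul_mod[OF Q, of j] by (simp add: lincomb_def dvd_eq_mod_eq_0)
qed

lemma lincomb_eqD:
  assumes "lincomb a b = lincomb c d"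
  shows "[a = c] (mod p)" "[b = d] (mod p)"
proof -
  have pz: "0 < p" using p_ge by simp
  have n: "n + n * (p - 1) = n * p" for n using pz by (metis Suc_diff_1 mult_Suc_right)
  \<comment> \<open>Coefficients are natural numbers, so \<open>c\<close> is subtracted by adding
    \<open>c * (p - 1)\<close>.\<close>
  have "lincomb (a + c * (p - 1)) (b + d * (p - 1)) = lincomb (c * p) (d * p)"
    unfolding lincomb_add[symmetric] assms unfolding lincomb_add n ..
  also have "\<dots> = Infinity" using lincomb_eq_Infinity by simp
  finally have *: "[a + c * (p - 1) = 0] (mod p)" "[b + d * (p - 1) = 0] (mod p)"
    using lincomb_eq_Infinity by (simp_all add: cong_0_iff)
  have "[a + c * p = c] (mod p)" if "[a + c * (p - 1) = 0] (mod p)" for a c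
  proof -
    have "a + c * p = a + c * (p - 1) + c" using n[of c] by simp
    thus ?thesis using cong_add[OF that cong_refl[of c]] by (simp add: add.assoc)
  qed
  hence "[a = c] (mod p)" if "[a + c * (p - 1) = 0] (mod p)" for a c
    using that by (metis cong_def mod_mult_self1 mult.commute)
  thus "[a = c] (mod p)" "[b = d] (mod p)" using * by blast+
qed

lemma lincomb_cyc: "lincomb i j \<in> cyc \<longleftrightarrow> p dvd j"
proof
  assume "lincomb i j \<in> cyc"
  then obtain k where "lincomb i j = lincomb k 0" using lincomb_simps(1) by (auto simp: cyc_def)
  from lincomb_eqD(2)[OF this] show "p dvd j" by (simp add: cong_0_iff)
next
  assume "p dvd j"
  hence "mul Q j = Infinity" using mul_mod[OF Q, of j] by (simp add: dvd_eq_mod_eq_0)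
  thus "lincomb i j \<in> cyc" by (simp add: lincomb_def)
qed

lemma ex_multiple_zero:
  assumes w: "w ^ p = 1" "w \<noteq> 1"
  shows "\<exists>b\<in>{1..<p}. eigenfun w (mul Q b) = 0"
proof -
  obtain T where T: "T \<in> ec_points W" "T \<notin> cyc" "eigenfun w T = 0" "mul T p = Infinity"
    using ex_torsion_zero[OF w] .
  then obtain i j where ij: "T = lincomb i j" using lincomb_span by blast
  have j: "\<not> p dvd j" using T(2) lincomb_cyc ij by simp
  have Qj: "mul Q j \<notin> cyc" using lincomb_cyc[of 0 j] j lincomb_simps by simp
  have "T = ec_add W (mul Q j) (mul P i)"
    unfolding ij lincomb_def by (intro ec_add_commute mul_closed P Q)
  hence "eigenfun w (mul Q j) = 0" using eigenfun_coset[OF w mul_closed[OF Q(1)] Qj] T(3) by simp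
  hence "eigenfun w (mul Q (j mod p)) = 0" using mul_mod[OF Q] by simp
  moreover have "j mod p \<in> {1..<p}" using j p_ge by (auto simp: dvd_eq_mod_eq_0 Suc_le_eq)
  ultimately show ?thesis by blast
qed

lemma multiple_zero_unique:
  assumes w: "w ^ p = 1" "w \<noteq> 1" and w': "w' ^ p = 1" "w' \<noteq> 1"
    and b: "b \<in> {1..<p}" "eigenfun w (mul Q b) = 0" "eigenfun w' (mul Q b) = 0"
  shows "w = w'"
proof (rule eigenfun_root_unique[OF w w', of "mul Q b" "mul Q (2 * b)"])
  \<comment> \<open>The point off the coset of zeros is \<open>2 b Q\<close>: since \<open>p\<close>
    is odd, it lies neither in \<open><P>\<close> nor in \<open>b Q + <P>\<close>.\<close>
  have nb: "\<not> p dvd b" using b by (auto dest: dvd_imp_le)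
  have "\<not> p dvd 2" using p_ge by (auto dest: dvd_imp_le)
  hence n2b: "\<not> p dvd 2 * b" using nb p prime_dvd_mult_iff by blast
  show "mul Q b \<notin> cyc" "mul Q (2 * b) \<notin> cyc"
    using lincomb_cyc[of 0] nb n2b by (simp_all add: lincomb_simps)
  show "mul Q (2 * b) \<noteq> ec_add W (mul Q b) (mul P i)" for i
  proof
    assume "mul Q (2 * b) = ec_add W (mul Q b) (mul P i)"
    also have "\<dots> = lincomb i b" unfolding lincomb_def by (intro ec_add_commute mul_closed P Q)
    finally have "lincomb 0 (2 * b) = lincomb i b" by (simp add: lincomb_simps)
    from lincomb_eqD(2)[OF this] have "[b + b = 0 + b] (mod p)" by (simp add: mult_2)
    hence "[b = 0] (mod p)" using cong_add_rcancel_nat by blast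
    thus False using nb by (simp add: cong_0_iff)
  qed
qed (use b mul_closed[OF Q(1)] in auto)

text \<open>
  Each nontrivial \<open>p\<close>-th root of unity \<open>w\<close> has its own coset \<open>b Q + \<langle>P\<rangle>\<close> of zeros of \<open>eigenfun w\<close>; there are
  \<open>p - 1\<close> roots and \<open>p - 1\<close> cosets.
\<close>

lemma ex_root_at_Q:
  assumes z: "primitive_root_of_unity p z"
  obtains k where "k \<in> {1..<p}" "eigenfun (z ^ k) Q = 0"
proof -
  have zp: "z ^ p = 1" and zk: "\<And>k. k \<in> {1..<p} \<Longrightarrow> z ^ k \<noteq> 1"
    using z by (auto simp: primitive_root_of_unity_def)
  have roots: "(z ^ k) ^ p = 1" for k
    by (metis zp power_mult mult.commute power_one)
  define f where "f k = (SOME b. b \<in> {1..<p} \<and> eigenfun (z ^ k) (mul Q b) = 0)" for k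
  have f: "f k \<in> {1..<p} \<and> eigenfun (z ^ k) (mul Q (f k)) = 0" if "k \<in> {1..<p}" for k
    unfolding f_def by (rule someI_ex) (use ex_multiple_zero[OF roots zk[OF that]] in blast)
  have "inj_on f {1..<p}"
  proof (rule inj_onI)
    fix k l assume kl: "k \<in> {1..<p}" "l \<in> {1..<p}" "f k = f l"
    have e: "z ^ k = z ^ l"
      using multiple_zero_unique[OF roots zk[OF kl(1)] roots zk[OF kl(2)], of "f k"] f[OF kl(1)] f[OF kl(2)] kl(3) by auto
    have znz: "z \<noteq> 0" using zp p_ge by (metis power_0_left zero_neq_one not_numeral_le_zero)
    have *: "k = l" if "k \<le> l" "z ^ k = z ^ l" "l < p" for k l
    proof (rule ccontr)
      assume "k \<noteq> l"
      hence "l - k \<in> {1..<p}" using that by auto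
      moreover have "z ^ k * z ^ (l - k) = z ^ l" using that(1) by (simp flip: power_add)
      hence "z ^ k * z ^ (l - k) = z ^ k * 1" using that(2) by simp
      hence "z ^ (l - k) = 1" using znz by simp
      ultimately show False using zk by blast
    qed
    show "k = l" using *[of k l] *[of l k] e kl nat_le_linear[of k l] by auto
  qed
  \<comment> \<open>An injective self-map of a finite set is onto, and the value 1 belongs to the
    coset of \<open>Q\<close> itself.\<close>
  hence "f ` {1..<p} = {1..<p}" using f by (intro endo_inj_surj) auto
  moreover have "1 \<in> {1..<p}" using p_ge by simp
  ultimately obtain k where "k \<in> {1..<p}" "f k = 1" by (metis imageE)
  thus thesis using that f[of k] Q by auto
qed

lemma root_at_Q_unique:
  assumes "w ^ p = 1" "w \<noteq> 1" "w' ^ p = 1" "w' \<noteq> 1" "eigenfun w Q = 0" "eigenfun w' Q = 0"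
  shows "w = w'"
  using multiple_zero_unique[OF assms(1-4), of 1] assms(5,6) Q p_ge by simp

text \<open>The substitute for "fixing the Weil pairing means determinant 1": zeros outside
  \<open><P>\<close> lie in \<open>Q + <P>\<close>, so they have coefficient 1 at
  \<open>Q\<close>.\<close>

lemma zero_at_lincomb:
  assumes w: "w ^ p = 1" "w \<noteq> 1" and "eigenfun w Q = 0" "eigenfun w (lincomb i j) = 0" "\<not> p dvd j"
  shows "[j = 1] (mod p)"
proof -
  have "Q \<notin> cyc" using lincomb_cyc[of 0 1] p_ge lincomb_simps by simp
  then obtain k where "lincomb i j = ec_add W Q (mul P k)"
    using eigenfun_zero_same_coset[OF w Q(1) _ assms(3) lincomb_closed] assms lincomb_cyc by blast
  also have "\<dots> = lincomb k 1" unfolding lincomb_def using ec_add_commute[OF Q(1) mP_closed] Q by simp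
  finally show ?thesis by (rule lincomb_eqD)
qed

end

section \<open>Subfields and conjugate elements\<close>

definition is_subfield :: "'b::field set \<Rightarrow> bool" where
  "is_subfield F \<longleftrightarrow> 0 \<in> F \<and> 1 \<in> F \<and> (\<forall>x\<in>F. \<forall>y\<in>F. x + y \<in> F \<and> x - y \<in> F \<and> x * y \<in> F \<and> x / y \<in> F)"

lemma subfldD:
  assumes "is_subfield F"
  shows "0 \<in> F" "1 \<in> F" "x \<in> F \<Longrightarrow> y \<in> F \<Longrightarrow> x + y \<in> F" "x \<in> F \<Longrightarrow> y \<in> F \<Longrightarrow> x - y \<in> F"
    "x \<in> F \<Longrightarrow> y \<in> F \<Longrightarrow> x * y \<in> F" "x \<in> F \<Longrightarrow> y \<in> F \<Longrightarrow> x / y \<in> F"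
  using assms by (auto simp: is_subfield_def)

lemma is_subfield_minus: "is_subfield F \<Longrightarrow> x \<in> F \<Longrightarrow> - x \<in> F"
  using subfldD(4)[of F 0 x] subfldD(1)[of F] by simp

lemma is_subfield_power: "is_subfield F \<Longrightarrow> x \<in> F \<Longrightarrow> x ^ n \<in> F"
  by (induction n) (auto simp: subfldD)

lemma is_subfield_sum: "is_subfield F \<Longrightarrow> (\<And>i. i \<in> S \<Longrightarrow> f i \<in> F) \<Longrightarrow> (\<Sum>i\<in>S. f i) \<in> F"
  by (induction S rule: infinite_finite_induct) (auto simp: subfldD)

lemma is_subfield_of_nat: "is_subfield F \<Longrightarrow> of_nat n \<in> F"
  by (induction n) (auto simp: subfldD)

lemma is_subfield_numeral: "is_subfield F \<Longrightarrow> numeral n \<in> F"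
  using is_subfield_of_nat[of F "numeral n"] by simp

lemmas is_subfield_closed = subfldD is_subfield_minus is_subfield_power is_subfield_sum is_subfield_numeral

lemma is_subfield_adjoin: "is_subfield (adjoin S)"
proof -
  let ?R = "ring_of_type_algebra :: 'a alg_closure ring"
  interpret R: field ?R by (rule field_from_type_algebra)
  have s: "carrier ?R = UNIV" "monoid.mult ?R = (*)" "ring.add ?R = (+)" "\<zero>\<^bsub>?R\<^esub> = 0" "\<one>\<^bsub>?R\<^esub> = 1"
    by (simp_all add: ring_of_type_algebra_def)
  have neg: "\<ominus>\<^bsub>?R\<^esub> x = - x" for x
    by (rule R.minus_equality) (simp_all add: s)
  have inv: "inv\<^bsub>?R\<^esub> x = inverse x" if "x \<noteq> 0" for x
    using that by (intro R.inv_char) (simp_all add: s)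
  have one: "1 \<in> adjoin S" using generate_field.one[of ?R] unfolding adjoin_def s .
  have add: "x + y \<in> adjoin S" if "x \<in> adjoin S" "y \<in> adjoin S" for x y
    using generate_field.eng_add[of x ?R _ y] that unfolding adjoin_def s .
  have mul: "x * y \<in> adjoin S" if "x \<in> adjoin S" "y \<in> adjoin S" for x y
    using generate_field.eng_mult[of x ?R _ y] that unfolding adjoin_def s .
  have um: "- x \<in> adjoin S" if "x \<in> adjoin S" for x
    using generate_field.a_inv[of x ?R] that unfolding adjoin_def neg .
  have zero: "0 \<in> adjoin S" using add[OF one um[OF one]] by simp
  have iv: "inverse x \<in> adjoin S" if "x \<in> adjoin S" for x
  proof (cases "x = 0")
    case False
    thus ?thesis using generate_field.m_inv[of x ?R] that inv[OF False] unfolding adjoin_def s by metis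
  qed (simp add: zero)
  show ?thesis unfolding is_subfield_def
    using zero one add mul um iv by (auto simp: diff_conv_add_uminus divide_inverse simp del: add_uminus_conv_diff)
qed

lemma adjoin_incl: "S \<subseteq> adjoin S" "range to_ac \<subseteq> adjoin S"
  unfolding adjoin_def by (auto intro: generate_field.incl)

lemma adjoin_least:
  assumes F: "is_subfield F" "range to_ac \<subseteq> F" "S \<subseteq> F"
  shows "adjoin S \<subseteq> F"
proof
  let ?R = "ring_of_type_algebra :: 'a alg_closure ring"
  interpret R: field ?R by (rule field_from_type_algebra)
  have s: "carrier ?R = UNIV" "monoid.mult ?R = (*)" "ring.add ?R = (+)" "\<zero>\<^bsub>?R\<^esub> = 0" "\<one>\<^bsub>?R\<^esub> = 1"
    by (simp_all add: ring_of_type_algebra_def)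
  have neg: "\<ominus>\<^bsub>?R\<^esub> x = - x" for x
    by (rule R.minus_equality) (simp_all add: s)
  have inv: "inv\<^bsub>?R\<^esub> x = inverse x" if "x \<noteq> 0" for x
    using that by (intro R.inv_char) (simp_all add: s)
  fix x assume "x \<in> adjoin S"
  thus "x \<in> F" unfolding adjoin_def
  proof (induction rule: generate_field.induct)
    case (m_inv h)
    thus ?case using inv[of h] subfldD(6)[OF F(1) subfldD(2)[OF F(1)], of h] by (simp add: s divide_inverse)
  qed (use F in \<open>auto simp: s neg is_subfield_closed\<close>)
qed

lemma adjoin_mono_closed:
  assumes "S \<subseteq> adjoin T" shows "adjoin S \<subseteq> adjoin T"
  by (rule adjoin_least[OF is_subfield_adjoin adjoin_incl(2) assms])

definition coeffs_in :: "'b::field set \<Rightarrow> 'b poly \<Rightarrow> bool" where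
  "coeffs_in F f \<longleftrightarrow> (\<forall>i. coeff f i \<in> F)"

lemma coeffs_in_simps:
  assumes "is_subfield F"
  shows "coeffs_in F 0" "coeffs_in F 1" "coeffs_in F f \<Longrightarrow> coeffs_in F g \<Longrightarrow> coeffs_in F (f + g)" "coeffs_in F f \<Longrightarrow> coeffs_in F g \<Longrightarrow> coeffs_in F (f - g)"
    "coeffs_in F f \<Longrightarrow> coeffs_in F g \<Longrightarrow> coeffs_in F (f * g)" "c \<in> F \<Longrightarrow> coeffs_in F f \<Longrightarrow> coeffs_in F (pCons c f)"
    "c \<in> F \<Longrightarrow> coeffs_in F f \<Longrightarrow> coeffs_in F (smult c f)" "c \<in> F \<Longrightarrow> coeffs_in F (monom c n)"
  using assms
  by (auto simp: coeffs_in_def coeff_mult coeff_1 coeff_pCons is_subfield_closed split: nat.splits)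

text \<open>\<open>F\<close> is a set and not a type, so long division is carried out with the
  coefficients tracked.\<close>

lemma coeffs_in_division:
  fixes m :: "'b::field poly"
  assumes F: "is_subfield F" and m: "coeffs_in F m" "m \<noteq> 0" and f: "coeffs_in F f"
  shows "\<exists>q r. coeffs_in F q \<and> coeffs_in F r \<and> f = q * m + r \<and> (r = 0 \<or> degree r < degree m)"
  using f
proof (induction "degree f" arbitrary: f rule: less_induct)
  case less
  show ?case
  proof (cases "f = 0 \<or> degree f < degree m")
    case True
    thus ?thesis using less.prems by (intro exI[of _ 0] exI[of _ f]) (auto simp: coeffs_in_simps[OF F])
  next
    case False
    define c where "c = lead_coeff f / lead_coeff m"
    define g where "g = f - monom c (degree f - degree m) * m"
    have c: "c \<in> F" using less.prems m by (auto simp: c_def coeffs_in_def is_subfield_closed[OF F])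
    have cg: "coeffs_in F g" unfolding g_def using c m less.prems by (intro coeffs_in_simps[OF F])
    have cnz: "c \<noteq> 0" using False m by (auto simp: c_def)
    have dm: "degree (monom c (degree f - degree m) * m) = degree f"
      using False m cnz by (simp add: degree_mult_eq degree_monom_eq monom_eq_0_iff)
    have "coeff g (degree f) = 0"
    proof -
      have "lead_coeff (monom c (degree f - degree m) * m) = lead_coeff f"
        unfolding lead_coeff_mult using m cnz by (simp add: degree_monom_eq c_def)
      thus ?thesis unfolding g_def dm coeff_diff by simp
    qed
    moreover have "degree g \<le> degree f" unfolding g_def by (intro degree_diff_le) (simp_all add: dm)
    ultimately have "g = 0 \<or> degree g < degree f"
      by (metis le_neq_implies_less leading_coeff_0_iff)
    moreover have "\<exists>q r. coeffs_in F q \<and> coeffs_in F r \<and> g = q * m + r \<and> (r = 0 \<or> degree r < degree m)" if "g = 0"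
      using that by (intro exI[of _ 0]) (auto simp: coeffs_in_simps[OF F])
    ultimately obtain q r where "coeffs_in F q" "coeffs_in F r" "g = q * m + r" "r = 0 \<or> degree r < degree m"
      using less.hyps[OF _ cg] by blast
    hence "coeffs_in F (q + monom c (degree f - degree m))" "f = (q + monom c (degree f - degree m)) * m + r"
      using c by (auto simp: g_def algebra_simps coeffs_in_simps[OF F])
    thus ?thesis using \<open>coeffs_in F r\<close> \<open>r = 0 \<or> degree r < degree m\<close> by blast
  qed
qed

definition minpol :: "'b::field set \<Rightarrow> 'b \<Rightarrow> 'b poly \<Rightarrow> bool" where
  "minpol F a m \<longleftrightarrow> coeffs_in F m \<and> m \<noteq> 0 \<and> poly m a = 0 \<and>
     (\<forall>f. coeffs_in F f \<and> f \<noteq> 0 \<and> poly f a = 0 \<longrightarrow> degree m \<le> degree f)"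

lemma ex_minpol:
  assumes "coeffs_in F f" "f \<noteq> 0" "poly f a = 0"
  shows "\<exists>m. minpol F a m"
proof -
  let ?P = "\<lambda>f. coeffs_in F f \<and> f \<noteq> 0 \<and> poly f a = 0"
  have "?P f" using assms by simp
  hence "?P (arg_min degree ?P) \<and> (\<forall>y. ?P y \<longrightarrow> degree (arg_min degree ?P) \<le> degree y)"
    by (rule arg_min_nat_lemma)
  thus ?thesis unfolding minpol_def by blast
qed

lemma minpol_dvd:
  assumes F: "is_subfield F" and m: "minpol F a m" and f: "coeffs_in F f" "poly f a = 0"
  obtains q where "coeffs_in F q" "f = q * m"
proof -
  obtain q r where qr: "coeffs_in F q" "coeffs_in F r" "f = q * m + r" "r = 0 \<or> degree r < degree m"
    using coeffs_in_division[OF F _ _ f(1), of m] m by (auto simp: minpol_def)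
  have "poly r a = 0" using qr(3) f(2) m by (simp add: minpol_def)
  hence "r = 0" using qr m by (auto simp: minpol_def)
  thus thesis using that qr by simp
qed

lemma minpol_degree: "minpol F a m \<Longrightarrow> degree m \<ge> 1"
  by (rule ccontr) (auto simp: minpol_def not_le elim!: degree_eq_zeroE)

lemma minpol_degree_1:
  assumes F: "is_subfield F" and m: "minpol F a m" "degree m = 1"
  shows "a \<in> F"
proof -
  have e: "coeff m 0 + a * coeff m 1 = 0"
    using m by (simp add: minpol_def poly_altdef algebra_simps)
  have "coeff m 1 \<noteq> 0" using m by (metis leading_coeff_0_iff minpol_def)
  hence "a = - coeff m 0 / coeff m 1" using e by (simp add: field_simps add_eq_0_iff)
  thus ?thesis using m by (auto simp: minpol_def coeffs_in_def is_subfield_closed[OF F])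
qed

text \<open>For the backward direction the minimal polynomial \<open>n\<close> of \<open>b\<close>
  divides \<open>m\<close>, say \<open>m = q * n\<close>. The cofactor \<open>q\<close> is too small
  in degree to vanish at \<open>a\<close>, so \<open>n\<close> does.\<close>

lemma minpol_conj:
  assumes F: "is_subfield F" and m: "minpol F a m" and b: "poly m b = 0" and r: "coeffs_in F r"
  shows "poly r a = 0 \<longleftrightarrow> poly r b = 0"
proof
  assume "poly r a = 0"
  then obtain q where "r = q * m" using minpol_dvd[OF F m r] by blast
  thus "poly r b = 0" using b by simp
next
  assume rb: "poly r b = 0"
  obtain n where n: "minpol F b n" using ex_minpol[of F m b] m b by (auto simp: minpol_def)
  obtain q where q: "coeffs_in F q" "m = q * n" using minpol_dvd[OF F n _ b] m by (auto simp: minpol_def)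
  obtain q' where q': "r = q' * n" using minpol_dvd[OF F n r rb] by blast
  have "m \<noteq> 0" "poly m a = 0" using m by (auto simp: minpol_def)
  hence nz: "q \<noteq> 0" "n \<noteq> 0" using q by auto
  have "poly q a \<noteq> 0"
  proof
    assume "poly q a = 0"
    hence "degree m \<le> degree q" using m q nz by (auto simp: minpol_def)
    moreover have "degree m = degree q + degree n" using q nz by (simp add: degree_mult_eq)
    ultimately show False using minpol_degree[OF n] by simp
  qed
  hence "poly n a = 0" using \<open>poly m a = 0\<close> q by simp
  thus "poly r a = 0" using q' by simp
qed

text \<open>A total function of which only the values on \<open>K\<close> matter. The condition at 1
  excludes the zero map.\<close>

definition hom_on :: "'b::field set \<Rightarrow> ('b \<Rightarrow> 'b) \<Rightarrow> bool" where
  "hom_on K s \<longleftrightarrow> s 1 = 1 \<and> (\<forall>x\<in>K. \<forall>y\<in>K. s (x + y) = s x + s y \<and> s (x * y) = s x * s y)"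

lemma fhomD:
  assumes K: "is_subfield K" and s: "hom_on K s"
  shows "s 0 = 0" "s 1 = 1" "x \<in> K \<Longrightarrow> y \<in> K \<Longrightarrow> s (x + y) = s x + s y"
    "x \<in> K \<Longrightarrow> y \<in> K \<Longrightarrow> s (x * y) = s x * s y" "x \<in> K \<Longrightarrow> y \<in> K \<Longrightarrow> s (x - y) = s x - s y"
    "x \<in> K \<Longrightarrow> y \<in> K \<Longrightarrow> s (x / y) = s x / s y" "x \<in> K \<Longrightarrow> s x = 0 \<longleftrightarrow> x = 0"
    "x \<in> K \<Longrightarrow> y \<in> K \<Longrightarrow> s x = s y \<longleftrightarrow> x = y"
proof -
  note k = subfldD[OF K]
  show a: "s (x + y) = s x + s y" if "x \<in> K" "y \<in> K" for x y using s that by (auto simp: hom_on_def)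
  show m: "s (x * y) = s x * s y" if "x \<in> K" "y \<in> K" for x y using s that by (auto simp: hom_on_def)
  show o: "s 1 = 1" using s by (auto simp: hom_on_def)
  have "s 0 + s 0 = s 0 + 0" using a[OF k(1,1)] by simp
  thus z: "s 0 = 0" by (rule add_left_imp_eq)
  show d: "s (x - y) = s x - s y" if "x \<in> K" "y \<in> K" for x y
    using a[OF k(4)[OF that] that(2)] by simp
  show nz: "s x = 0 \<longleftrightarrow> x = 0" if "x \<in> K" for x
  proof
    assume e: "s x = 0"
    show "x = 0"
    proof (rule ccontr)
      assume "x \<noteq> 0"
      hence "1 = s (x * (1 / x))" using o by simp
      also have "\<dots> = 0" using m[OF that k(6)[OF k(2) that]] e by simp
      finally show False by simp
    qed
  qed (simp add: z)
  show "s x = s y \<longleftrightarrow> x = y" if "x \<in> K" "y \<in> K" for x y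
    using nz[OF k(4)[OF that]] d[OF that] by auto
  show "s (x / y) = s x / s y" if "x \<in> K" "y \<in> K" for x y
  proof (cases "y = 0")
    case False
    have "s (x / y) * s y = s x" using m[OF k(6)[OF that] that(2)] False by simp
    thus ?thesis using nz[OF that(2)] False by (simp add: field_simps)
  qed (simp add: z)
qed

lemma hom_on_sum:
  assumes K: "is_subfield K" and s: "hom_on K s" and "\<And>i. i \<in> S \<Longrightarrow> f i \<in> K"
  shows "s (\<Sum>i\<in>S. f i) = (\<Sum>i\<in>S. s (f i))"
  using assms(3)
  by (induction S rule: infinite_finite_induct) (auto simp: fhomD[OF K s] is_subfield_sum[OF K])

lemma hom_on_power:
  assumes K: "is_subfield K" and s: "hom_on K s" and "x \<in> K"
  shows "s (x ^ n) = s x ^ n"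
  using assms(3) by (induction n) (auto simp: fhomD[OF K s] is_subfield_power[OF K])

text \<open>Fractions are allowed, so no inverses in \<open>F[a]\<close> have to be constructed.\<close>

definition simple_ext :: "'b::field set \<Rightarrow> 'b \<Rightarrow> 'b set" where
  "simple_ext F a = {poly r a / poly s a | r s. coeffs_in F r \<and> coeffs_in F s \<and> poly s a \<noteq> 0}"

lemma simple_ext_incl:
  assumes F: "is_subfield F" shows "F \<subseteq> simple_ext F a" "a \<in> simple_ext F a"
proof -
  have "c \<in> simple_ext F a" if "c \<in> F" for c
    unfolding simple_ext_def using that coeffs_in_simps[OF F]
    by (intro CollectI exI[of _ "[:c:]"] exI[of _ 1]) auto
  thus "F \<subseteq> simple_ext F a" by blast
  show "a \<in> simple_ext F a"
    unfolding simple_ext_def using coeffs_in_simps[OF F] subfldD(1,2)[OF F]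
    by (intro CollectI exI[of _ "[:0, 1:]"] exI[of _ 1]) auto
qed

lemma is_subfield_simple_ext:
  assumes F: "is_subfield F" shows "is_subfield (simple_ext F a)"
proof -
  have I: "poly r a / poly s a \<in> simple_ext F a" if "coeffs_in F r" "coeffs_in F s" "poly s a \<noteq> 0" for r s
    using that by (auto simp: simple_ext_def)
  have "x + y \<in> simple_ext F a \<and> x - y \<in> simple_ext F a \<and> x * y \<in> simple_ext F a \<and> x / y \<in> simple_ext F a"
    if "x \<in> simple_ext F a" "y \<in> simple_ext F a" for x y
  proof -
    from that obtain r s r' s' where x: "coeffs_in F r" "coeffs_in F s" "poly s a \<noteq> 0" "x = poly r a / poly s a"
      and y: "coeffs_in F r'" "coeffs_in F s'" "poly s' a \<noteq> 0" "y = poly r' a / poly s' a"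
      by (auto simp: simple_ext_def)
    have nn: "poly (s * s') a \<noteq> 0" using x y by simp
    have e: "x + y = poly (r * s' + r' * s) a / poly (s * s') a" "x - y = poly (r * s' - r' * s) a / poly (s * s') a"
      "x * y = poly (r * r') a / poly (s * s') a"
      unfolding x(4) y(4) using x(3) y(3) by (simp_all add: field_simps)
    have "x + y \<in> simple_ext F a" "x - y \<in> simple_ext F a" "x * y \<in> simple_ext F a"
      unfolding e by (intro I coeffs_in_simps[OF F] x y nn)+
    moreover have "x / y \<in> simple_ext F a"
    proof (cases "poly r' a = 0")
      case True
      thus ?thesis using y simple_ext_incl(1)[OF F, of a] subfldD(1)[OF F] by auto
    next
      case False
      have "x / y = poly (r * s') a / poly (s * r') a" unfolding x(4) y(4) by simp
      thus ?thesis using I[of "r * s'" "s * r'"] x y False by (simp add: coeffs_in_simps[OF F])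
    qed
    ultimately show ?thesis by blast
  qed
  thus ?thesis using simple_ext_incl(1)[OF F, of a] subfldD(1,2)[OF F] by (auto simp: is_subfield_def)
qed

text \<open>The map \<open>r(a) / t(a) -> r(b) / t(b)\<close> is well defined, because equality of
  two fractions at \<open>a\<close> is the vanishing of a polynomial over \<open>F\<close> at
  \<open>a\<close>, which transfers to \<open>b\<close>.\<close>

lemma simple_ext_hom:
  assumes F: "is_subfield F" and conj: "\<And>r. coeffs_in F r \<Longrightarrow> poly r a = 0 \<longleftrightarrow> poly r b = 0"
  obtains s where "hom_on (simple_ext F a) s" "s a = b" "\<And>c. c \<in> F \<Longrightarrow> s c = c"
proof -
  define s where "s x = (SOME y. \<exists>r t. coeffs_in F r \<and> coeffs_in F t \<and> poly t a \<noteq> 0 \<and>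
     x = poly r a / poly t a \<and> y = poly r b / poly t b)" for x
  have s: "s (poly r a / poly t a) = poly r b / poly t b" if rt: "coeffs_in F r" "coeffs_in F t" "poly t a \<noteq> 0" for r t
    unfolding s_def
  proof (rule someI2_ex)
    fix y assume "\<exists>r' t'. coeffs_in F r' \<and> coeffs_in F t' \<and> poly t' a \<noteq> 0 \<and>
       poly r a / poly t a = poly r' a / poly t' a \<and> y = poly r' b / poly t' b"
    then obtain r' t' where r': "coeffs_in F r'" "coeffs_in F t'" "poly t' a \<noteq> 0"
       "poly r a / poly t a = poly r' a / poly t' a" "y = poly r' b / poly t' b" by blast
    have "poly (r * t' - r' * t) a = 0" using r' rt by (simp add: field_simps)
    moreover have "coeffs_in F (r * t' - r' * t)" by (intro coeffs_in_simps[OF F] r' rt)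
    ultimately have "poly (r * t' - r' * t) b = 0" using conj by blast
    moreover have "poly t b \<noteq> 0" "poly t' b \<noteq> 0" using conj r' rt by auto
    ultimately show "y = poly r b / poly t b" unfolding r' by (simp add: field_simps)
  qed (use rt in blast)
  have sc: "s c = c" if "c \<in> F" for c
    using s[of "[:c:]" 1] that by (simp add: coeffs_in_simps[OF F])
  have "s a = b" using s[of "[:0, 1:]" 1] by (simp add: coeffs_in_simps[OF F] subfldD(1,2)[OF F])
  moreover have "hom_on (simple_ext F a) s"
    unfolding hom_on_def
  proof (intro conjI ballI)
    show "s 1 = 1" using sc subfldD(2)[OF F] by simp
    fix x y assume "x \<in> simple_ext F a" "y \<in> simple_ext F a"
    then obtain r t r' t' where x: "coeffs_in F r" "coeffs_in F t" "poly t a \<noteq> 0" "x = poly r a / poly t a"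
      and y: "coeffs_in F r'" "coeffs_in F t'" "poly t' a \<noteq> 0" "y = poly r' a / poly t' a"
      by (auto simp: simple_ext_def)
    have nb: "poly t b \<noteq> 0" "poly t' b \<noteq> 0" using conj x y by auto
    have "x + y = poly (r * t' + r' * t) a / poly (t * t') a"
      unfolding x(4) y(4) using x(3) y(3) by (simp add: field_simps)
    hence e: "s (x + y) = poly (r * t' + r' * t) b / poly (t * t') b"
      using s[of "r * t' + r' * t" "t * t'"] x y by (simp add: coeffs_in_simps[OF F])
    have e': "s x = poly r b / poly t b" "s y = poly r' b / poly t' b" using x y s by auto
    show "s (x + y) = s x + s y" unfolding e e' using nb by (simp add: field_simps)
    have "x * y = poly (r * r') a / poly (t * t') a"
      using x y by simp
    hence "s (x * y) = poly (r * r') b / poly (t * t') b"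
      using s[of "r * r'" "t * t'"] x y by (simp add: coeffs_in_simps[OF F])
    thus "s (x * y) = s x * s y" using x y s by simp
  qed
  ultimately show thesis using that sc by blast
qed

text \<open>A solution satisfies \<open>j^3 = 1\<close>. As \<open>p - 1\<close> is 1 modulo 3,
  Fermat's theorem turns this into \<open>j = 1\<close>, so \<open>p\<close> divides 3, against
  \<open>p = 2\<close> modulo 3.\<close>

lemma no_cube_root_of_unity:
  assumes "prime (p::nat)" "[p = 2] (mod 3)" "odd p"
  shows "\<not> p dvd j * (1 + j) + 1"
proof
  assume d: "p dvd j * (1 + j) + 1"
  have nj: "\<not> p dvd j"
  proof
    assume "p dvd j"
    hence "p dvd j * (1 + j)" by simp
    hence "p dvd 1" using d by (metis dvd_add_right_iff)
    thus False using assms(1) by (simp add: prime_nat_iff)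
  qed
  define u where "u = j * (1 + j) + 1"
  have u: "[u = 0] (mod p)" using d by (simp add: u_def cong_0_iff)
  have e: "j ^ 3 + u = 1 + u * j"
    by (simp add: u_def algebra_simps power3_eq_cube)
  have "[j ^ 3 + u = j ^ 3 + 0] (mod p)" "[1 + u * j = 1 + 0 * j] (mod p)"
    by (intro cong_add cong_mult u cong_refl)+
  hence j3: "[j ^ 3 = 1] (mod p)" unfolding e using cong_sym cong_trans by force
  have "p mod 3 = 2" using assms(2) by (simp add: cong_def)
  hence "p = 3 * (p div 3) + 2" using mult_div_mod_eq[of 3 p] by simp
  then obtain k where k: "p - 1 = 3 * k + 1" by (intro that[of "p div 3"]) simp
  have "[j ^ (p - 1) = 1] (mod p)" by (rule fermat_theorem[OF assms(1) nj])
  moreover have "[j ^ (p - 1) = j] (mod p)"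
  proof -
    have "[(j ^ 3) ^ k * j = 1 ^ k * j] (mod p)" by (intro cong_mult cong_pow j3 cong_refl)
    thus ?thesis unfolding k power_add power_mult by simp
  qed
  ultimately have j1: "[j = 1] (mod p)" using cong_sym cong_trans by blast
  have "[j * (1 + j) + 1 = 1 * (1 + 1) + 1] (mod p)"
    by (intro cong_add cong_mult j1 cong_refl)
  hence "[1 * (1 + 1) + 1 = 0] (mod p)"
    using u unfolding u_def by (rule cong_trans[OF cong_sym])
  hence "[3 = 0] (mod p)" by (simp add: numeral_3_eq_3)
  hence "p dvd 3" by (simp add: cong_0_iff)
  hence "p = 3" using assms(1) primes_dvd_imp_eq[of p 3] by simp
  thus False using assms(2) by (simp add: cong_def)
qed

section \<open>Fields of definition of points\<close>

definition pt_over :: "'b set \<Rightarrow> 'b point \<Rightarrow> bool" where "pt_over F T \<longleftrightarrow> set_point T \<subseteq> F"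

lemma pt_over_simps [simp]: "pt_over F Infinity" "pt_over F (Affine x y) \<longleftrightarrow> x \<in> F \<and> y \<in> F"
  by (auto simp: pt_over_def)

lemma pt_over_mono: "pt_over F T \<Longrightarrow> F \<subseteq> F' \<Longrightarrow> pt_over F' T"
  by (auto simp: pt_over_def)

definition W_over :: "'b set \<Rightarrow> 'b weierstrass \<Rightarrow> bool" where
  "W_over F W \<longleftrightarrow> set_weierstrass W \<subseteq> F"

lemma W_overD: "W_over F W \<Longrightarrow> wa1 W \<in> F" "W_over F W \<Longrightarrow> wa2 W \<in> F" "W_over F W \<Longrightarrow> wa3 W \<in> F"
   "W_over F W \<Longrightarrow> wa4 W \<in> F" "W_over F W \<Longrightarrow> wa6 W \<in> F"
  by (cases W; auto simp: W_over_def)+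

lemma W_over_mono: "W_over F W \<Longrightarrow> F \<subseteq> F' \<Longrightarrow> W_over F' W"
  by (auto simp: W_over_def)

lemma slope_over:
  assumes F: "is_subfield F" and W: "W_over F W" and "pt_over F S" "pt_over F T"
  shows "slope W S T \<in> F"
  using assms(3,4) W_overD[OF W]
  by (cases S; cases T) (auto simp: slope_def is_subfield_closed[OF F])

lemma ec_add_affine:
  "ec_add W (Affine x1 y1) (Affine x2 y2) = (if x1 = x2 \<and> y1 + y2 + wa1 W * x1 + wa3 W = 0 then Infinity
     else let l = slope W (Affine x1 y1) (Affine x2 y2); x3 = l\<^sup>2 + wa1 W * l - wa2 W - x1 - x2
       in Affine x3 (- (l + wa1 W) * x3 - (y1 - l * x1) - wa3 W))"
  by (auto simp: slope_def Let_def)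

lemma ec_add_over:
  assumes F: "is_subfield F" and W: "W_over F W" and "pt_over F S" "pt_over F T"
  shows "pt_over F (ec_add W S T)"
proof (cases S; cases T)
  fix x1 y1 x2 y2 assume ST: "S = Affine x1 y1" "T = Affine x2 y2"
  have l: "slope W (Affine x1 y1) (Affine x2 y2) \<in> F"
    using slope_over[OF F W] assms(3,4) ST by blast
  show ?thesis using assms(3,4) l W_overD[OF W] unfolding ST ec_add_affine Let_def
    by (simp add: is_subfield_closed[OF F])
qed (use assms in auto)

lemma slope_hom:
  assumes F: "is_subfield F" and W: "W_over F W" and s: "hom_on F s" "\<And>c. c \<in> set_weierstrass W \<Longrightarrow> s c = c"
    and "pt_over F S" "pt_over F T"
  shows "slope W (map_point s S) (map_point s T) = s (slope W S T)"
proof -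
  have sc: "s (wa1 W) = wa1 W" "s (wa2 W) = wa2 W" "s (wa3 W) = wa3 W" "s (wa4 W) = wa4 W" "s (wa6 W) = wa6 W"
    using s(2) by (cases W; auto)+
  have num: "s (numeral n) = numeral n" for n
  proof -
    have "s (of_nat k) = of_nat k" for k
      by (induction k) (auto simp: fhomD[OF F s(1)] is_subfield_closed[OF F] is_subfield_of_nat[OF F])
    from this[of "numeral n"] show ?thesis by simp
  qed
  show ?thesis using assms(5,6) W_overD[OF W]
    by (cases S; cases T)
      (auto simp: slope_def fhomD[OF F s(1)] hom_on_power[OF F s(1)] sc num is_subfield_closed[OF F])
qed

lemma ec_add_hom:
  assumes F: "is_subfield F" and W: "W_over F W" and s: "hom_on F s" "\<And>c. c \<in> set_weierstrass W \<Longrightarrow> s c = c"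
    and "pt_over F S" "pt_over F T"
  shows "ec_add W (map_point s S) (map_point s T) = map_point s (ec_add W S T)"
proof (cases S; cases T)
  have sc: "s (wa1 W) = wa1 W" "s (wa2 W) = wa2 W" "s (wa3 W) = wa3 W" "s (wa4 W) = wa4 W" "s (wa6 W) = wa6 W"
    using s(2) by (cases W; auto)+
  fix x1 y1 x2 y2 assume ST: "S = Affine x1 y1" "T = Affine x2 y2"
  define l where "l = slope W (Affine x1 y1) (Affine x2 y2)"
  have mem: "x1 \<in> F" "y1 \<in> F" "x2 \<in> F" "y2 \<in> F" using assms(5,6) ST by auto
  have l: "l \<in> F" using slope_over[OF F W] assms(5,6) ST unfolding l_def by blast
  have sl: "slope W (Affine (s x1) (s y1)) (Affine (s x2) (s y2)) = s l"
    using slope_hom[OF F W s, of S T] assms(5,6) unfolding ST l_def by simp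
  have cond: "s x1 = s x2 \<and> s y1 + s y2 + wa1 W * s x1 + wa3 W = 0 \<longleftrightarrow>
     x1 = x2 \<and> y1 + y2 + wa1 W * x1 + wa3 W = 0"
  proof -
    have "s (y1 + y2 + wa1 W * x1 + wa3 W) = s y1 + s y2 + wa1 W * s x1 + wa3 W"
      using mem W_overD[OF W] by (simp add: fhomD[OF F s(1)] sc is_subfield_closed[OF F])
    moreover have "y1 + y2 + wa1 W * x1 + wa3 W \<in> F"
      using mem W_overD[OF W] by (simp add: is_subfield_closed[OF F])
    ultimately show ?thesis using fhomD(7)[OF F s(1)] fhomD(8)[OF F s(1)] mem by metis
  qed
  have um: "s (- x) = - s x" if "x \<in> F" for x
    using fhomD(5)[OF F s(1) subfldD(1)[OF F] that] fhomD(1)[OF F s(1)] by simp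
  show ?thesis unfolding ST point.map ec_add_affine sl cond l_def[symmetric] Let_def
    using l mem W_overD[OF W]
    by (auto simp: fhomD[OF F s(1)] hom_on_power[OF F s(1)] um sc is_subfield_closed[OF F])
qed auto

context ell_curve begin

lemma mul_over:
  assumes F: "is_subfield F" and W: "W_over F W" and "pt_over F T"
  shows "pt_over F (mul T n)"
  by (induction n) (auto intro: ec_add_over[OF F W] assms)

lemma mul_hom:
  assumes F: "is_subfield F" and W: "W_over F W" and s: "hom_on F s" "\<And>c. c \<in> set_weierstrass W \<Longrightarrow> s c = c"
    and T: "pt_over F T"
  shows "mul (map_point s T) n = map_point s (mul T n)"
  by (induction n) (auto simp: ec_add_hom[OF F W s] mul_over[OF F W] T)

end

context ec_torsion_point begin

text \<open>\<open>w\<close>, the curve and the multiples of \<open>P\<close> are fixed by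
  \<open>s\<close>, so \<open>T\<close> is the only ingredient that moves. Thus \<open>s\<close>
  permutes the zeros of \<open>eigenfun w\<close> defined over \<open>F\<close>.\<close>

lemma eigenfun_hom:
  assumes F: "is_subfield F" and W: "W_over F W" and s: "hom_on F s" "\<And>c. c \<in> set_weierstrass W \<Longrightarrow> s c = c"
    and PF: "pt_over F P" "map_point s P = P" and w: "w \<in> F" "s w = w" and T: "pt_over F T"
  shows "eigenfun w (map_point s T) = s (eigenfun w T)"
proof -
  have a: "wa1 W \<in> F" "s (wa1 W) = wa1 W" using W_overD[OF W] s(2) by (cases W; auto)+
  have um: "s (- x) = - s x" if "x \<in> F" for x
    using fhomD(5)[OF F s(1) subfldD(1)[OF F] that] fhomD(1)[OF F s(1)] by simp
  have mo: "pt_over F (mul P i)" for i by (rule mul_over[OF F W PF(1)])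
  have mP: "map_point s (mul P i) = mul P i" for i using mul_hom[OF F W s PF(1), of i] PF(2) by simp
  have cs: "slope_const i \<in> F" "s (slope_const i) = slope_const i" for i
    using slope_over[OF F W PF(1) mo[of i]] slope_hom[OF F W s PF(1) mo[of i]] mP[of i] PF(2) a um
    by (auto simp: slope_const_def is_subfield_closed[OF F])
  have sl: "slope W T (mul P i) \<in> F" "s (slope W T (mul P i)) = slope W (map_point s T) (mul P i)" for i
    using slope_over[OF F W T mo[of i]] slope_hom[OF F W s T mo[of i]] mP[of i] by auto
  have 1: "s (\<Sum>i=1..<p. w ^ i * slope_const i) = (\<Sum>i=1..<p. w ^ i * slope_const i)"
    by (subst hom_on_sum[OF F s(1)])
      (auto simp: fhomD[OF F s(1)] hom_on_power[OF F s(1)] is_subfield_closed[OF F] w cs)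
  have 2: "s (\<Sum>i=1..<p. w ^ i * slope W T (mul P i)) = (\<Sum>i=1..<p. w ^ i * slope W (map_point s T) (mul P i))"
    by (subst hom_on_sum[OF F s(1)])
      (auto simp: fhomD[OF F s(1)] hom_on_power[OF F s(1)] is_subfield_closed[OF F] w sl)
  have m: "(\<Sum>i=1..<p. w ^ i * slope_const i) \<in> F" "(\<Sum>i=1..<p. w ^ i * slope W T (mul P i)) \<in> F"
    by (intro is_subfield_sum[OF F] subfldD(5)[OF F] is_subfield_power[OF F] w cs sl)+
  show ?thesis unfolding eigenfun_def
    using m w by (simp add: fhomD[OF F s(1)] is_subfield_closed[OF F] 1[simplified] 2[simplified])
qed

end

section \<open>Rationality of the root of unity and conjugation of the second basis point\<close>

context ec_torsion_basis begin

text \<open>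
  The minimal polynomial of \<open>w\<close> over \<open>M\<close> divides both \<open>1 + t + \<dots> + t ^ (p - 1)\<close> and \<open>eigenfun t Q\<close>, whose only
  common root \<open>w\<close> is simple.
\<close>

lemma root_in_field:
  assumes M: "is_subfield M" "W_over M W" "pt_over M P" "pt_over M Q" and w: "w ^ p = 1" "w \<noteq> 1" "eigenfun w Q = 0"
    and char: "of_nat p \<noteq> (0::'a)"
  shows "w \<in> M"
proof -
  define f1 where "f1 = [:1, -1:] * (\<Sum>i=1..<p. monom (slope W Q (mul P i)) i) + [:0, 1:] * (\<Sum>i=1..<p. monom (slope_const i) i)"
  define f2 :: "'a poly" where "f2 = (\<Sum>i<p. [:0, 1:] ^ i)"
  have e1: "poly f1 t = eigenfun t Q" for t
    unfolding f1_def eigenfun_def poly_add poly_mult poly_sum poly_monom by (simp add: mult.commute algebra_simps)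
  have e2: "[:0, 1:] ^ p - 1 = ([:0, 1:] - 1) * f2" unfolding f2_def by (rule power_diff_1_eq)
  have e2': "t ^ p - 1 = (t - 1) * poly f2 t" for t
    using arg_cong[OF e2, of "\<lambda>f. poly f t"] by simp
  have e21: "poly f2 1 = of_nat p" by (simp add: f2_def poly_sum)
  note cs = coeffs_in_simps[OF M(1)]
  have cins: "coeffs_in M (\<Sum>i\<in>I. g i)" if "\<And>i. i \<in> I \<Longrightarrow> coeffs_in M (g i)" for g :: "nat \<Rightarrow> 'a poly" and I
    using that by (induction I rule: infinite_finite_induct) (auto simp: cs)
  have mo: "pt_over M (mul P i)" for i by (rule mul_over[OF M(1,2,3)])
  have csM: "slope_const i \<in> M" for i
    using slope_over[OF M(1,2,3) mo] W_overD(1)[OF M(2)] by (auto simp: slope_const_def is_subfield_closed[OF M(1)])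
  have slM: "slope W Q (mul P i) \<in> M" for i by (rule slope_over[OF M(1,2,4) mo])
  have mem: "0 \<in> M" "1 \<in> M" "-1 \<in> M" using is_subfield_closed[OF M(1)] by auto
  have c1: "coeffs_in M f1" unfolding f1_def by (intro cs cins csM slM mem)
  have cX: "coeffs_in M ([:0, 1:] ^ i)" for i by (induction i) (auto simp: cs mem simp del: mult_pCons_left)
  have c2: "coeffs_in M f2" unfolding f2_def by (intro cins cX)
  have f2w: "poly f2 w = 0" using e2'[of w] w by simp
  have f2nz: "f2 \<noteq> 0" using e21 char by auto
  obtain m where m: "minpol M w m" using ex_minpol[OF c2 f2nz f2w] by blast
  obtain q1 q2 where q: "f1 = q1 * m" "f2 = q2 * m"
    using minpol_dvd[OF M(1) m c1] minpol_dvd[OF M(1) m c2 f2w] e1 w by metis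
  have "poly m w = 0" using m by (simp add: minpol_def)
  then obtain m1 where m1: "m = [:-w, 1:] * m1" unfolding poly_eq_0_iff_dvd by (elim dvdE)
  have mnz: "m \<noteq> 0" using m by (simp add: minpol_def)
  hence m1nz: "m1 \<noteq> 0" using m1 by auto
  have dm: "degree m = degree m1 + 1" unfolding m1 using m1nz by (simp add: degree_mult_eq del: mult_pCons_left)
  show ?thesis
  proof (cases "degree m1 = 0")
    case True
    thus ?thesis using minpol_degree_1[OF M(1) m] dm by simp
  next
    case False
    then obtain t where t: "poly m1 t = 0" using alg_closed_imp_poly_has_root[of m1] by auto
    have mt: "poly m t = 0" unfolding m1 poly_mult t by simp
    have tp: "t ^ p = 1" using e2'[of t] q(2) mt by simp
    have t1: "t \<noteq> 1" using e21 char q(2) mt by auto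
    have "eigenfun t Q = 0" using e1[of t] q(1) mt by simp
    hence tw: "t = w" using root_at_Q_unique[OF tp t1 w(1,2)] w(3) by simp
    obtain m2 where m2: "m1 = [:-w, 1:] * m2" using t unfolding tw poly_eq_0_iff_dvd by (elim dvdE)
    define g where "g = ([:0, 1:] - 1) * q2 * m2"
    \<comment> \<open>A second factor \<open>X - w\<close> in \<open>m\<close> would make
      \<open>w\<close> a double root of \<open>X^p - 1\<close>, whose derivative
      \<open>p w^(p - 1)\<close> is nonzero there.\<close>
    have "[:0, 1:] ^ p - 1 = [:-w, 1:] * ([:-w, 1:] * g)"
      unfolding e2 q(2) m1 m2 g_def by (simp only: mult_ac)
    hence "pderiv ([:0, 1:] ^ p - 1) = pderiv ([:-w, 1:] * ([:-w, 1:] * g))" by simp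
    hence "poly (pderiv ([:0, 1:] ^ p - 1)) w = 0" by (simp only: pderiv_mult poly_add poly_mult) simp
    hence "of_nat p * w ^ (p - 1) = 0"
      by (simp add: pderiv_diff pderiv_power pderiv_pCons)
    moreover have "w \<noteq> 0" using w p_ge by (metis power_0_left zero_neq_one not_numeral_le_zero)
    ultimately show ?thesis using char by simp
  qed
qed

text \<open>
  A conjugate \<open>u\<close> of \<open>x2\<close> over \<open>L\<close> is the abscissa of another intersection of the horizontal line through \<open>Q\<close>
  with the curve, and it exists because otherwise this line is tangent at \<open>Q\<close>, so that \<open>3 Q = O\<close> or \<open>2 Q\<close> is
  defined over \<open>L\<close>. Let \<open>s\<close> send \<open>x2\<close> to \<open>u\<close>, so \<open>s Q = i P + j Q\<close>. If \<open>s\<close> permuted the three intersections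
  cyclically, their sum \<open>O\<close> would give \<open>j\<^sup>2 + j + 1 = 0\<close> modulo \<open>p\<close>. Hence \<open>s\<close> interchanges two of them and
  \<open>j = -1\<close>; the third one is a multiple of \<open>P\<close>. Over a field containing \<open>w\<close> this is impossible, because \<open>s\<close>
  would preserve the zeros \<open>Q + \<langle>P\<rangle>\<close> of \<open>eigenfun w\<close>.
\<close>

lemma conj_dichotomy:
  assumes L1: "is_subfield L1" "W_over L1 W" "pt_over L1 P" and L: "is_subfield L" "L1 \<subseteq> L"
    and Qxy: "Q = Affine x2 y2" "y2 \<in> L" "x2 \<notin> L"
    and p3: "[p = 2] (mod 3)"
    and w: "w ^ p = 1" "w \<noteq> 1" "eigenfun w Q = 0"
    and N: "is_subfield N" "L1 \<subseteq> N" "w \<in> N"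
  shows "y2 \<in> L1" "x2 \<in> N"
proof -
  \<comment> \<open>In the application \<open>L1 = K(x1, y1)\<close>,
    \<open>L = K(x1, y1, y2)\<close> and \<open>N = K(x1, y1, \<zeta>)\<close>.\<close>
  have WL: "W_over L W" "pt_over L P" using W_over_mono pt_over_mono L1 L by blast+
  have WN: "W_over N W" "pt_over N P" using W_over_mono pt_over_mono L1 N by blast+
  have cQ: "on_curve W x2 y2" using Q Qxy by simp
  have pnd: "\<not> p dvd 2" "\<not> p dvd 1" using p_ge by (auto dest: dvd_imp_le)
  have pnd3: "\<not> p dvd 3"
  proof
    assume "p dvd 3"
    hence "p = 3" using p_ge dvd_imp_le[of p 3] by simp
    thus False using p3 by (simp add: cong_def)
  qed
  have QnI: "Q \<noteq> Infinity" using Qxy by simp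
  define c where "c = [:a6 - y2\<^sup>2 - a3 * y2, a4 - a1 * y2, a2, 1:]"
  have c_iff: "poly c x = 0 \<longleftrightarrow> on_curve W x y2" for x
    by (auto simp: c_def on_curve_def algebra_simps power2_eq_square power3_eq_cube)
  have cc: "coeffs_in L c" unfolding c_def
    using W_overD[OF WL(1)] Qxy(2) by (intro coeffs_in_simps[OF L(1)]) (auto simp: is_subfield_closed[OF L(1)])
  have dc: "degree c = 3" "c \<noteq> 0" by (simp_all add: c_def)
  have "poly c x2 = 0" using c_iff cQ by simp
  then obtain m where m: "minpol L x2 m" using ex_minpol[OF cc dc(2)] by blast
  obtain q where q: "c = q * m" using minpol_dvd[OF L(1) m cc \<open>poly c x2 = 0\<close>] by blast
  have qnz: "q \<noteq> 0" "m \<noteq> 0" using q dc by auto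
  have dqm: "degree q + degree m = 3" using q dc qnz by (simp add: degree_mult_eq)
  have dm: "degree m \<ge> 2" using minpol_degree_1[OF L(1) m] minpol_degree[OF m] Qxy(3) by (cases "degree m = 1") auto
  have "poly m x2 = 0" using m by (simp add: minpol_def)
  then obtain m1 where m1: "m = [:-x2, 1:] * m1" unfolding poly_eq_0_iff_dvd by (elim dvdE)
  have m1nz: "m1 \<noteq> 0" using m1 qnz by auto
  have dm1: "degree m = degree m1 + 1" unfolding m1 using m1nz by (simp add: degree_mult_eq del: mult_pCons_left)

  \<comment> \<open>Otherwise \<open>m\<close>, of degree at least 2, has \<open>x2\<close> as its
    only root, so \<open>x2\<close> is at least a double root of \<open>c\<close>. This is the
    possibly inseparable case.\<close>
  have "\<exists>u. u \<noteq> x2 \<and> poly m u = 0"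
  proof (rule ccontr)
    assume "\<not> ?thesis"
    hence only: "poly m u = 0 \<Longrightarrow> u = x2" for u by blast
    obtain t where t: "poly m1 t = 0" using alg_closed_imp_poly_has_root[of m1] dm dm1 by auto
    have "poly m t = 0" unfolding m1 poly_mult t by simp
    hence "t = x2" by (rule only)
    then obtain m2 where m2: "m1 = [:-x2, 1:] * m2" using t unfolding poly_eq_0_iff_dvd by (elim dvdE) simp
    have m2nz: "m2 \<noteq> 0" using m2 m1nz by auto
    have dm2: "degree m1 = degree m2 + 1" unfolding m2 using m2nz by (simp add: degree_mult_eq del: mult_pCons_left)
    have "degree (m2 * q) = 1" using m2nz qnz dqm dm1 dm2 by (simp add: degree_mult_eq)
    hence "m2 * q = [:coeff (m2 * q) 0, coeff (m2 * q) 1:]"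
      by (intro poly_eqI) (auto simp: coeff_pCons coeff_eq_0 split: nat.splits)
    then obtain k0 k1 where k: "m2 * q = [:k0, k1:]" by blast
    have ce: "c = [:-x2, 1:] * ([:-x2, 1:] * [:k0, k1:])"
      unfolding q m1 m2 k[symmetric] by (simp only: mult_ac)
    have k1: "k1 = 1" using arg_cong[OF ce, of "\<lambda>f. coeff f 3"] by (simp add: c_def eval_nat_numeral)
    have ce2: "a2 = k0 - 2 * x2" using arg_cong[OF ce, of "\<lambda>f. coeff f 2"] unfolding k1 by (simp add: c_def eval_nat_numeral)
    have ce1: "a4 - a1 * y2 = x2\<^sup>2 - 2 * x2 * k0"
      using arg_cong[OF ce, of "\<lambda>f. coeff f 1"] unfolding k1 by (simp add: c_def algebra_simps power2_eq_square)
    define v where "v = - a2 - 2 * x2"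
    have Q2: "mul Q 2 = ec_add W Q Q" using mul_add[OF Q(1), of 1 1] Q by (simp add: numeral_2_eq_2)
    have "mul Q 2 \<noteq> Infinity" using mul_eq_Infinity_iff[OF Q QnI] pnd by simp
    hence QQn: "ec_add W (Affine x2 y2) (Affine x2 y2) \<noteq> Infinity" unfolding Q2 unfolding Qxy .
    have no: "\<not> (x2 = x2 \<and> y2 + y2 + a1 * x2 + a3 = 0)"
    proof
      assume "x2 = x2 \<and> y2 + y2 + a1 * x2 + a3 = 0"
      from QQn[unfolded ec_add.simps if_P[OF this]] show False by simp
    qed
    have "3 * x2\<^sup>2 + 2 * a2 * x2 + a4 - a1 * y2 = 3 * x2\<^sup>2 + 2 * (k0 - 2 * x2) * x2 + (x2\<^sup>2 - 2 * x2 * k0)"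
      unfolding ce1[symmetric] ce2[symmetric] by simp
    also have "\<dots> = 0" by Groebner_Basis.algebra
    finally have sl: "slope W (Affine x2 y2) (Affine x2 y2) = 0" by (simp add: slope_def)
    have v2: "0\<^sup>2 + a1 * 0 - a2 - x2 - x2 = v" by (simp add: v_def)
    have QQ: "mul Q 2 = Affine v (- y2 - a1 * v - a3)"
      unfolding Q2 unfolding Qxy line_third_point(1)[OF cQ cQ no, unfolded sl v2] by simp
    show False
    proof (cases "v = x2")
      case True
      hence "mul Q 2 = ec_neg W Q" using QQ Qxy by simp
      hence "ec_add W (mul Q 2) Q = Infinity"
        using ec_add_eq_Infinity_iff[OF neg_points[OF Q(1)] Q(1)] by simp
      moreover have "ec_add W (mul Q 2) Q = mul Q 3" using mul_simps(3)[of Q 2] by (simp add: numeral_3_eq_3 numeral_2_eq_2)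
      ultimately show False using mul_eq_Infinity_iff[OF Q QnI] pnd3 by simp
    next
      case False
      have "v = - k0" unfolding v_def ce2 by simp
      hence "poly c v = 0" unfolding ce k1 poly_mult by simp
      moreover have "poly m v \<noteq> 0" using only False by blast
      ultimately have "poly q v = 0" unfolding q by simp
      have "degree q \<noteq> 0"
      proof
        assume "degree q = 0"
        then obtain e where "q = [:e:]" by (rule degree_eq_zeroE)
        thus False using \<open>poly q v = 0\<close> qnz by simp
      qed
      hence "degree m2 = 0" using dqm dm1 dm2 by simp
      then obtain e where e: "m2 = [:e:]" by (rule degree_eq_zeroE)
      \<comment> \<open>Now \<open>v\<close> is a simple root of \<open>c\<close> split off by
        \<open>q\<close>, and \<open>m\<close> is a multiple of \<open>(X - x2)^2\<close>. Its
        middle coefficient puts \<open>2 * x2\<close>, though perhaps not \<open>x2\<close>, into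
        \<open>L\<close>; in characteristic 2 this element is just 0.\<close>
      have me: "m = [:x2 * x2 * e, - 2 * x2 * e, e:]" unfolding m1 m2 e by (simp add: algebra_simps)
      have "e \<noteq> 0" using m2nz e by simp
      hence "2 * x2 = - coeff m 1 / coeff m 2" unfolding me by (simp add: eval_nat_numeral)
      also have "\<dots> \<in> L" using m by (auto simp: minpol_def coeffs_in_def is_subfield_closed[OF L(1)])
      finally have "2 * x2 \<in> L" .
      hence "v \<in> L" unfolding v_def using W_overD[OF WL(1)] by (auto simp: is_subfield_closed[OF L(1)])
      hence "pt_over L (mul Q 2)" unfolding QQ using Qxy(2) W_overD[OF WL(1)] by (simp add: is_subfield_closed[OF L(1)])
      \<comment> \<open>As \<open>p\<close> is odd, \<open>(p + 1) / 2\<close> inverts doubling on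
        \<open>E[p]\<close>, so \<open>Q\<close> would be defined over \<open>L\<close>.\<close>
      hence "pt_over L (mul (mul Q 2) ((p + 1) div 2))" by (rule mul_over[OF L(1) WL(1)])
      also have "mul (mul Q 2) ((p + 1) div 2) = mul Q (Suc p)"
        unfolding mul_mul[OF Q(1)] using p(2) by simp
      also have "\<dots> = Q" using Q by simp
      finally show False using Qxy by simp
    qed
  qed
  then obtain u where u: "u \<noteq> x2" "poly m u = 0" by blast
  have cu: "on_curve W u y2" using c_iff[of u] u q by simp
  define T where "T = Affine u y2"
  have TP: "T \<in> ec_points W" using cu by (simp add: T_def)
  define v where "v = - a2 - x2 - u"
  have no: "\<not> (x2 = u \<and> y2 + y2 + a1 * x2 + a3 = 0)" using u by auto
  have sl: "slope W (Affine x2 y2) (Affine u y2) = 0" using u by (simp add: slope_def)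
  have v2: "0\<^sup>2 + a1 * 0 - a2 - x2 - u = v" by (simp add: v_def)
  note third = line_third_point[OF cQ cu no, unfolded sl v2]
  have QT: "ec_add W Q T = Affine v (- y2 - a1 * v - a3)" unfolding Qxy T_def third(1) by simp
  have s2: "x2 * u + x2 * v + u * v = a4 - a1 * y2" and s3: "x2 * u * v = y2\<^sup>2 + a3 * y2 - a6"
    using third(4) by (simp_all add: collinear_def)
  have roots: "x = x2 \<or> x = u \<or> x = v" if "on_curve W x y2" for x
  proof -
    have "(x - x2) * (x - u) * (x - v) = x ^ 3 - (x2 + u + v) * x\<^sup>2 + (x2 * u + x2 * v + u * v) * x - x2 * u * v"
      by Groebner_Basis.algebra
    also have "x2 + u + v = - a2" by (simp add: v_def)
    also have "x ^ 3 - (- a2) * x\<^sup>2 + (x2 * u + x2 * v + u * v) * x - x2 * u * v = 0"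
      unfolding s2 s3 using that by (simp add: on_curve_def algebra_simps)
    finally have "(x - x2) * (x - u) * (x - v) = 0" .
    thus ?thesis by auto
  qed

  obtain s where s: "hom_on (simple_ext L x2) s" "s x2 = u" "\<And>c. c \<in> L \<Longrightarrow> s c = c"
    using simple_ext_hom[OF L(1), of x2 u] minpol_conj[OF L(1) m u(2)] by blast
  define M where "M = simple_ext L x2"
  have M: "is_subfield M" "L \<subseteq> M" "x2 \<in> M"
    unfolding M_def using is_subfield_simple_ext[OF L(1)] simple_ext_incl[OF L(1)] by auto
  have sM: "hom_on M s" using s M_def by simp
  have WM: "W_over M W" "pt_over M P" using W_over_mono pt_over_mono WL M by blast+
  have sW: "s c = c" if "c \<in> set_weierstrass W" for c using that s(3) WL by (auto simp: W_over_def)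
  have sP: "map_point s P = P" using WL(2) s(3) by (cases P) auto
  have QM: "pt_over M Q" unfolding Qxy using M Qxy(2) by auto
  have sQ: "map_point s Q = T" unfolding Qxy T_def using s Qxy(2) by simp
  have "mul T p = Infinity" using mul_hom[OF M(1) WM(1) sM sW QM, of p] sQ Q by simp
  then obtain i j where ij: "T = lincomb i j" using lincomb_span TP by blast
  \<comment> \<open>\<open>s\<close> fixes \<open>P\<close> and sends \<open>Q\<close> to
    \<open>T = i P + j Q\<close>, hence \<open>T\<close> to \<open>i P + j T\<close>.\<close>
  have sT: "map_point s T = lincomb (i + i * j) (j * j)"
  proof -
    have "map_point s (lincomb i j) = ec_add W (map_point s (mul P i)) (map_point s (mul Q j))"
      unfolding lincomb_def
      using ec_add_hom[OF M(1) WM(1) sM sW mul_over[OF M(1) WM] mul_over[OF M(1) WM(1) QM]] by simp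
    also have "\<dots> = ec_add W (mul P i) (mul T j)"
      using mul_hom[OF M(1) WM(1) sM sW WM(2)] mul_hom[OF M(1) WM(1) sM sW QM] sP sQ by simp
    also have "\<dots> = ec_add W (lincomb i 0) (lincomb (i * j) (j * j))" unfolding ij lincomb_mul lincomb_simps(1) ..
    also have "\<dots> = lincomb (i + i * j) (j * j)" unfolding lincomb_add by simp
    finally show ?thesis unfolding ij .
  qed
  \<comment> \<open>So \<open>u\<close> lies in \<open>L(x2)\<close>, the domain of
    \<open>s\<close>, and \<open>s u\<close> is again the abscissa of one of the three
    points.\<close>
  have TM: "pt_over M T" unfolding ij lincomb_def by (intro ec_add_over[OF M(1) WM(1)] mul_over[OF M(1) WM(1)] WM QM)
  hence uM: "u \<in> M" by (simp add: T_def)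
  have sT': "map_point s T = Affine (s u) y2" unfolding T_def using s(3)[OF Qxy(2)] by simp
  hence "on_curve W (s u) y2" using lincomb_closed[of "i + i * j" "j * j"] sT by simp
  hence "s u = x2 \<or> s u = u \<or> s u = v" by (rule roots)
  moreover have "s u \<noteq> u" using fhomD(8)[OF M(1) sM uM M(3)] s(2) u(1) by simp
  moreover have "s u \<noteq> v"
  proof
    assume "s u = v"
    hence "map_point s T = ec_neg W (ec_add W Q T)" unfolding sT' QT by simp
    hence "ec_add W (map_point s T) (ec_add W Q T) = Infinity"
      using ec_add_eq_Infinity_iff[OF _ ec_add_closed[OF Q(1) TP]] neg_points[OF ec_add_closed[OF Q(1) TP]] by simp
    moreover have "ec_add W Q T = lincomb i (1 + j)" using lincomb_add[of 0 1 i j] lincomb_simps(3) ij by simp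
    ultimately have "lincomb (i + i * j + i) (j * j + (1 + j)) = Infinity" unfolding sT by (simp only: lincomb_add)
    hence "p dvd j * j + (1 + j)" unfolding lincomb_eq_Infinity by simp
    hence "p dvd j * (1 + j) + 1" by (simp add: algebra_simps)
    thus False using no_cube_root_of_unity[OF p(1) p3 p(2)] by simp
  qed
  ultimately have "s u = x2" by blast
  hence "lincomb 0 1 = lincomb (i + i * j) (j * j)" using sT sT' lincomb_simps(3) Qxy by simp
  from lincomb_eqD[OF this] have ci: "[0 = i + i * j] (mod p)" and cj: "[1 = j * j] (mod p)" .
  \<comment> \<open>With \<open>j = 1\<close> the map would be a shear \<open>Q -> Q + i P\<close>;
    its square is the identity on \<open>Q\<close> only if \<open>2 i = 0\<close>, that is, if
    \<open>T = Q\<close>.\<close>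
  have j1: "\<not> [j = 1] (mod p)"
  proof
    assume j: "[j = 1] (mod p)"
    have "[i + i * j = i + i * 1] (mod p)" by (intro cong_add cong_mult j cong_refl)
    hence "[0 = i + i * 1] (mod p)" using ci cong_trans by blast
    hence "p dvd 2 * i" using cong_0_iff cong_sym by (metis mult_2 mult_1_right)
    hence "p dvd i" using p(1) pnd prime_dvd_mult_iff by blast
    hence "mul P i = Infinity" using mP_Infinity by simp
    moreover have "mul Q j = mul Q 1"
      using mul_mod[OF Q, of j] mul_mod[OF Q, of 1] j by (simp add: cong_def)
    ultimately have "T = Q" unfolding ij lincomb_def using Q by simp
    thus False using u(1) Qxy T_def by simp
  qed
  have jn0: "j \<noteq> 0"
  proof
    assume "j = 0"
    hence "[1 = 0] (mod p)" using cj by simp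
    thus False using pnd(2) unfolding cong_0_iff by blast
  qed
  have "p dvd (j - 1) * (j + 1)"
  proof -
    have "p dvd j * j - 1" using cj jn0 by (metis cong_altdef_nat cong_sym mult_le_mono One_nat_def Suc_leI mult_1 neq0_conv)
    moreover have "j * j - 1 = (j - 1) * (j + 1)" by (cases j) (auto simp: algebra_simps)
    ultimately show ?thesis by simp
  qed
  moreover have "\<not> p dvd j - 1" using j1 jn0 by (metis cong_altdef_nat One_nat_def Suc_leI neq0_conv)
  ultimately have pj: "p dvd j + 1" using p(1) prime_dvd_mult_iff by blast
  have "ec_add W Q T = lincomb i (1 + j)" using lincomb_add[of 0 1 i j] lincomb_simps(3) ij by simp
  also have "\<dots> = mul P i"
    unfolding lincomb_def using mul_eq_Infinity_iff[OF Q QnI, of "1 + j"] pj by simp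
  finally have "pt_over L1 (ec_add W Q T)" using mul_over[OF L1] by simp
  \<comment> \<open>\<open>t\<close> is the ordinate of \<open>Q + T = i P\<close>. Negation is an
    involution, so \<open>y2\<close> is recovered from \<open>t\<close> and \<open>v\<close> over
    \<open>L1\<close>.\<close>
  moreover define t where "t = - y2 - a1 * v - a3"
  ultimately have vL: "v \<in> L1" and "t \<in> L1" unfolding QT by simp_all
  hence "- t - a1 * v - a3 \<in> L1" using W_overD[OF L1(2)] by (intro is_subfield_closed[OF L1(1)])
  thus y2: "y2 \<in> L1" by (simp add: t_def)

  show "x2 \<in> N"
  proof (rule ccontr)
    assume xN: "x2 \<notin> N"
    have su: "x2 + u \<in> L1"
    proof -
      have "- a2 - v \<in> L1" using vL W_overD[OF L1(2)] by (intro is_subfield_closed[OF L1(1)])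
      thus ?thesis by (simp add: v_def)
    qed
    have pu: "x2 * u \<in> L1"
    proof -
      define t where "t = x2 + u"
      have "a4 - a1 * y2 - v * t \<in> L1"
        using vL su[folded t_def] y2 W_overD[OF L1(2)] by (intro is_subfield_closed[OF L1(1)])
      also have "a4 - a1 * y2 - v * t = x2 * u" unfolding s2[symmetric] t_def by (simp add: algebra_simps)
      finally show ?thesis .
    qed
    \<comment> \<open>With \<open>v\<close> in \<open>L1\<close>, Vieta's relations give
      \<open>x2 + u\<close> and \<open>x2 * u\<close> in \<open>L1\<close>. If \<open>x2\<close> is
      not in \<open>N\<close>, this quadratic is up to a constant its minimal polynomial over
      \<open>N\<close>, so \<open>u\<close> is conjugate to \<open>x2\<close> over \<open>N\<close>
      too.\<close>
    define d where "d = [:x2 * u, - (x2 + u), 1:]"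
    have "x2 * u \<in> N" "- (x2 + u) \<in> N" using su pu N is_subfield_minus[OF N(1)] by blast+
    hence "coeffs_in N d" unfolding d_def using subfldD(2)[OF N(1)] by (intro coeffs_in_simps[OF N(1)])
    hence d: "coeffs_in N d" "d \<noteq> 0" "poly d x2 = 0" "poly d u = 0" "degree d = 2"
      by (simp_all add: d_def algebra_simps)
    obtain n where n: "minpol N x2 n" using ex_minpol[OF d(1,2,3)] by blast
    obtain r where r: "d = r * n" using minpol_dvd[OF N(1) n d(1,3)] by blast
    have rnz: "r \<noteq> 0" "n \<noteq> 0" using r d by auto
    have "degree n \<ge> 2" using minpol_degree_1[OF N(1) n] minpol_degree[OF n] xN by (cases "degree n = 1") auto
    moreover have "degree r + degree n = 2" using d(5) unfolding r degree_mult_eq[OF rnz] .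
    ultimately have "degree r = 0" by simp
    then obtain r0 where "r = [:r0:]" by (rule degree_eq_zeroE)
    hence "poly n u = 0" using d(4) r rnz by simp
    from minpol_conj[OF N(1) n this] obtain s' where s': "hom_on (simple_ext N x2) s'" "s' x2 = u" "\<And>c. c \<in> N \<Longrightarrow> s' c = c"
      using simple_ext_hom[OF N(1), of x2 u] by blast
    let ?M = "simple_ext N x2"
    have M': "is_subfield ?M" "N \<subseteq> ?M" "x2 \<in> ?M"
      using is_subfield_simple_ext[OF N(1)] simple_ext_incl[OF N(1)] by auto
    have "eigenfun w (map_point s' Q) = s' (eigenfun w Q)"
    proof (rule eigenfun_hom[OF M'(1) _ s'(1)])
      show "W_over ?M W" "pt_over ?M P" using W_over_mono pt_over_mono WN M' by blast+
      show "s' c = c" if "c \<in> set_weierstrass W" for c using that s'(3) WN by (auto simp: W_over_def)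
      show "map_point s' P = P" using WN(2) s'(3) by (cases P) auto
      show "w \<in> ?M" "s' w = w" using N M' s' by auto
      show "pt_over ?M Q" unfolding Qxy using M' y2 N by auto
    qed
    also have "\<dots> = 0" using w fhomD(1)[OF M'(1) s'(1)] by simp
    also have "map_point s' Q = T" unfolding T_def Qxy using s' y2 N by auto
    also note ij
    finally have h: "eigenfun w (lincomb i j) = 0" .
    have "\<not> p dvd j" using pj pnd by (metis dvd_add_right_iff)
    from zero_at_lincomb[OF w h this] j1 show False by simp
  qed
qed

end

section \<open>Base change to the algebraic closure and the division field\<close>

lemma W_over_map: "W_over (adjoin S) (map_weierstrass to_ac E)"
  using adjoin_incl(2) by (fastforce simp: W_over_def weierstrass.set_map)

lemma elliptic_map: "elliptic_curve E \<Longrightarrow> elliptic_curve (map_weierstrass to_ac E)"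
proof -
  have "w_discriminant (map_weierstrass to_ac E) = to_ac (w_discriminant E)"
    by (cases E) (simp add: w_discriminant_def Let_def)
  thus "elliptic_curve E \<Longrightarrow> elliptic_curve (map_weierstrass to_ac E)" by (simp add: elliptic_curve_def)
qed

theorem theorem3p4:
  fixes E :: "'k::field weierstrass"
    and p :: nat
    and x1 y1 x2 y2 \<zeta> :: "'k alg_closure"
  assumes "elliptic_curve E"
    and "prime p" and "odd p" and "[p = 2] (mod 3)" and "p \<noteq> CHAR('k)"
    and "torsion_basis (ec_closure_group E) p (Affine x1 y1) (Affine x2 y2)"
    and "primitive_root_of_unity p \<zeta>"
  shows "division_field E p = adjoin {x1, y1, y2} \<or> division_field E p = adjoin {x1, y1, \<zeta>}"
proof -
  define W where "W = map_weierstrass to_ac E"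
  have basis: "torsion_basis (ec_group W) p (Affine x1 y1) (Affine x2 y2)"
    using assms(6) by (simp add: ec_closure_group_def W_def)
  interpret ell_curve W by unfold_locales (simp add: W_def elliptic_map assms)
  interpret ec_torsion_basis W p "Affine x1 y1" "Affine x2 y2"
    by unfold_locales (use basis assms in \<open>auto simp: torsion_basis_def torsion_def\<close>)
  have char: "of_nat p \<noteq> (0 :: 'k alg_closure)"
  proof
    assume "of_nat p = (0 :: 'k alg_closure)"
    hence "CHAR('k) dvd p" by (simp add: of_nat_eq_0_iff_char_dvd)
    moreover have "CHAR('k) \<noteq> 1" by (simp add: CHAR_not_1)
    ultimately show False using assms(2,5) by (metis prime_nat_iff)
  qed
  have WS: "W_over (adjoin S) W" for S unfolding W_def by (rule W_over_map)
  have inS: "x \<in> S \<Longrightarrow> x \<in> adjoin S" for x S using adjoin_incl(1) by blast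
  define M where "M = adjoin {x1, y1, x2, y2}"
  have M: "is_subfield M" "W_over M W" "pt_over M (Affine x1 y1)" "pt_over M (Affine x2 y2)"
    unfolding M_def by (auto simp: is_subfield_adjoin WS inS)
  have div: "division_field E p = M"
  proof
    have "set_point T \<subseteq> M" if "T \<in> torsion (ec_group W) p" for T
    proof -
      have "T \<in> ec_points W" "mul T p = Infinity" using that by (auto simp: torsion_def)
      then obtain i j where "T = lincomb i j" using lincomb_span by blast
      hence "pt_over M T" unfolding lincomb_def
        by (auto intro: ec_add_over[OF M(1,2)] mul_over[OF M(1,2)] M simp del: pt_over_simps)
      thus ?thesis by (simp add: pt_over_def)
    qed
    hence "coordinates (torsion (ec_group W) p) \<subseteq> M" by (auto simp: coordinates_def)
    thus "division_field E p \<subseteq> M"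
      unfolding division_field_def M_def ec_closure_group_def W_def by (rule adjoin_mono_closed)
    have "Affine x1 y1 \<in> torsion (ec_group W) p" "Affine x2 y2 \<in> torsion (ec_group W) p"
      using basis by (simp_all add: torsion_basis_def)
    hence "{x1, y1, x2, y2} \<subseteq> coordinates (torsion (ec_group W) p)"
      unfolding coordinates_def by force
    thus "M \<subseteq> division_field E p"
      unfolding division_field_def M_def ec_closure_group_def W_def
      using adjoin_incl(1) by (intro adjoin_mono_closed) blast
  qed
  show ?thesis
  proof (cases "x2 \<in> adjoin {x1, y1, y2}")
    case True
    have "M = adjoin {x1, y1, y2}" unfolding M_def
      using True by (intro equalityI adjoin_mono_closed) (auto simp: inS)
    thus ?thesis using div by simp
  next
    case False
    have zp: "\<zeta> ^ p = 1" and zk: "\<And>k. k \<in> {1..<p} \<Longrightarrow> \<zeta> ^ k \<noteq> 1"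
      using assms(7) by (auto simp: primitive_root_of_unity_def)
    \<comment> \<open>Which power of \<open>\<zeta>\<close> belongs to the coset of the second basis
      point is unknown, but every \<open>k\<close> prime to \<open>p\<close> generates the same
      field: \<open>w\<close> is a power of \<open>\<zeta>\<close> and conversely.\<close>
    obtain k where k: "k \<in> {1..<p}" "eigenfun (\<zeta> ^ k) (Affine x2 y2) = 0"
      using ex_root_at_Q[OF assms(7)] .
    define w where "w = \<zeta> ^ k"
    have w: "w ^ p = 1" "w \<noteq> 1" "eigenfun w (Affine x2 y2) = 0"
      using k zk zp unfolding w_def by (auto simp: power_mult[symmetric] mult.commute[of k]) (simp add: power_mult)
    let ?N = "adjoin {x1, y1, \<zeta>}"
    have wN: "w \<in> ?N" unfolding w_def by (intro is_subfield_power is_subfield_adjoin inS) simp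
    have sub: "adjoin {x1, y1} \<subseteq> ?N" "adjoin {x1, y1} \<subseteq> adjoin {x1, y1, y2}"
      by (intro adjoin_mono_closed; auto simp: inS)+
    have "y2 \<in> adjoin {x1, y1}" "x2 \<in> ?N"
      using conj_dichotomy[of "adjoin {x1, y1}" "adjoin {x1, y1, y2}" x2 y2 w ?N] False w wN assms(4) sub
      by (auto simp: is_subfield_adjoin WS inS)
    hence "M \<subseteq> ?N" unfolding M_def using sub by (intro adjoin_mono_closed) (auto simp: inS)
    moreover have "\<zeta> \<in> M"
    proof -
      have "coprime k p" using k assms(2) by (metis atLeastLessThan_iff coprime_commute dvd_imp_le leD not_one_le_zero prime_imp_coprime neq0_conv)
      then obtain l where "[k * l = 1] (mod p)" using cong_solve_coprime_nat unfolding One_nat_def by blast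
      hence "k * l mod p = 1" using p_ge by (simp add: cong_def)
      hence "k * l = p * (k * l div p) + 1" using mult_div_mod_eq[of p "k * l"] by simp
      hence "w ^ l = (\<zeta> ^ p) ^ (k * l div p) * \<zeta>"
        unfolding w_def power_mult[symmetric] by (metis power_add power_one_right)
      hence "w ^ l = \<zeta>" using zp by simp
      moreover have "w \<in> M" by (rule root_in_field[OF M w char])
      ultimately show ?thesis using is_subfield_power[OF M(1)] by metis
    qed
    hence "?N \<subseteq> M" using M by (intro adjoin_mono_closed[of _ "{x1, y1, x2, y2}", folded M_def]) auto
    ultimately show ?thesis using div by blast
  qed
qed

end
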